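(* Let $(\beta_n)_{n\ge 1}$ be a sequence of positive real numbers, write $\beta=\beta_n$, and assume that $\frac{\log n}{n}\ll\beta\ll\frac{1}{\log n}$. Let $\alpha=\alpha_n=\frac{n\beta}{2}$ (so $\alpha\gg 1$). For each $n$ let $(\lambda_1,\ldots,\lambda_n)$ be distributed according to $P_{n,\alpha,\beta}$. Then $\lambda_{\max}:=\max_{i\le n}\lambda_i$ satisfies a large deviations principle in $\mathbb{R}$ as $n\to\infty$, with speed $n\beta$ and rate function $$J(x)=\begin{cases}\displaystyle -\int\log|x-y|\,\mathrm{d}\sigma(y)+\frac{x^2}{4}-\frac12 & \text{if } x\ge 2,\\[1ex] +\infty & \text{if } x<2.\end{cases}$$
   Context: For real sequences $u=u_n$, $v=v_n$, the notation $u\ll v$ (equivalently $v\gg u$) means $u_n/v_n\to 0$ as $n\to\infty$. For $n\ge 1$ and $\alpha,\beta>0$, $P_{n,\alpha,\beta}$ is the probability measure on $\mathbb{R}^n$ (the Gaussian $\beta$-ensemble) $$P_{n,\alpha,\beta}(\mathrm{d}\lambda_1,\ldots,\mathrm{d}\lambda_n)=\frac{1}{Z_{n,\alpha,\beta}}\exp\Big(-\frac{\alpha}{2}\sum_{i=1}^n\lambda_i^2\Big)\prod_{1\le i<j\le n}|\lambda_i-\lambda_j|^{\beta}\prod_{i=1}^n\mathrm{d}\lambda_i,$$ where $Z_{n,\alpha,\beta}$ is the normalizing constant. $\sigma$ is the semicircle law on $[-2,2]$, i.e. the probability measure with density $\frac{1}{2\pi}\sqrt{4-x^2}\,\mathbf{1}_{[-2,2]}(x)$.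 Large deviations principle with speed $a_n\to\infty$ and rate function $J$ (lower semicontinuous, with values in $[0,+\infty]$): for every closed $F\subset\mathbb{R}$, $\limsup_n \frac{1}{a_n}\log P(\lambda_{\max}\in F)\le-\inf_F J$, and for every open $G\subset\mathbb{R}$, $\liminf_n\frac{1}{a_n}\log P(\lambda_{\max}\in G)\ge-\inf_G J$. Here $a_n=n\beta_n$ and $P=P_{n,\alpha,\beta}$. *)

theory Defs
  imports "HOL-Probability.Probability"
begin

definition much_less :: "(nat \<Rightarrow> real) \<Rightarrow> (nat \<Rightarrow> real) \<Rightarrow> bool"  (infix "\<lless>" 50)
  where "u \<lless> v \<longleftrightarrow> (\<lambda>n. u n / v n) \<longlonglongrightarrow> 0"

text \<open>Points of \<open>\<real>\<^sup>n\<close> are the elements of \<^term>\<open>space (\<Pi>\<^sub>M i\<in>{..<n}. lborel :: real measure)\<close>;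
  coordinates are numbered from \<open>0\<close> to \<open>n - 1\<close>.\<close>

definition gbe_weight :: "nat \<Rightarrow> real \<Rightarrow> real \<Rightarrow> (nat \<Rightarrow> real) \<Rightarrow> real"
  where "gbe_weight n \<alpha> \<beta> x =
    exp (- (\<alpha> / 2) * (\<Sum>i<n. (x i)\<^sup>2)) * (\<Prod>j<n. \<Prod>i<j. \<bar>x i - x j\<bar> powr \<beta>)"

definition gbe_Z :: "nat \<Rightarrow> real \<Rightarrow> real \<Rightarrow> real"
  where "gbe_Z n \<alpha> \<beta> = (LINT x|(\<Pi>\<^sub>M i\<in>{..<n}. lborel). gbe_weight n \<alpha> \<beta> x)"

definition gbe :: "nat \<Rightarrow> real \<Rightarrow> real \<Rightarrow> (nat \<Rightarrow> real) measure"
  where "gbe n \<alpha> \<beta> =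
    density (\<Pi>\<^sub>M i\<in>{..<n}. lborel) (\<lambda>x. ennreal (gbe_weight n \<alpha> \<beta> x / gbe_Z n \<alpha> \<beta>))"

definition lambda_max :: "nat \<Rightarrow> (nat \<Rightarrow> real) \<Rightarrow> real"
  where "lambda_max n x = Max (x ` {..<n})"

definition semicircle :: "real measure"
  where "semicircle =
    density lborel (\<lambda>x. ennreal (1 / (2 * pi) * sqrt (4 - x\<^sup>2) * indicator {-2..2} x))"

text \<open>The value at \<open>y = x\<close>, where \<^term>\<open>ln 0 = (0::real)\<close> by convention,
  is irrelevant because \<^const>\<open>semicircle\<close> has no atoms.\<close>

definition rate_J :: "real \<Rightarrow> ereal"
  where "rate_J x =
    (if x \<ge> 2 then ereal (- (LINT y|semicircle. ln \<bar>x - y\<bar>) + x\<^sup>2 / 4 - 1 / 2) else \<infinity>)"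

text \<open>Logarithm of a probability, with \<open>log 0 = -\<infinity>\<close>.\<close>

definition log_prob :: "real \<Rightarrow> ereal"
  where "log_prob p = (if p = 0 then - \<infinity> else ereal (ln p))"

definition lower_semicontinuous :: "('a::topological_space \<Rightarrow> ereal) \<Rightarrow> bool"
  where "lower_semicontinuous J \<longleftrightarrow> (\<forall>c. closed {x. J x \<le> c})"

text \<open>The random variables \<open>X n\<close> are defined on the probability spaces \<open>M n\<close>; \<open>a\<close> is the speed and
  \<open>J\<close> the rate function. The infimum over the empty set is \<open>\<infinity>\<close>. The rate function is not
  required to have compact sublevel sets.\<close>

definition large_deviations_principle ::
  "(nat \<Rightarrow> 'a measure) \<Rightarrow> (nat \<Rightarrow> 'a \<Rightarrow> 'b::topological_space) \<Rightarrow> (nat \<Rightarrow> real) \<Rightarrow> ('b \<Rightarrow> ereal) \<Rightarrow> bool"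
  where "large_deviations_principle M X a J \<longleftrightarrow>
    filterlim a at_top sequentially \<and>
    (\<forall>x. 0 \<le> J x) \<and> lower_semicontinuous J \<and>
    (\<forall>F. closed F \<longrightarrow>
      limsup (\<lambda>n. ereal (1 / a n) * log_prob \<P>(\<omega> in M n. X n \<omega> \<in> F)) \<le> - (INF x\<in>F. J x)) \<and>
    (\<forall>G. open G \<longrightarrow>
      - (INF x\<in>G. J x) \<le> liminf (\<lambda>n. ereal (1 / a n) * log_prob \<P>(\<omega> in M n. X n \<omega> \<in> G)))"

end

theory Submission
  imports Defs
begin

text \<open>
  Throughout, \<open>a = n \<beta>\<close> is the speed, so that \<open>\<alpha> = a / 2\<close> and the Gaussian factor of the density is
  \<open>exp (- a / 4 * (\<Sum>i. \<lambda>\<^sub>i\<^sup>2))\<close>. Let \<open>U t\<close> be the logarithmic potential of the semicircle law.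

  \<^bold>\<open>One particle in the field of the others.\<close> Integrating out all coordinates but the last one gives
  \<open>P (\<lambda>\<^sub>n \<in> A) = D A / D UNIV\<close>, where \<open>D A\<close> is the expectation, over \<open>n - 1\<close> particles, of
  \<open>\<integral>\<^sub>A exp (- a t\<^sup>2 / 4) \<Prod>\<bar>\<lambda>\<^sub>i - t\<bar>\<^sup>\<beta> dt\<close> (\<open>emeasure_gbe_last\<close>). The quotient of partition functions is
  \<open>D UNIV\<close>, so it is estimated in the same way as \<open>D A\<close>. If the empirical measure is close to the
  semicircle law, then \<open>D A\<close> is \<open>exp (a * sup\<^sub>A (U t - t\<^sup>2 / 4))\<close> up to factors \<open>exp (o a)\<close>. Now \<open>U t - t\<^sup>2 / 4\<close> is at
  most \<open>- 1 / 2\<close> everywhere, and equals \<open>- 1 / 2 - J t\<close> for \<open>t \<ge> 2\<close>, where \<open>J\<close> is continuous and strictly increasing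
  with \<open>J 2 = 0\<close>. Hence \<open>P (\<lambda>\<^sub>n \<ge> x)\<close> decays like \<open>exp (- a * J x)\<close>. By exchangeability
  \<open>P (\<lambda>max \<ge> x)\<close> lies between this quantity and \<open>n\<close> times it, and the factor \<open>n\<close> is negligible because
  \<open>log n\<close> is much smaller than \<open>a\<close>. Since \<open>J\<close> is strictly increasing, subtracting two such tails gives the lower bound
  for short intervals.

  \<^bold>\<open>Concentration of the empirical measure.\<close> It is needed with probability \<open>1 - exp (- M a)\<close> for every \<open>M\<close>, and a
  change of variables supplies it. Substitute \<open>\<lambda>\<^sub>i + \<epsilon> f \<lambda>\<^sub>i\<close> for every \<open>\<lambda>\<^sub>i\<close> in the integral of the weight:
  the integral does not change, while the integrand is multiplied by at least the exponential of
  \<open>\<epsilon> * \<beta> / 2 * Y - C\<close>, where \<open>Y = (\<Sum>i j. (f \<lambda>\<^sub>i - f \<lambda>\<^sub>j) / (\<lambda>\<^sub>i - \<lambda>\<^sub>j)) - n * (\<Sum>i. \<lambda>\<^sub>i * f \<lambda>\<^sub>i)\<close> and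
  \<open>C\<close> is of order \<open>\<epsilon> * n + \<epsilon>\<^sup>2 * n\<^sup>2 * \<beta>\<close>. So \<open>E (exp (\<epsilon> * \<beta> / 2 * Y)) \<le> exp C\<close>
  (\<open>loop_defect_exponential_bound\<close>). For a small fixed \<open>\<epsilon>\<close>, Markov's inequality bounds the probability of
  \<open>Y \<ge> \<delta> * n\<^sup>2\<close> by \<open>exp (- c * n\<^sup>2 * \<beta>)\<close>, and \<open>n\<^sup>2 * \<beta> = n * a\<close> is far larger than \<open>a\<close>. For the resolvent functions
  \<open>f t = Re (c / (z - t))\<close>, \<open>Y\<close> is essentially \<open>n\<^sup>2 * Re (c * (s\<^sup>2 - z * s + 1))\<close> with \<open>s\<close> the Stieltjes transform of the
  empirical measure. Thus \<open>s\<close> almost solves the equation \<open>s\<^sup>2 - z * s + 1 = 0\<close> of the semicircle law. With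
  \<open>\<epsilon>\<close> of order \<open>1 / n\<close> and \<open>f t = - t / sqrt (1 + t\<^sup>2)\<close> the same inequality bounds
  \<open>E (exp (t * \<beta> * (\<Sum>i. sqrt (1 + \<lambda>\<^sub>i\<^sup>2))))\<close> by \<open>exp (3 * t * a)\<close>, which controls particles far away.

  \<^bold>\<open>From resolvents to potentials.\<close> The roots of \<open>s\<^sup>2 - z * s + 1\<close> are \<open>w\<close> and \<open>1 / w\<close> with \<open>w\<close> in the upper half plane,
  while \<open>s\<close> lies in the lower one, so \<open>s\<close> is close to \<open>1 / w\<close> (\<open>root_of_approximate_quadratic\<close>). Integrating along a
  vertical line from far away, the smoothed empirical potential \<open>(\<Sum>i. log \<bar>x + \<i> * h - \<lambda>\<^sub>i\<bar>) / n\<close> is close to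
  \<open>log \<bar>w\<bar> + Re (1 / w\<^sup>2) / 2\<close> (\<open>log_mean_close\<close>). The smoothing costs nothing in upper bounds, because
  \<open>\<bar>x - y\<bar> \<le> \<bar>x + \<i> * h - y\<bar>\<close>; in lower bounds Jensen's inequality in \<open>t\<close> absorbs the singularities, as
  \<open>log \<bar>t - y\<bar>\<close> is integrable.

  \<^bold>\<open>No mass is lost on the left.\<close> If all particles are at most \<open>c < 2\<close>, take \<open>E\<close> between \<open>c\<close> and \<open>2\<close> (and nonnegative):
  the Stieltjes transform at \<open>E + \<i> * h\<close> is almost real, and \<open>s\<^sup>2 - E * s + 1 \<ge> 1 - E\<^sup>2 / 4 > 0\<close> for real \<open>s\<close>. The
  approximate equation therefore fails, an event of probability at most \<open>exp (- M a)\<close> for every \<open>M\<close>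
  (\<open>prob_max_left\<close>).
\<close>

section \<open>The outer root of the semicircle equation\<close>

text \<open>
  The solution of \<open>w + 1 / w = z\<close> outside the unit disc (inverse Joukowski map), for \<open>z\<close> in the upper half plane. Writing
  it with \<open>csqrt (4 - z\<^sup>2)\<close> rather than \<open>csqrt (z\<^sup>2 - 4)\<close> keeps the argument of the root off its branch cut there.
\<close>

definition outer_root :: "complex \<Rightarrow> complex"
  where "outer_root z = (z + \<i> * csqrt (4 - z\<^sup>2)) / 2"

text \<open>
  The logarithmic potential of the semicircle law in the upper half plane: the real part of a primitive of
  \<open>1 / outer_root z\<close>, normalised to behave like \<open>ln (cmod z)\<close> at infinity.
\<close>

definition plane_potential :: "complex \<Rightarrow> real"
  where "plane_potential z = ln (cmod (outer_root z)) + Re (1 / (outer_root z)\<^sup>2) / 2"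

lemma four_minus_square_off_cut:
  assumes "Im z > 0"
  shows "4 - z\<^sup>2 \<notin> \<real>\<^sub>\<le>\<^sub>0"
proof
  assume "4 - z\<^sup>2 \<in> \<real>\<^sub>\<le>\<^sub>0"
  then have im: "Im (4 - z\<^sup>2) = 0" and re: "Re (4 - z\<^sup>2) \<le> 0"
    by (auto simp: complex_nonpos_Reals_iff)
  from im assms have "Re z = 0" by (simp add: power2_eq_square)
  with re zero_le_square[of "Im z"] show False by (simp add: power2_eq_square)
qed

lemma Re_csqrt_pos:
  assumes "z \<notin> \<real>\<^sub>\<le>\<^sub>0" shows "Re (csqrt z) > 0"
  using assms Re_csqrt[of z] csqrt_principal[of z]
  by (metis complex_nonpos_Reals_iff csqrt_eq_0 csqrt_of_real_nonpos less_eq_real_def nonpos_Reals_zero_I order_less_le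
        power2_csqrt complex_eq_iff Re_power2 Im_power2 mult_zero_left mult_zero_right zero_power2 diff_0 neg_le_0_iff_le zero_le_power2)

lemma outer_root_Im_pos:
  assumes "Im z > 0" shows "Im (outer_root z) > 0"
  using add_pos_pos[OF assms Re_csqrt_pos[OF four_minus_square_off_cut[OF assms]]]
  by (simp add: outer_root_def del: csqrt.sel)

lemma two_outer_root: "2 * outer_root z = z + \<i> * csqrt (4 - z\<^sup>2)"
  by (simp only: outer_root_def) (simp del: csqrt.sel)

lemma outer_root_quadratic: "(outer_root z)\<^sup>2 - z * outer_root z + 1 = 0"
proof -
  define c where "c = csqrt (4 - z\<^sup>2)"
  have "c\<^sup>2 = 4 - z\<^sup>2" by (simp add: c_def)
  then have c: "c * c = 4 - z * z" by (simp add: power2_eq_square)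
  have "4 * ((outer_root z)\<^sup>2 - z * outer_root z + 1)
      = (2 * outer_root z)\<^sup>2 - 2 * z * (2 * outer_root z) + 4"
    by (simp add: power2_eq_square algebra_simps)
  also have "\<dots> = 4 - z * z - c * c"
    unfolding two_outer_root c_def[symmetric] by (simp add: power2_eq_square algebra_simps)
  also have "\<dots> = 0" by (simp add: c)
  finally show ?thesis by (simp only: mult_eq_0_iff) simp
qed

lemma outer_root_nonzero: "outer_root z \<noteq> 0"
  using outer_root_quadratic[of z] by auto

lemma outer_root_sum: "outer_root z + 1 / outer_root z = z"
  using outer_root_quadratic[of z] outer_root_nonzero[of z]
  by (simp add: field_simps power2_eq_square)

lemma Im_inverse_root: 
  assumes "w \<noteq> 0" shows "Im (w + 1 / w) = Im w * (1 - 1 / (cmod w)\<^sup>2)"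
  by (simp add: Im_divide cmod_def algebra_simps)

lemma outer_root_bounds:
  assumes "Im z > 0"
  shows "cmod (outer_root z) > 1" "Im z \<le> Im (outer_root z)"
proof -
  let ?w = "outer_root z"
  have eq: "Im z = Im ?w * (1 - 1 / (cmod ?w)\<^sup>2)"
    using Im_inverse_root[OF outer_root_nonzero[of z]] by (simp only: outer_root_sum)
  have pos: "Im ?w > 0" by (rule outer_root_Im_pos[OF assms])
  then have "1 - 1 / (cmod ?w)\<^sup>2 > 0" using eq assms by (simp add: zero_less_mult_iff)
  moreover have "cmod ?w > 0" using outer_root_nonzero by simp
  ultimately have "(cmod ?w)\<^sup>2 > 1" by (simp add: field_simps)
  then show "cmod ?w > 1" by (metis norm_ge_zero one_power2 power2_less_imp_less)
  have "Im ?w * (1 - 1 / (cmod ?w)\<^sup>2) \<le> Im ?w * 1"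
    using pos by (intro mult_left_mono) auto
  then show "Im z \<le> Im ?w" using eq by simp
qed

text \<open>
  The polynomial factors as \<open>(s - 1 / w) * (s - w)\<close>, and the second factor is bounded below because \<open>s\<close> and \<open>w\<close> lie on
  different sides of the real axis.
\<close>

lemma root_of_approximate_quadratic:
  assumes z: "Im z > 0" and s: "Im s \<le> 0"
  shows "cmod (s - 1 / outer_root z) \<le> cmod (s\<^sup>2 - z * s + 1) / Im z"
proof -
  let ?w = "outer_root z"
  have "s\<^sup>2 - z * s + 1 = s\<^sup>2 - (?w + 1 / ?w) * s + 1" by (simp only: outer_root_sum)
  also have "\<dots> = (s - 1 / ?w) * (s - ?w)"
    using outer_root_nonzero[of z] by (simp add: field_simps power2_eq_square)
  finally have eq: "cmod (s\<^sup>2 - z * s + 1) = cmod (s - 1 / ?w) * cmod (s - ?w)"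
    by (simp add: norm_mult)
  have "Im z \<le> Im ?w - Im s" using outer_root_bounds(2)[OF z] s by simp
  also have "\<dots> \<le> cmod (s - ?w)" using abs_Im_le_cmod[of "s - ?w"] by simp
  finally have "cmod (s - 1 / ?w) * Im z \<le> cmod (s - 1 / ?w) * cmod (s - ?w)"
    by (intro mult_left_mono) auto
  then show ?thesis using z eq by (simp add: field_simps)
qed

lemma outer_root_has_derivative:
  assumes "Im z > 0"
  shows "(outer_root has_field_derivative
      outer_root z / (outer_root z - 1 / outer_root z)) (at z)"
proof -
  note cut = four_minus_square_off_cut[OF assms]
  let ?c = "csqrt (4 - z\<^sup>2)"
  have c0: "?c \<noteq> 0" using cut by auto
  have "?c * \<i> = 2 * outer_root z - z" unfolding two_outer_root by simp
  also have "\<dots> = outer_root z - 1 / outer_root z"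
    using outer_root_sum[of z] by (simp add: algebra_simps)
  finally have c: "\<i> * ?c = outer_root z - 1 / outer_root z" by (simp add: mult.commute)
  have "(outer_root has_field_derivative (1 + \<i> * (- (2 * z) / (2 * ?c))) / 2) (at z)"
    unfolding outer_root_def
    by (rule derivative_eq_intros refl cut | simp add: field_simps)+
  moreover have "(1 + \<i> * (- (2 * z) / (2 * ?c))) / 2 = outer_root z / (\<i> * ?c)"
    using c0 by (simp add: outer_root_def field_simps)
  ultimately show ?thesis by (simp only: c)
qed

text \<open>
  With \<open>F = Ln w + 1 / (2 * w\<^sup>2)\<close> one has \<open>F' = w' * (1 / w - 1 / w ^ 3) = 1 / w\<close>, because
  \<open>w' = w / (w - 1 / w)\<close>.
\<close>

lemma plane_potential_has_derivative:
  assumes "t > 0"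
  shows "((\<lambda>t. plane_potential (Complex x t)) has_real_derivative
     - Im (1 / outer_root (Complex x t))) (at t)"
proof -
  let ?z = "Complex x t"
  let ?w = "outer_root ?z"
  let ?F = "\<lambda>z. Ln (outer_root z) + 1 / (2 * (outer_root z)\<^sup>2)"
  have im: "Im ?z > 0" using assms by simp
  have w0: "?w \<noteq> 0" by (rule outer_root_nonzero)
  have wcut: "?w \<notin> \<real>\<^sub>\<le>\<^sub>0" using outer_root_Im_pos[OF im] by (auto simp: complex_nonpos_Reals_iff)
  have sq: "?w\<^sup>2 \<noteq> 1"
    using outer_root_bounds(1)[OF im] by (metis less_irrefl norm_one norm_power power_one one_less_power pos2)
  have "?w - 1 / ?w \<noteq> 0" using sq w0 by (simp add: field_simps power2_eq_square)
  moreover have "1 / ?w - 1 / ?w ^ 3 = (?w - 1 / ?w) / ?w\<^sup>2"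
    using w0 by (simp add: field_simps eval_nat_numeral)
  ultimately have key: "?w / (?w - 1 / ?w) * (1 / ?w - 1 / ?w ^ 3) = 1 / ?w"
    using w0 by (simp add: power2_eq_square)
  define d where "d = ?w / (?w - 1 / ?w)"
  note der = outer_root_has_derivative[OF im, folded d_def]
  have "(?F has_field_derivative d * (1 / ?w - 1 / ?w ^ 3)) (at ?z)"
    by (rule derivative_eq_intros der refl wcut w0 | simp add: w0)+
       (use w0 in \<open>simp add: field_simps eval_nat_numeral\<close>)
  then have "(?F has_field_derivative ?w / (?w - 1 / ?w) * (1 / ?w - 1 / ?w ^ 3)) (at ?z)"
    by (simp only: d_def)
  then have "(?F has_field_derivative 1 / ?w) (at ?z)" by (simp only: key)
  moreover have "((\<lambda>t. Complex x t) has_vector_derivative \<i>) (at t)"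
    by (auto simp: has_vector_derivative_complex_iff intro!: derivative_eq_intros)
  ultimately have "((?F \<circ> (\<lambda>t. Complex x t)) has_vector_derivative \<i> * (1 / ?w)) (at t)"
    by (intro field_vector_diff_chain_at)
  then have "((\<lambda>t. Re (?F (Complex x t))) has_real_derivative Re (\<i> * (1 / ?w))) (at t)"
    by (auto simp: has_vector_derivative_complex_iff o_def)
  moreover have "Re (?F (Complex x t)) = plane_potential (Complex x t)" for t
  proof -
    have "1 / (2 * (outer_root (Complex x t))\<^sup>2) = (1 / (outer_root (Complex x t))\<^sup>2) / 2" by simp
    then show ?thesis
      by (simp only: plane_potential_def plus_complex.sel Re_Ln[OF outer_root_nonzero] Re_divide_numeral)
  qed
  ultimately show ?thesis by (simp only: Re_i_times)
qed

section \<open>The potential on the real line and the rate function\<close>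

definition outer_root_real :: "real \<Rightarrow> real"
  where "outer_root_real x = (x + sqrt (x\<^sup>2 - 4)) / 2"

definition line_potential :: "real \<Rightarrow> real"
  where "line_potential x = ln (outer_root_real x) + 1 / (2 * (outer_root_real x)\<^sup>2)"

text \<open>
  The finite branch of the rate function, see \<open>rate_J_eq\<close> below.
\<close>

definition excess :: "real \<Rightarrow> real"
  where "excess x = x\<^sup>2 / 4 - 1 / 2 - line_potential x"

text \<open>
  The excess as a function of the root \<open>w\<close>, where it has the manifestly positive derivative
  \<open>(w\<^sup>2 - 1)\<^sup>2 / (2 * w ^ 3)\<close>.
\<close>

definition excess_at_root :: "real \<Rightarrow> real"
  where "excess_at_root w = w\<^sup>2 / 4 - 1 / (4 * w\<^sup>2) - ln w"

lemma outer_root_real_ge_1: "x \<ge> 2 \<Longrightarrow> outer_root_real x \<ge> 1"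
  using add_mono[of 2 x 0 "sqrt (x\<^sup>2 - 4)"] power_mono[of 2 x 2]
  by (simp add: outer_root_real_def)

lemma outer_root_real_sum:
  assumes "x \<ge> 2" shows "outer_root_real x + 1 / outer_root_real x = x"
proof -
  have "(sqrt (x\<^sup>2 - 4))\<^sup>2 = x\<^sup>2 - 4" using power_mono[of 2 x 2] assms by simp
  then have "outer_root_real x * outer_root_real x - x * outer_root_real x + 1 = 0"
    by (simp add: outer_root_real_def power2_eq_square field_simps)
  then show ?thesis using outer_root_real_ge_1[OF assms] by (simp add: field_simps)
qed

lemma outer_root_real_strict_mono:
  assumes "2 \<le> x" "x < y" shows "outer_root_real x < outer_root_real y"
proof -
  have "x\<^sup>2 \<le> y\<^sup>2" using assms by (intro power_mono) auto
  then have "sqrt (x\<^sup>2 - 4) \<le> sqrt (y\<^sup>2 - 4)" by simp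
  with assms(2) have "x + sqrt (x\<^sup>2 - 4) < y + sqrt (y\<^sup>2 - 4)" by (rule add_less_le_mono)
  then show ?thesis by (simp only: outer_root_real_def divide_strict_right_mono zero_less_numeral)
qed

lemma excess_at_root_strict_mono:
  assumes "1 \<le> v" "v < w" shows "excess_at_root v < excess_at_root w"
proof (rule DERIV_pos_imp_increasing_open[OF assms(2)])
  fix u assume u: "v < u" "u < w"
  then have u1: "u > 1" using assms by simp
  have "(excess_at_root has_real_derivative (u\<^sup>2 - 1)\<^sup>2 / (2 * u ^ 3)) (at u)"
    unfolding excess_at_root_def using u1
    by (auto intro!: derivative_eq_intros simp: field_simps eval_nat_numeral)
  moreover have "(u\<^sup>2 - 1)\<^sup>2 / (2 * u ^ 3) > 0"
    using u1 one_less_power[of u 2] by (intro divide_pos_pos zero_less_power mult_pos_pos) auto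
  ultimately show "\<exists>y. (excess_at_root has_real_derivative y) (at u) \<and> 0 < y" by blast
next
  show "continuous_on {v..w} excess_at_root"
    unfolding excess_at_root_def using assms by (auto intro!: continuous_intros)
qed

lemma excess_at_root_nonneg: "1 \<le> w \<Longrightarrow> excess_at_root w \<ge> 0"
  using excess_at_root_strict_mono[of 1 w] by (cases "w = 1") (auto simp: excess_at_root_def)

lemma excess_eq:
  assumes "x \<ge> 2" shows "excess x = excess_at_root (outer_root_real x)"
proof -
  define w where "w = outer_root_real x"
  have w: "w \<ge> 1" "x = w + 1 / w"
    using outer_root_real_ge_1[OF assms] outer_root_real_sum[OF assms] by (simp_all add: w_def)
  have "x\<^sup>2 / 4 = w\<^sup>2 / 4 + 1 / 2 + 1 / (4 * w\<^sup>2)"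
    unfolding w(2) using w(1) by (simp add: power2_eq_square field_simps)
  then show ?thesis
    by (simp add: excess_def line_potential_def excess_at_root_def w_def[symmetric])
       (use w(1) in \<open>simp add: field_simps\<close>)
qed

lemma excess_2: "excess 2 = 0"
  by (simp add: excess_def line_potential_def outer_root_real_def)

lemma excess_strict_mono: "2 \<le> x \<Longrightarrow> x < y \<Longrightarrow> excess x < excess y"
  by (simp add: excess_eq excess_at_root_strict_mono outer_root_real_strict_mono outer_root_real_ge_1)

lemma excess_mono: "2 \<le> x \<Longrightarrow> x \<le> y \<Longrightarrow> excess x \<le> excess y"
  using excess_strict_mono[of x y] by (cases "x = y") auto

lemma excess_nonneg: "2 \<le> x \<Longrightarrow> excess x \<ge> 0"
  using excess_mono[of 2 x] by (simp add: excess_2)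

lemma continuous_on_excess: "continuous_on {2..} excess"
proof -
  have "outer_root_real x \<noteq> 0" "outer_root_real x > 0" if "x \<ge> 2" for x
    using outer_root_real_ge_1[OF that] by auto
  moreover have "continuous_on {2..} outer_root_real"
    unfolding outer_root_real_def by (intro continuous_intros) auto
  ultimately show ?thesis
    unfolding excess_def line_potential_def
    by (intro continuous_intros) auto
qed

text \<open>
  On the segment \<open>[-2, 2]\<close> itself the potential equals \<open>x\<^sup>2 / 4 - 1 / 2\<close>, and outside it is smaller by the excess; this is the
  version at height \<open>t\<close>. With \<open>w = u + \<i> * v\<close> and \<open>r = cmod w\<close>, the difference of the two sides without the term \<open>2 * t\<close> is the
  convex combination \<open>u\<^sup>2 / r\<^sup>2 * V1 + v\<^sup>2 / r\<^sup>2 * V0\<close>. Here \<open>V1\<close> is minus the excess at \<open>r\<close>, and \<open>V0\<close> is of the order of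
  \<open>r - 1 / r\<close>, which is \<open>t * r / v\<close>.
\<close>

lemma plane_potential_le:
  assumes "t > 0"
  shows "plane_potential (Complex x t) \<le> x\<^sup>2 / 4 - 1 / 2 + 2 * t"
proof -
  define w where "w = outer_root (Complex x t)"
  define u v where "u = Re w" and "v = Im w"
  define r where "r = cmod w"
  have im: "Im (Complex x t) > 0" using assms by simp
  have r1: "r > 1" using outer_root_bounds(1)[OF im] by (simp add: r_def w_def)
  have v0: "v > 0" using outer_root_Im_pos[OF im] by (simp add: v_def w_def)
  have rsq: "r\<^sup>2 = u\<^sup>2 + v\<^sup>2" by (simp add: r_def u_def v_def cmod_power2)
  have rr: "Re (cnj w) = u" "Im (cnj w) = - v" by (simp_all add: u_def v_def)
  have w0: "w \<noteq> 0" using r1 by (auto simp: r_def)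
  have sum: "w + 1 / w = Complex x t" unfolding w_def by (rule outer_root_sum)
  have x: "x = u * (1 + 1 / r\<^sup>2)"
    using arg_cong[OF sum, of Re] by (simp add: Re_divide u_def r_def cmod_power2 algebra_simps)
  have t: "t = v * (1 - 1 / r\<^sup>2)"
    using arg_cong[OF sum, of Im] Im_inverse_root[OF w0] by (simp add: v_def r_def)
  have re: "Re (1 / w\<^sup>2) = (u\<^sup>2 - v\<^sup>2) / (r\<^sup>2)\<^sup>2"
    by (simp add: Re_divide Re_power2 Im_power2 u_def v_def r_def cmod_power2)
       (simp add: power2_eq_square algebra_simps)
  define V1 where "V1 = ln r + 1 / (4 * r\<^sup>2) - r\<^sup>2 / 4"
  define V0 where "V0 = ln r + (1 - 1 / r\<^sup>2) / 2"
  have V1: "V1 \<le> 0" using excess_at_root_nonneg[of r] r1 by (simp add: V1_def excess_at_root_def)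
  have "ln (r\<^sup>2) \<ge> 1 - 1 / r\<^sup>2"
    using ln_le_minus_one[of "1 / r\<^sup>2"] r1 by (simp add: ln_div)
  then have "V0 \<le> 2 * ln r" using r1 by (simp add: V0_def ln_realpow)
  also have "ln r \<le> r - 1" using r1 by (intro ln_le_minus_one) auto
  also have "r - 1 \<le> r - 1 / r" using r1 by (simp add: field_simps)
  also have "r - 1 / r = r * (1 - 1 / r\<^sup>2)" using r1 by (simp add: power2_eq_square field_simps)
  finally have V0: "V0 \<le> 2 * (r * (1 - 1 / r\<^sup>2))" by simp
  have vr: "v \<le> r" using abs_Im_le_cmod[of w] by (simp add: v_def r_def)
  have "plane_potential (Complex x t) - (x\<^sup>2 / 4 - 1 / 2) = u\<^sup>2 / r\<^sup>2 * V1 + v\<^sup>2 / r\<^sup>2 * V0"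
  proof -
    have "plane_potential (Complex x t) = ln r + (u\<^sup>2 - v\<^sup>2) / (r\<^sup>2)\<^sup>2 / 2"
      by (simp only: plane_potential_def w_def[symmetric] r_def[symmetric] re)
    moreover have "x\<^sup>2 = (u * (1 + 1 / r\<^sup>2))\<^sup>2" by (simp only: x)
    moreover have "u\<^sup>2 / r\<^sup>2 * V1 = u\<^sup>2 / r\<^sup>2 * ln r + u\<^sup>2 / r\<^sup>2 * (1 / (4 * r\<^sup>2) - r\<^sup>2 / 4)"
      unfolding V1_def by (simp only: distrib_left[symmetric]) (simp add: algebra_simps)
    moreover have "v\<^sup>2 / r\<^sup>2 * V0 = v\<^sup>2 / r\<^sup>2 * ln r + v\<^sup>2 / r\<^sup>2 * ((1 - 1 / r\<^sup>2) / 2)"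
      unfolding V0_def by (simp only: distrib_left)
    moreover have "ln r = (u\<^sup>2 / r\<^sup>2) * ln r + (v\<^sup>2 / r\<^sup>2) * ln r"
    proof -
      have "u\<^sup>2 / r\<^sup>2 + v\<^sup>2 / r\<^sup>2 = r\<^sup>2 / r\<^sup>2" by (simp only: rsq add_divide_distrib)
      then have "u\<^sup>2 / r\<^sup>2 + v\<^sup>2 / r\<^sup>2 = 1" using r1 by simp
      then show ?thesis by (metis distrib_right mult_1)
    qed
    moreover have "(u\<^sup>2 - v\<^sup>2) / (r\<^sup>2)\<^sup>2 / 2 - ((u * (1 + 1 / r\<^sup>2))\<^sup>2 / 4 - 1 / 2)
        = u\<^sup>2 / r\<^sup>2 * (1 / (4 * r\<^sup>2) - r\<^sup>2 / 4) + v\<^sup>2 / r\<^sup>2 * ((1 - 1 / r\<^sup>2) / 2)"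
    proof -
      define p where "p = r\<^sup>2"
      have "r\<^sup>2 > 0" using r1 by simp
      then have p: "p > 0" "v\<^sup>2 = p - u\<^sup>2" using rsq by (simp_all add: p_def)
      show ?thesis unfolding p_def[symmetric] p(2) using p(1)
        by (simp add: field_simps power2_eq_square)
    qed
    ultimately show ?thesis by linarith
  qed
  also have "\<dots> \<le> 0 + v\<^sup>2 / r\<^sup>2 * (2 * (r * (1 - 1 / r\<^sup>2)))"
    using V0 V1 by (intro add_mono mult_left_mono mult_nonneg_nonpos) auto
  also have "\<dots> = (v / r) * (2 * t)" using r1 unfolding t by (simp add: power2_eq_square)
  also have "\<dots> \<le> 1 * (2 * t)" using vr r1 assms by (intro mult_right_mono) (auto simp: field_simps)
  finally show ?thesis by simp
qed

lemma abs_ln_diff_le: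
  fixes a b :: real
  assumes "a \<ge> 1" "b \<ge> 1" shows "\<bar>ln a - ln b\<bar> \<le> \<bar>a - b\<bar>"
proof -
  have *: "ln a - ln b \<le> \<bar>a - b\<bar>" if "a \<ge> 1" "b \<ge> 1" for a b :: real
  proof -
    have "ln a - ln b \<le> (a - b) / b" using ln_diff_le[of a b] that by simp
    also have "\<dots> \<le> \<bar>a - b\<bar> / b" using that by (intro divide_right_mono) auto
    also have "\<dots> \<le> \<bar>a - b\<bar>" using that mult_right_mono[of 1 b "\<bar>a - b\<bar>"] by (simp add: field_simps)
    finally show ?thesis .
  qed
  show ?thesis using *[OF assms] *[OF assms(2,1)] by (simp add: abs_le_iff abs_minus_commute)
qed

text \<open>
  Subtracting the two equations for the roots \<open>w\<close> and \<open>v\<close> at \<open>x + \<i> * t\<close> and at \<open>x\<close> gives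
  \<open>(w - v) * (1 - 1 / (w * v)) = \<i> * t\<close>, and the second factor stays away from \<open>0\<close> as long as \<open>x\<close> stays away from \<open>2\<close>.
\<close>

lemma plane_potential_near_line:
  assumes "t > 0" "x \<ge> y" "y > 2"
  shows "\<bar>plane_potential (Complex x t) - line_potential x\<bar>
     \<le> 2 * t * (outer_root_real y / (outer_root_real y - 1))"
proof -
  define w where "w = outer_root (Complex x t)"
  define v where "v = outer_root_real x"
  define c where "c = outer_root_real y"
  have im: "Im (Complex x t) > 0" using assms by simp
  have w1: "cmod w > 1" using outer_root_bounds(1)[OF im] by (simp add: w_def)
  have c1: "c > 1" using outer_root_real_strict_mono[of 2 y] assms by (simp add: c_def outer_root_real_def)
  have cv: "c \<le> v" using outer_root_real_strict_mono[of y x] assms by (cases "x = y") (auto simp: c_def v_def)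
  have w0: "w \<noteq> 0" using w1 by auto
  have "w + 1 / w = Complex x t" unfolding w_def by (rule outer_root_sum)
  moreover have vx: "v + 1 / v = x" using outer_root_real_sum[of x] assms by (simp add: v_def)
  moreover have "Complex x t = complex_of_real x + \<i> * complex_of_real t" by (simp add: complex_eq_iff)
  ultimately have "\<i> * complex_of_real t = w + 1 / w - complex_of_real (v + 1 / v)" by simp
  also have "\<dots> = (w - complex_of_real v) * (1 - 1 / (w * complex_of_real v))"
    using w0 c1 cv by (simp add: field_simps)
  finally have "cmod (\<i> * complex_of_real t) = cmod \<dots>" by simp
  then have eq: "t = cmod (w - complex_of_real v) * cmod (1 - 1 / (w * complex_of_real v))"
    using assms by (simp add: norm_mult)
  have "1 - 1 / c \<le> 1 - cmod (1 / (w * complex_of_real v))"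
  proof -
    have "c * 1 \<le> v * cmod w" using cv w1 c1 by (intro mult_mono) auto
    then show ?thesis using c1 w1 cv by (simp add: norm_divide norm_mult frac_le mult.commute)
  qed
  also have "\<dots> \<le> cmod (1 - 1 / (w * complex_of_real v))"
    using norm_triangle_ineq2[of 1 "1 / (w * complex_of_real v)"] by simp
  finally have "cmod (w - complex_of_real v) * (1 - 1 / c) \<le> t"
    unfolding eq by (intro mult_left_mono) auto
  then have d: "cmod (w - complex_of_real v) \<le> t * (c / (c - 1))"
    using c1 by (simp add: field_simps)
  have v1: "v \<ge> 1" using c1 cv by simp
  have "\<bar>ln (cmod w) - ln v\<bar> \<le> \<bar>cmod w - v\<bar>" using w1 v1 by (intro abs_ln_diff_le) auto
  also have "\<dots> \<le> cmod (w - complex_of_real v)"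
    using norm_triangle_ineq3[of w "complex_of_real v"] v1 by simp
  finally have ln: "\<bar>ln (cmod w) - ln v\<bar> \<le> cmod (w - complex_of_real v)" .
  have "cmod (1 / w\<^sup>2 - 1 / (complex_of_real v)\<^sup>2)
      = cmod (w - complex_of_real v) * (cmod (complex_of_real v + w) / (cmod w * v)\<^sup>2)"
  proof -
    have "1 / w\<^sup>2 - 1 / (complex_of_real v)\<^sup>2
        = - ((w - complex_of_real v) * (complex_of_real v + w) / (w * complex_of_real v)\<^sup>2)"
      using w0 v1 by (simp add: field_simps power2_eq_square)
    then show ?thesis using v1 by (simp add: norm_mult norm_divide norm_power)
  qed
  also have "\<dots> \<le> cmod (w - complex_of_real v) * 2"
  proof (intro mult_left_mono)
    have "cmod (complex_of_real v + w) \<le> v + cmod w"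
      using norm_triangle_ineq[of "complex_of_real v" w] v1 by simp
    also have "\<dots> \<le> 2 * (cmod w * v)"
    proof -
      have "v * 1 \<le> v * cmod w" "1 * cmod w \<le> v * cmod w"
        using v1 w1 by (intro mult_mono; simp)+
      then show ?thesis by (simp add: mult.commute)
    qed
    also have "\<dots> \<le> 2 * (cmod w * v)\<^sup>2"
    proof -
      have "1 * 1 \<le> cmod w * v" using v1 w1 by (intro mult_mono) auto
      then have "(cmod w * v) ^ 1 \<le> (cmod w * v) ^ 2" by (intro power_increasing) auto
      then show ?thesis by simp
    qed
    finally show "cmod (complex_of_real v + w) / (cmod w * v)\<^sup>2 \<le> 2"
      using v1 w0 by (simp add: field_simps)
  qed auto
  finally have "\<bar>Re (1 / w\<^sup>2 - 1 / (complex_of_real v)\<^sup>2)\<bar> \<le> cmod (w - complex_of_real v) * 2"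
    using abs_Re_le_cmod order_trans by blast
  moreover have "Re (1 / (complex_of_real v)\<^sup>2) = 1 / v\<^sup>2"
    by (metis Re_complex_of_real of_real_1 of_real_divide of_real_power)
  ultimately have re: "\<bar>Re (1 / w\<^sup>2) - 1 / v\<^sup>2\<bar> \<le> cmod (w - complex_of_real v) * 2"
    by simp
  have "\<bar>plane_potential (Complex x t) - line_potential x\<bar>
      = \<bar>(ln (cmod w) - ln v) + (Re (1 / w\<^sup>2) - 1 / v\<^sup>2) / 2\<bar>"
    by (simp add: plane_potential_def line_potential_def w_def v_def field_simps)
  also have "\<dots> \<le> 2 * cmod (w - complex_of_real v)"
  proof -
    have "\<bar>A + B / 2\<bar> \<le> 2 * C" if "\<bar>A\<bar> \<le> C" "\<bar>B\<bar> \<le> C * 2" for A B C :: real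
      using that by (simp add: abs_le_iff)
    from this[OF ln re] show ?thesis .
  qed
  also have "\<dots> \<le> 2 * (t * (c / (c - 1)))" using d by simp
  finally show ?thesis by (simp add: c_def)
qed

section \<open>From the approximate equation to the empirical potential\<close>

definition resolvent_mean :: "nat \<Rightarrow> (nat \<Rightarrow> real) \<Rightarrow> complex \<Rightarrow> complex"
  where "resolvent_mean N x z = (\<Sum>i<N. 1 / (z - complex_of_real (x i))) / of_nat N"

text \<open>
  It vanishes when the resolvent mean is replaced by the Stieltjes transform of the semicircle law.
\<close>

definition resolvent_defect :: "nat \<Rightarrow> (nat \<Rightarrow> real) \<Rightarrow> complex \<Rightarrow> complex"
  where "resolvent_defect N x z = (resolvent_mean N x z)\<^sup>2 - z * resolvent_mean N x z + 1"

definition log_mean :: "nat \<Rightarrow> (nat \<Rightarrow> real) \<Rightarrow> complex \<Rightarrow> real"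
  where "log_mean N x z = (\<Sum>i<N. ln (cmod (z - complex_of_real (x i)))) / real N"

lemma Im_inverse_resolvent: "Im (1 / (z - complex_of_real y)) = - Im z / (cmod (z - complex_of_real y))\<^sup>2"
  by (simp add: Im_divide cmod_power2)

lemma Im_resolvent_mean_nonpos:
  assumes "Im z > 0" shows "Im (resolvent_mean N x z) \<le> 0"
  unfolding resolvent_mean_def Im_divide_of_nat
  by (intro divide_nonpos_nonneg) (use assms in \<open>auto simp: Im_inverse_resolvent intro!: sum_nonpos\<close>)

lemma ln_cmod_has_derivative:
  assumes "t > 0"
  shows "((\<lambda>t. ln (cmod (Complex a t - complex_of_real y))) has_real_derivative
     - Im (1 / (Complex a t - complex_of_real y))) (at t)"
proof -
  have pos: "(a - y)\<^sup>2 + t\<^sup>2 > 0" using assms by (intro add_nonneg_pos) auto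
  have eq: "ln (cmod (Complex a t - complex_of_real y)) = ln ((a - y)\<^sup>2 + t\<^sup>2) / 2" for t
    by (cases "(a - y)\<^sup>2 + t\<^sup>2 = 0") (auto simp: cmod_def ln_sqrt add_nonneg_eq_0_iff)
  have "((\<lambda>t. (a - y)\<^sup>2 + t\<^sup>2) has_real_derivative 2 * t) (at t)"
    by (auto intro!: derivative_eq_intros)
  then have "((\<lambda>t. ln ((a - y)\<^sup>2 + t\<^sup>2)) has_real_derivative
      inverse ((a - y)\<^sup>2 + t\<^sup>2) * (2 * t)) (at t)"
    by (rule DERIV_chain2[where f = ln and g = "\<lambda>t. (a - y)\<^sup>2 + t\<^sup>2", OF DERIV_ln[OF pos]])
  then have "((\<lambda>t. ln ((a - y)\<^sup>2 + t\<^sup>2) / 2) has_real_derivative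
      inverse ((a - y)\<^sup>2 + t\<^sup>2) * (2 * t) / 2) (at t)"
    by (rule DERIV_cdivide)
  then have "((\<lambda>t. ln ((a - y)\<^sup>2 + t\<^sup>2) / 2) has_real_derivative t / ((a - y)\<^sup>2 + t\<^sup>2)) (at t)"
    by (rule DERIV_cong) (simp only: divide_inverse mult.commute mult.left_commute mult.assoc, simp)
  moreover have "- Im (1 / (Complex a t - complex_of_real y)) = t / ((a - y)\<^sup>2 + t\<^sup>2)"
    by (simp add: Im_inverse_resolvent cmod_power2)
  ultimately show ?thesis unfolding eq by simp
qed

lemma log_mean_has_derivative:
  assumes "t > 0"
  shows "((\<lambda>t. log_mean N x (Complex a t)) has_real_derivative
     - Im (resolvent_mean N x (Complex a t))) (at t)"
proof -
  have "((\<lambda>t. log_mean N x (Complex a t)) has_real_derivative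
     (\<Sum>i<N. - Im (1 / (Complex a t - complex_of_real (x i)))) / real N) (at t)"
    unfolding log_mean_def by (intro DERIV_cdivide DERIV_sum ln_cmod_has_derivative assms)
  then show ?thesis by (simp add: resolvent_mean_def Im_divide_of_nat sum_negf)
qed

lemma ln_cmod_far:
  assumes "R > 0" "\<bar>a\<bar> \<le> B"
  shows "\<bar>ln (cmod (Complex a R - complex_of_real y)) - ln R\<bar> \<le> (B + sqrt (1 + y\<^sup>2)) / R"
proof -
  define c where "c = cmod (Complex a R - complex_of_real y)"
  have cge: "R \<le> c" using abs_Im_le_cmod[of "Complex a R - complex_of_real y"] assms by (simp add: c_def)
  have "c \<le> \<bar>a - y\<bar> + R" using cmod_le[of "Complex a R - complex_of_real y"] assms by (simp add: c_def)
  also have "\<bar>a - y\<bar> \<le> B + sqrt (1 + y\<^sup>2)"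
  proof -
    have "\<bar>y\<bar> \<le> sqrt (1 + y\<^sup>2)" by (intro real_le_rsqrt) auto
    then show ?thesis using assms by linarith
  qed
  finally have "c - R \<le> B + sqrt (1 + y\<^sup>2)" by simp
  moreover have "ln c - ln R \<le> (c - R) / R" using ln_diff_le[of c R] cge assms by simp
  moreover have "ln R \<le> ln c" using cge assms by simp
  ultimately show ?thesis
    using assms divide_right_mono[of "c - R" "B + sqrt (1 + y\<^sup>2)" R] unfolding c_def[symmetric]
    by (simp add: abs_le_iff)
qed

text \<open>
  Far up, both the empirical and the limiting potential are \<open>ln R + O(1 / R)\<close>; this is where the comparison along a
  vertical line starts.
\<close>

lemma plane_potential_far:
  assumes "R \<ge> 2" "\<bar>a\<bar> \<le> B"
  shows "\<bar>plane_potential (Complex a R) - ln R\<bar> \<le> (B + 3) / R"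
proof -
  define z where "z = Complex a R"
  define r where "r = cmod (outer_root z)"
  have im: "Im z > 0" using assms by (simp add: z_def)
  have r1: "r > 1" using outer_root_bounds(1)[OF im] by (simp add: r_def)
  have "R \<le> cmod z" using abs_Im_le_cmod[of z] assms by (simp add: z_def)
  moreover have "cmod z \<le> B + R" using cmod_le[of z] assms by (simp add: z_def)
  moreover have "cmod z \<le> r + 1 / r" "r \<le> cmod z + 1 / r"
    using norm_triangle_ineq[of "outer_root z" "1 / outer_root z"]
      norm_triangle_ineq4[of z "1 / outer_root z"] outer_root_sum[of z]
    by (simp_all add: r_def norm_divide) (metis add_diff_cancel)
  moreover have "1 / r \<le> 1" using r1 by simp
  ultimately have r: "R - 1 \<le> r" "r \<le> R + B + 1" by linarith+
  have "ln r - ln R \<le> (r - R) / R" using ln_diff_le[of r R] r1 assms by simp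
  also have "\<dots> \<le> (B + 1) / R" using r assms by (intro divide_right_mono) auto
  finally have up: "ln r - ln R \<le> (B + 1) / R" .
  have "ln R - ln r \<le> (R - r) / r" using ln_diff_le[of R r] r1 assms by simp
  also have "\<dots> \<le> 1 / r" using r r1 by (intro divide_right_mono) auto
  also have "\<dots> \<le> 2 / R" using r assms r1 by (simp add: field_simps)
  finally have lo: "ln R - ln r \<le> 2 / R" .
  have "\<bar>Re (1 / (outer_root z)\<^sup>2)\<bar> \<le> 1 / r\<^sup>2"
    using abs_Re_le_cmod[of "1 / (outer_root z)\<^sup>2"] by (simp add: r_def norm_divide norm_power)
  also have "\<dots> \<le> 1 / r" using r1 by (simp add: field_simps power2_eq_square)
  also have "\<dots> \<le> 2 / R" using r assms r1 by (simp add: field_simps)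
  finally have re: "\<bar>Re (1 / (outer_root z)\<^sup>2)\<bar> \<le> 2 / R" .
  have "B \<ge> 0" using assms by simp
  then have "0 \<le> B / R" using assms by simp
  then show ?thesis using up lo re
    unfolding plane_potential_def z_def[symmetric] r_def[symmetric]
    by (simp add: abs_le_iff add_divide_distrib) 
qed

text \<open>
  The difference of the two potentials has vertical derivative \<open>Im (1 / w - s)\<close>, which the approximate equation makes small
  between the heights \<open>\<eta>\<close> and \<open>R\<close>; at height \<open>R\<close> the difference is \<open>O(1 / R)\<close>.
\<close>

lemma log_mean_close:
  assumes N: "N > 0" and eta: "0 < \<eta>" "\<eta> \<le> R" and R: "R \<ge> 2" and a: "\<bar>a\<bar> \<le> B"
    and defect: "\<And>t. \<eta> \<le> t \<Longrightarrow> t \<le> R \<Longrightarrow> cmod (resolvent_defect N x (Complex a t)) \<le> \<delta>"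
    and K: "(\<Sum>i<N. sqrt (1 + (x i)\<^sup>2)) \<le> K * real N"
  shows "\<bar>log_mean N x (Complex a \<eta>) - plane_potential (Complex a \<eta>)\<bar>
     \<le> R * \<delta> / \<eta> + (2 * B + K + 3) / R"
proof -
  define D where "D t = log_mean N x (Complex a t) - plane_potential (Complex a t)" for t
  define D' where "D' t = Im (1 / outer_root (Complex a t)) - Im (resolvent_mean N x (Complex a t))" for t
  have der: "(D has_real_derivative D' t) (at t)" if "t > 0" for t
    unfolding D_def D'_def
    by (rule derivative_eq_intros log_mean_has_derivative plane_potential_has_derivative that | simp)+
  have D': "\<bar>D' t\<bar> \<le> \<delta> / \<eta>" if t: "\<eta> \<le> t" "t \<le> R" for t
  proof -
    let ?z = "Complex a t" and ?s = "resolvent_mean N x (Complex a t)"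
    have im: "Im ?z > 0" using t eta by simp
    have "\<bar>D' t\<bar> \<le> cmod (?s - 1 / outer_root ?z)"
      using abs_Im_le_cmod[of "?s - 1 / outer_root ?z"] by (simp add: D'_def abs_minus_commute)
    also have "\<dots> \<le> cmod (resolvent_defect N x ?z) / t"
      using root_of_approximate_quadratic[OF im Im_resolvent_mean_nonpos[OF im]]
      by (simp add: resolvent_defect_def)
    also have "\<dots> \<le> \<delta> / \<eta>"
      using defect[OF t] t eta by (intro frac_le) (auto intro: order_trans[OF norm_ge_zero])
    finally show ?thesis .
  qed
  have diff: "\<bar>D R - D \<eta>\<bar> \<le> R * \<delta> / \<eta>"
  proof (cases "\<eta> = R")
    case True
    have "0 \<le> \<delta> / \<eta>" using D'[of R] True abs_ge_zero order_trans by blast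
    then have "0 \<le> R * (\<delta> / \<eta>)" using R by (intro mult_nonneg_nonneg) auto
    then show ?thesis using True by simp
  next
    case False
    then have "\<eta> < R" using eta by simp
    then obtain t where t: "\<eta> < t" "t < R" "D R - D \<eta> = (R - \<eta>) * D' t"
      using MVT2[of \<eta> R D D'] der eta by (metis less_le_trans)
    have "\<bar>D R - D \<eta>\<bar> \<le> R * (\<delta> / \<eta>)"
      unfolding t(3) abs_mult using D'[of t] t eta by (intro mult_mono) auto
    then show ?thesis by simp
  qed
  have "\<bar>log_mean N x (Complex a R) - ln R\<bar>
      = \<bar>\<Sum>i<N. ln (cmod (Complex a R - complex_of_real (x i))) - ln R\<bar> / real N"
    using N by (simp add: log_mean_def sum_subtractf field_simps)
  also have "\<dots> \<le> (\<Sum>i<N. (B + sqrt (1 + (x i)\<^sup>2)) / R) / real N"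
    using ln_cmod_far[of R a B] R a
    by (intro divide_right_mono order_trans[OF sum_abs] sum_mono) auto
  also have "\<dots> \<le> (B + K) / R"
    using K N R by (simp add: field_simps sum.distrib flip: sum_divide_distrib)
  finally have "\<bar>log_mean N x (Complex a R) - ln R\<bar> \<le> (B + K) / R" .
  then have "\<bar>D R\<bar> \<le> (B + K) / R + (B + 3) / R"
    using plane_potential_far[OF R a] unfolding D_def by linarith
  also have "\<dots> = (2 * B + K + 3) / R" by (simp add: add_divide_distrib)
  finally show ?thesis using diff unfolding D_def by linarith
qed

text \<open>
  The price for replacing \<open>\<bar>a - y\<bar>\<close> by its smoothed version is an integrable singularity with a small factor. It
  follows from \<open>u + \<eta> \<le> u * (1 + sqrt (\<eta> / u))\<^sup>2\<close> and \<open>ln (1 + q) \<le> q\<close>.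
\<close>

lemma log_smoothing_loss:
  assumes "0 < \<eta>" and that: "a \<noteq> y"
  shows "ln (cmod (Complex a \<eta> - complex_of_real y)) - 2 * sqrt \<eta> / sqrt \<bar>a - y\<bar> \<le> ln \<bar>a - y\<bar>"
proof -
  define u where "u = \<bar>a - y\<bar>"
  have u: "u > 0" using that by (simp add: u_def)
  define q where "q = sqrt (\<eta> / u)"
  have q: "q \<ge> 0" "q\<^sup>2 = \<eta> / u" using u assms by (auto simp: q_def)
  have eta: "\<eta> = q\<^sup>2 * u" using q u by simp
  have "cmod (Complex a \<eta> - complex_of_real y) \<le> u + \<eta>"
    using cmod_le[of "Complex a \<eta> - complex_of_real y"] assms by (simp add: u_def)
  also have "\<dots> \<le> u * (1 + q)\<^sup>2" using q u by (simp add: eta power2_eq_square algebra_simps)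
  finally have "ln (cmod (Complex a \<eta> - complex_of_real y)) \<le> ln (u * (1 + q)\<^sup>2)"
    using that by (subst ln_le_cancel_iff) (auto simp: complex_eq_iff u intro!: mult_pos_pos) 
  also have "\<dots> = ln u + 2 * ln (1 + q)" using u q by (simp add: ln_mult ln_realpow)
  also have "ln (1 + q) \<le> q" using q by (intro ln_add_one_self_le_self) auto
  finally show ?thesis by (simp add: u_def q_def real_sqrt_divide)
qed

section \<open>The logarithmic potential of the semicircle law\<close>

lemma four_minus_square_pos: "y \<in> {-2<..<2} \<Longrightarrow> 4 - y\<^sup>2 > 0" for y :: real
proof -
  assume "y \<in> {-2<..<2}"
  then have "0 < (2 - y) * (2 + y)" by simp
  then show ?thesis by (simp add: power2_eq_square algebra_simps)
qed

lemma sqrt_one_minus_half: "sqrt (1 - (y / 2)\<^sup>2) = sqrt (4 - y\<^sup>2) / 2" for y :: real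
proof -
  have "1 - (y / 2)\<^sup>2 = (4 - y\<^sup>2) / 4" by (simp add: power_divide field_simps)
  then have "sqrt (1 - (y / 2)\<^sup>2) = sqrt ((4 - y\<^sup>2) / 4)" by (rule arg_cong)
  then show ?thesis by (simp add: real_sqrt_divide)
qed

lemma semicircle_total: "((\<lambda>y. sqrt (4 - y\<^sup>2)) has_integral 2 * pi) {-2..2}"
proof -
  let ?F = "\<lambda>y. y * sqrt (4 - y\<^sup>2) / 2 + 2 * arcsin (y / 2)"
  have "((\<lambda>y. sqrt (4 - y\<^sup>2)) has_integral ?F 2 - ?F (-2)) {-2..2}"
  proof (rule fundamental_theorem_of_calculus_interior)
    show "continuous_on {- 2..2} ?F" by (intro continuous_intros) auto
  next
    fix y :: real assume y: "y \<in> {-2<..<2}"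
    have pos: "4 - y\<^sup>2 > 0" by (rule four_minus_square_pos[OF y])
    define r where "r = sqrt (4 - y\<^sup>2)"
    have r: "r > 0" "r * r = 4 - y * y" using pos by (auto simp: r_def power2_eq_square)
    have s: "sqrt (1 - (y / 2)\<^sup>2) = r / 2" by (simp only: r_def sqrt_one_minus_half)
    have "(?F has_real_derivative (1 * r + y * ((- (2 * y)) * (inverse r / 2))) / 2
        + 2 * (1 / 2 * inverse (r / 2))) (at y)"
      by (rule derivative_eq_intros refl | use y pos in \<open>simp add: s r_def[symmetric]\<close>)+
    moreover have "(1 * r + y * ((- (2 * y)) * (inverse r / 2))) / 2 + 2 * (1 / 2 * inverse (r / 2)) = r"
      using r by (simp add: field_simps)
    ultimately show "(?F has_vector_derivative sqrt (4 - y\<^sup>2)) (at y)"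
      by (simp add: has_real_derivative_iff_has_vector_derivative r_def)
  qed auto
  then show ?thesis by (simp add: arcsin_minus)
qed

text \<open>
  An explicit primitive: \<open>sqrt (4 - y\<^sup>2) / (x - y)\<close> equals
  \<open>(x + y) / sqrt (4 - y\<^sup>2) - (x\<^sup>2 - 4) / ((x - y) * sqrt (4 - y\<^sup>2))\<close>, and each part integrates to elementary functions. The
  argument \<open>?u\<close> of the last arcsine runs from \<open>1\<close> to \<open>-1\<close>.
\<close>

lemma semicircle_stieltjes:
  assumes x: "x > 2"
  shows "((\<lambda>y. sqrt (4 - y\<^sup>2) / (x - y)) has_integral 2 * pi / outer_root_real x) {-2..2}"
proof -
  define q where "q = sqrt (x\<^sup>2 - 4)"
  have x2: "x\<^sup>2 > 4" using power_strict_mono[of 2 x 2] x by simp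
  have q: "q > 0" "q * q = x * x - 4" using x2 by (auto simp: q_def power2_eq_square)
  let ?u = "\<lambda>y. (4 - x * y) / (2 * (x - y))"
  let ?F = "\<lambda>y. x * arcsin (y / 2) - sqrt (4 - y\<^sup>2) + q * arcsin (?u y)"
  have one_minus: "1 - (?u y)\<^sup>2 = (x\<^sup>2 - 4) * (4 - y\<^sup>2) / (2 * (x - y))\<^sup>2" if "y < x" for y
    
  proof -
    have "1 - (?u y)\<^sup>2 = ((2 * (x - y))\<^sup>2 - (4 - x * y)\<^sup>2) / (2 * (x - y))\<^sup>2"
    proof -
      have "1 - b / c = (c - b) / c" if "c \<noteq> 0" for b c :: real using that by (simp add: diff_divide_distrib)
      then show ?thesis using that by (simp only: power_divide) simp
    qed
    also have "(2 * (x - y))\<^sup>2 - (4 - x * y)\<^sup>2 = (x\<^sup>2 - 4) * (4 - y\<^sup>2)"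
      by (simp add: power2_eq_square algebra_simps)
    finally show ?thesis .
  qed
  have bnd: "\<bar>?u y\<bar> \<le> 1" if "y \<in> {-2..2}" for y
  proof -
    have "y\<^sup>2 \<le> 2\<^sup>2" using that abs_le_square_iff[of y 2] by auto
    then have "0 \<le> 1 - (?u y)\<^sup>2" using that x x2 by (subst one_minus) auto
    then show ?thesis by (simp add: abs_square_le_1)
  qed
  have "((\<lambda>y. sqrt (4 - y\<^sup>2) / (x - y)) has_integral ?F 2 - ?F (-2)) {-2..2}"
  proof (rule fundamental_theorem_of_calculus_interior)
    have "-1 \<le> ?u y" "?u y \<le> 1" if "y \<in> {-2..2}" for y using bnd[OF that] by (simp_all only: abs_le_iff) linarith+
    then show "continuous_on {- 2..2} ?F" 
      using x by (intro continuous_intros ballI conjI) auto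
  next
    fix y :: real assume y: "y \<in> {-2<..<2}"
    have pos: "4 - y\<^sup>2 > 0" by (rule four_minus_square_pos[OF y])
    define r where "r = sqrt (4 - y\<^sup>2)"
    have r: "r > 0" "r * r = 4 - y * y" using pos by (auto simp: r_def power2_eq_square)
    have s: "sqrt (1 - (y / 2)\<^sup>2) = r / 2" by (simp only: r_def sqrt_one_minus_half)
    have xy: "x - y > 0" using y x by simp
    have s2: "sqrt (1 - (?u y)\<^sup>2) = q * r / (2 * (x - y))"
      using xy x by (subst one_minus) (auto simp: real_sqrt_divide real_sqrt_mult q_def r_def)
    have "1 - (?u y)\<^sup>2 > 0" using pos x2 xy by (subst one_minus) auto
    then have "\<bar>?u y\<bar> < 1" by (simp only: abs_square_less_1[symmetric])
    then have u1: "-1 < ?u y" "?u y < 1" by linarith+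
    have "(?u has_real_derivative ((- x) * (2 * (x - y)) - (4 - x * y) * (- 2)) / (2 * (x - y) * (2 * (x - y)))) (at y)"
      using xy by (auto intro!: derivative_eq_intros)
    moreover have "((- x) * (2 * (x - y)) - (4 - x * y) * (- 2)) / (2 * (x - y) * (2 * (x - y)))
        = (2 * (4 - x * x)) / (2 * (2 * (x - y) * (x - y)))"
      by (rule arg_cong2[where f = "(/)"]) (simp_all add: algebra_simps)
    ultimately have du: "(?u has_real_derivative (4 - x * x) / (2 * (x - y) * (x - y))) (at y)"
      by (simp only: mult_divide_mult_cancel_left_if) simp
    have "(?F has_real_derivative x * (1 / 2 * inverse (r / 2)) - (- (2 * y)) * (inverse r / 2)
        + q * ((4 - x * x) / (2 * (x - y) * (x - y)) * inverse (q * r / (2 * (x - y))))) (at y)"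
    proof (intro DERIV_add DERIV_diff)
      show "((\<lambda>y. x * arcsin (y / 2)) has_real_derivative x * (1 / 2 * inverse (r / 2))) (at y)"
        by (rule derivative_eq_intros refl | use y in \<open>simp add: s\<close>)+
      show "((\<lambda>y. sqrt (4 - y\<^sup>2)) has_real_derivative - (2 * y) * (inverse r / 2)) (at y)"
        by (rule derivative_eq_intros refl | use pos in \<open>simp add: r_def[symmetric]\<close>)+
      show "((\<lambda>y. q * arcsin (?u y)) has_real_derivative
          q * ((4 - x * x) / (2 * (x - y) * (x - y)) * inverse (q * r / (2 * (x - y))))) (at y)"
        using DERIV_cmult[OF DERIV_chain2[where f = arcsin and g = ?u, OF DERIV_arcsin[OF u1] du], of q]
        unfolding s2 by (simp only: mult.commute)
    qed
    moreover have "x * (1 / 2 * inverse (r / 2)) - (- (2 * y)) * (inverse r / 2)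
        + q * ((4 - x * x) / (2 * (x - y) * (x - y)) * inverse (q * r / (2 * (x - y)))) = r / (x - y)"
    proof -
      have "q * ((4 - x * x) / (2 * (x - y) * (x - y)) * inverse (q * r / (2 * (x - y))))
         = (4 - x * x) / ((x - y) * r)"
      proof -
        have "q * (c / (2 * d * d) * inverse (q * r / (2 * d))) = c / (d * r)" if "d > 0" for c d
          using q(1) r(1) that by (simp add: field_simps)
        from this[OF xy] show ?thesis .
      qed
      moreover have "x * (1 / 2 * inverse (r / 2)) - (- (2 * y)) * (inverse r / 2) = (x + y) / r"
        using r(1) by (simp add: field_simps)
      moreover have "(x + y) / r + (4 - x * x) / ((x - y) * r) = ((x + y) * (x - y) + (4 - x * x)) / ((x - y) * r)"
        using r(1) xy by (simp add: add_divide_distrib)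
      moreover have "(x + y) * (x - y) + (4 - x * x) = r * r" using r(2) by (simp add: algebra_simps)
      ultimately show ?thesis using r(1) by simp
    qed
    ultimately show "(?F has_vector_derivative sqrt (4 - y\<^sup>2) / (x - y)) (at y)"
      by (simp add: has_real_derivative_iff_has_vector_derivative r_def)
  qed auto
  moreover have "?F 2 - ?F (-2) = 2 * pi / outer_root_real x"
  proof -
    have u: "?u 2 = -1" "?u (-2) = 1" using x by (simp_all add: field_simps)
    have "1 / outer_root_real x = x - outer_root_real x"
      using outer_root_real_sum[of x] x by simp
    then have "2 * pi / outer_root_real x = 2 * pi * (x - outer_root_real x)"
      by (simp add: divide_inverse)
    also have "\<dots> = pi * x - pi * q" by (simp add: outer_root_real_def q_def[symmetric] algebra_simps)
    finally have "2 * pi / outer_root_real x = pi * x - pi * q" .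
    moreover have "x * arcsin (2 / 2) = pi * x / 2" "x * arcsin (- 2 / 2) = - (pi * x / 2)"
      by (simp_all add: arcsin_minus)
    moreover have "sqrt (4 - 2\<^sup>2) = 0" "sqrt (4 - (- 2)\<^sup>2) = 0" by simp_all
    moreover have "q * arcsin (- 1) = - (pi * q / 2)" "q * arcsin 1 = pi * q / 2"
      by (simp_all add: arcsin_minus)
    ultimately show ?thesis using u by (simp only:)
  qed
  ultimately show ?thesis by simp
qed

lemma line_potential_has_derivative:
  assumes "x > 2"
  shows "(line_potential has_real_derivative 1 / outer_root_real x) (at x)"
proof -
  define w where "w = outer_root_real x"
  define q where "q = sqrt (x\<^sup>2 - 4)"
  have x2: "x\<^sup>2 > 4" using power_strict_mono[of 2 x 2] assms by simp
  have q: "q > 0" using x2 by (auto simp: q_def power2_eq_square)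
  have w1: "w \<ge> 1" using outer_root_real_ge_1[of x] assms by (simp add: w_def)
  have "1 / w = x - w" using outer_root_real_sum[of x] assms by (simp add: w_def)
  then have wq: "w - 1 / w = q" by (simp add: w_def outer_root_real_def q_def field_simps)
  have "(outer_root_real has_real_derivative (1 + (2 * x) * (inverse q / 2)) / 2) (at x)"
    unfolding outer_root_real_def
    by (rule derivative_eq_intros refl | use x2 in \<open>simp add: q_def[symmetric]\<close>)+
  moreover have "(1 + (2 * x) * (inverse q / 2)) / 2 = w / q"
    using q by (simp add: w_def outer_root_real_def q_def[symmetric] field_simps)
  ultimately have dw: "(outer_root_real has_real_derivative w / q) (at x)" by simp
  have "((\<lambda>w. ln w + 1 / (2 * w\<^sup>2)) has_real_derivative 1 / w - 1 / w ^ 3) (at w)"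
    using w1 by (auto intro!: derivative_eq_intros simp: field_simps eval_nat_numeral)
  from DERIV_chain2[OF this[unfolded w_def] dw]
  have "(line_potential has_real_derivative (1 / w - 1 / w ^ 3) * (w / q)) (at x)"
    by (simp only: line_potential_def[abs_def] w_def)
  moreover have "1 / w - 1 / w ^ 3 = (w - 1 / w) / w\<^sup>2"
    using w1 by (simp add: field_simps eval_nat_numeral)
  ultimately show ?thesis using w1 q by (simp add: wq w_def[symmetric] power2_eq_square)
qed

text \<open>
  The logarithmic potential to the right of the support, without the normalisation \<open>1 / (2 * pi)\<close> of the density.
\<close>

definition semicircle_log :: "real \<Rightarrow> real"
  where "semicircle_log x = integral {-2..2} (\<lambda>y. sqrt (4 - y\<^sup>2) * ln (x - y))"

lemma semicircle_log_has_derivative: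
  assumes "x > 2"
  shows "(semicircle_log has_real_derivative 2 * pi / outer_root_real x) (at x)"
proof -
  have "((\<lambda>x. integral (cbox (-2) 2) (\<lambda>y. sqrt (4 - y\<^sup>2) * ln (x - y))) has_field_derivative
      integral (cbox (-2) 2) (\<lambda>y. sqrt (4 - y\<^sup>2) / (x - y))) (at x within {2<..})"
  proof (rule leibniz_rule_field_derivative[where fx = "\<lambda>x y. sqrt (4 - y\<^sup>2) / (x - y)"])
    fix x y :: real assume "x \<in> {2<..}" "y \<in> cbox (-2) 2"
    then have "x - y > 0" by simp
    then show "((\<lambda>x. sqrt (4 - y\<^sup>2) * ln (x - y)) has_real_derivative sqrt (4 - y\<^sup>2) / (x - y)) (at x within {2<..})"
      by (auto intro!: derivative_eq_intros)
  next
    fix x :: real assume "x \<in> {2<..}"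
    then show "(\<lambda>y. sqrt (4 - y\<^sup>2) * ln (x - y)) integrable_on cbox (-2) 2"
      by (intro integrable_continuous continuous_intros) auto
  next
    show "continuous_on ({2<..} \<times> cbox (- 2) 2) (\<lambda>(x::real, y). sqrt (4 - y\<^sup>2) / (x - y))"
      unfolding case_prod_beta by (intro continuous_intros) auto
  qed (use assms in auto)
  moreover have "at x within {2<..} = at x" using assms by (intro at_within_open) auto
  ultimately show ?thesis
    using integral_unique[OF semicircle_stieltjes[OF assms]] by (simp add: semicircle_log_def[abs_def])
qed

lemma line_potential_far:
  assumes "x \<ge> 3" shows "\<bar>line_potential x - ln x\<bar> \<le> 2 / (x - 2)"
proof -
  define w where "w = outer_root_real x"
  have w: "w \<ge> 1" "x = w + 1 / w"
    using outer_root_real_ge_1[of x] outer_root_real_sum[of x] assms by (simp_all add: w_def)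
  have "1 / w \<le> 1" using w by simp
  moreover have "0 \<le> 1 / w" using w(1) by simp
  ultimately have wx: "x - 1 \<le> w" "w \<le> x" using w(2) by linarith+
  have "ln x - ln w \<le> (x - w) / w" using ln_diff_le[of x w] w assms by simp
  also have "\<dots> \<le> 1 / (x - 2)" using wx w(1) assms by (intro frac_le) auto
  finally have 1: "ln x - ln w \<le> 1 / (x - 2)" .
  have "1 / (2 * w\<^sup>2) \<le> 1 / (x - 2)"
  proof (intro divide_left_mono)
    have "x - 2 \<le> w * 1" using wx by simp
    also have "\<dots> \<le> w * (2 * w)" using w by (intro mult_left_mono) auto
    finally show "x - 2 \<le> 2 * w\<^sup>2" by (simp add: power2_eq_square)
  qed (use w assms in auto)
  moreover have "1 / (2 * w\<^sup>2) \<ge> 0" "ln w \<le> ln x" "0 \<le> 1 / (x - 2)" using wx w assms by auto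
  moreover have "2 / (x - 2) = 1 / (x - 2) + 1 / (x - 2)" by simp
  ultimately show ?thesis using 1
    unfolding line_potential_def w_def[symmetric] by linarith
qed

lemma semicircle_log_far:
  assumes "x \<ge> 3" shows "\<bar>semicircle_log x - 2 * pi * ln x\<bar> \<le> 2 * pi * (2 / (x - 2))"
proof -
  let ?g = "\<lambda>y. sqrt (4 - y\<^sup>2) :: real"
  have "((\<lambda>y. ?g y * ln (x - y) - ?g y * ln x) has_integral (semicircle_log x - 2 * pi * ln x)) {-2..2}"
    unfolding semicircle_log_def
    by (intro has_integral_diff has_integral_mult_left semicircle_total integrable_integral
        integrable_continuous_interval continuous_intros) (use assms in auto)
  moreover have "((\<lambda>y. ?g y * (2 / (x - 2))) has_integral 2 * pi * (2 / (x - 2))) {-2..2}"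
    by (intro has_integral_mult_left semicircle_total)
  moreover have "norm (?g y * ln (x - y) - ?g y * ln x) \<le> ?g y * (2 / (x - 2))" if y: "y \<in> {-2..2}" for y
  proof -
    have "y\<^sup>2 \<le> 2\<^sup>2" using y abs_le_square_iff[of y 2] by auto
    then have g: "?g y \<ge> 0" by simp
    have "ln (x - y) - ln x \<le> (x - y - x) / x" using ln_diff_le[of "x - y" x] y assms by simp
    also have "\<dots> \<le> 2 / (x - 2)" using y assms by (intro frac_le) auto
    finally have 1: "ln (x - y) - ln x \<le> 2 / (x - 2)" .
    have "ln x - ln (x - y) \<le> (x - (x - y)) / (x - y)" using ln_diff_le[of x "x - y"] y assms by simp
    also have "\<dots> \<le> 2 / (x - 2)" using y assms by (intro frac_le) auto
    finally have "\<bar>ln (x - y) - ln x\<bar> \<le> 2 / (x - 2)" using 1 by simp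
    then have "?g y * \<bar>ln (x - y) - ln x\<bar> \<le> ?g y * (2 / (x - 2))" using g by (rule mult_left_mono)
    then show ?thesis using g by (simp add: abs_mult flip: right_diff_distrib)
  qed
  ultimately have "norm (semicircle_log x - 2 * pi * ln x) \<le> 2 * pi * (2 / (x - 2))"
    using integral_norm_bound_integral[of "\<lambda>y. ?g y * ln (x - y) - ?g y * ln x" "{-2..2}" "\<lambda>y. ?g y * (2 / (x - 2))"]
    by (metis (no_types, lifting) has_integral_iff)
  then show ?thesis by simp
qed

text \<open>
  Both sides have derivative \<open>2 * pi / outer_root_real x\<close>, and both are \<open>2 * pi * ln x + O(1 / x)\<close> at infinity.
\<close>

lemma semicircle_log_eq:
  assumes "x > 2" shows "semicircle_log x = 2 * pi * line_potential x"
proof -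
  let ?D = "\<lambda>x. semicircle_log x - 2 * pi * line_potential x"
  have der: "(?D has_real_derivative 0) (at u)" if "u > 2" for u
    by (rule derivative_eq_intros semicircle_log_has_derivative[OF that] line_potential_has_derivative[OF that] | simp)+
  have "\<exists>c. \<forall>u\<in>{2<..}. ?D u = c"
    by (rule has_field_derivative_zero_constant) (use der in \<open>auto intro: has_field_derivative_at_within\<close>)
  then obtain c where c: "\<And>u. u > 2 \<Longrightarrow> ?D u = c" by auto
  have "\<bar>c\<bar> \<le> e" if "e > 0" for e
  proof -
    define u where "u = 3 + 8 * pi / e"
    have u: "u \<ge> 3" "8 * pi / e \<le> u - 2" using that by (auto simp: u_def)
    have "\<bar>c\<bar> = \<bar>(semicircle_log u - 2 * pi * ln u) - 2 * pi * (line_potential u - ln u)\<bar>"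
      using c[of u] u by (simp add: algebra_simps)
    also have "\<dots> \<le> 2 * pi * (2 / (u - 2)) + 2 * pi * (2 / (u - 2))"
    proof -
      have "\<bar>2 * pi * (line_potential u - ln u)\<bar> \<le> 2 * pi * (2 / (u - 2))"
        using mult_left_mono[OF line_potential_far[OF u(1)], of "2 * pi"] by (simp add: abs_mult)
      then show ?thesis using semicircle_log_far[OF u(1)] by linarith
    qed
    also have "\<dots> = 8 * pi / (u - 2)" by simp
    also have "\<dots> \<le> e" using u that by (simp add: field_simps)
    finally show ?thesis .
  qed
  then have "c = 0" by (metis abs_le_zero_iff field_le_epsilon add_0)
  then show ?thesis using c[OF assms] by simp
qed

lemma semicircle_integral:
  assumes [measurable]: "f \<in> borel_measurable borel"
  shows "(LINT y|semicircle. f y) = (LINT y|lborel. indicator {-2..2} y * (sqrt (4 - y\<^sup>2) * f y)) / (2 * pi)"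
proof -
  have nn: "0 \<le> 1 / (2 * pi) * sqrt (4 - y\<^sup>2) * indicator {-2..2} y" for y :: real
    using abs_le_square_iff[of y 2] by (auto simp: indicator_def)
  have "(LINT y|semicircle. f y) = (LINT y|lborel. (1 / (2 * pi) * sqrt (4 - y\<^sup>2) * indicator {-2..2} y) *\<^sub>R f y)"
    unfolding semicircle_def by (rule integral_density) (use nn in \<open>auto simp del: mult_1_left\<close>)
  also have "\<dots> = (LINT y|lborel. indicator {-2..2} y * (sqrt (4 - y\<^sup>2) * f y) / (2 * pi))"
    by (intro Bochner_Integration.integral_cong) (auto simp: indicator_def)
  finally show ?thesis by simp
qed

text \<open>
  The density vanishes like \<open>sqrt (2 - y)\<close> at the edge, which tames the logarithm uniformly in \<open>x\<close>.
\<close>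

lemma semicircle_log_density_bound:
  assumes "y \<in> {-2..2}" "2 \<le> x" "x \<le> 3"
  shows "\<bar>sqrt (4 - y\<^sup>2) * ln \<bar>x - y\<bar>\<bar> \<le> 24"
proof (cases "y = 2")
  case False
  define u where "u = x - y"
  define v where "v = 2 - y"
  have uv: "0 < v" "v \<le> u" "u \<le> 5" using assms False by (auto simp: u_def v_def)
  have g: "0 \<le> sqrt (4 - y\<^sup>2)" "sqrt (4 - y\<^sup>2) \<le> 2 * sqrt v"
  proof -
    have "4 - y\<^sup>2 = v * (4 - v)" by (simp add: v_def power2_eq_square algebra_simps)
    moreover have "v \<le> 4" using assms by (simp add: v_def)
    then have "0 \<le> v * (4 - v)" "v * (4 - v) \<le> 4 * v" using uv by (auto simp: right_diff_distrib)
    moreover note calculation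
    ultimately show "0 \<le> sqrt (4 - y\<^sup>2)" by simp
    have "sqrt (4 - y\<^sup>2) \<le> sqrt (4 * v)" using \<open>4 - y\<^sup>2 = _\<close> \<open>_ \<le> 4 * v\<close> by simp
    then show "sqrt (4 - y\<^sup>2) \<le> 2 * sqrt v" by (simp add: real_sqrt_mult)
  qed
  have "ln u \<le> 5" using ln_le_minus_one[of u] uv by simp
  moreover have "- ln u \<le> 2 / sqrt v"
  proof -
    have "- ln u \<le> - ln v" using uv by simp
    also have "\<dots> = 2 * ln (1 / sqrt v)" using uv by (simp add: ln_div ln_sqrt)
    also have "ln (1 / sqrt v) \<le> 1 / sqrt v" using ln_le_minus_one[of "1 / sqrt v"] uv by simp
    finally show ?thesis by simp
  qed
  moreover have "2 / sqrt v \<ge> 0" using uv by simp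
  ultimately have "\<bar>ln u\<bar> \<le> 5 + 2 / sqrt v" by linarith
  then have "sqrt (4 - y\<^sup>2) * \<bar>ln u\<bar> \<le> (2 * sqrt v) * (5 + 2 / sqrt v)"
    using g uv by (intro mult_mono) auto
  also have "\<dots> = 10 * sqrt v + 4" using uv by (simp add: field_simps)
  also have "\<dots> \<le> 10 * sqrt 4 + 4"
    using assms by (intro add_mono mult_left_mono real_sqrt_le_mono) (auto simp: v_def)
  finally have "sqrt (4 - y\<^sup>2) * \<bar>ln u\<bar> \<le> 24" by simp
  then show ?thesis using g by (simp only: abs_mult u_def[symmetric] abs_of_nonneg abs_of_pos[of u]) (use uv in simp)
qed simp

text \<open>
  The value at the edge \<open>x = 2\<close> is obtained by dominated convergence from the right.
\<close>

lemma semicircle_log_integral: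
  assumes "x \<ge> 2"
  shows "(LINT y|semicircle. ln \<bar>x - y\<bar>) = line_potential x"
proof -
  have gt: "(LINT y|semicircle. ln \<bar>x - y\<bar>) = line_potential x" if x: "x > 2" for x
  proof -
    have "(LINT y|semicircle. ln \<bar>x - y\<bar>)
       = (LINT y:{-2..2}|lborel. sqrt (4 - y\<^sup>2) * ln (x - y)) / (2 * pi)"
      unfolding set_lebesgue_integral_def using x
      by (subst semicircle_integral) (auto intro!: Bochner_Integration.integral_cong simp: indicator_def)
    also have "(LINT y:{-2..2}|lborel. sqrt (4 - y\<^sup>2) * ln (x - y)) = semicircle_log x"
      unfolding semicircle_log_def
      by (intro set_borel_integral_eq_integral borel_integrable_atLeastAtMost' continuous_intros) (use x in auto)
    finally show ?thesis using semicircle_log_eq[OF x] by simp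
  qed
  show ?thesis
  proof (cases "x = 2")
    case True
    define X where "X k = 2 + 1 / real (Suc k)" for k
    have X: "2 < X k" "X k \<le> 3" for k by (auto simp: X_def)
    have Xlim: "X \<longlonglongrightarrow> 2"
      unfolding X_def using tendsto_add[OF tendsto_const LIMSEQ_inverse_real_of_nat, of 2] by (simp add: inverse_eq_divide)
    let ?f = "\<lambda>x y. indicator {-2..2} y * (sqrt (4 - y\<^sup>2) * ln \<bar>x - y\<bar>) :: real"
    have "(\<lambda>k. LINT y|lborel. ?f (X k) y) \<longlonglongrightarrow> (LINT y|lborel. ?f 2 y)"
    proof (rule integral_dominated_convergence[where w = "\<lambda>y. 24 * indicator {-2..2} y"])
      show "AE y in lborel. (\<lambda>k. ?f (X k) y) \<longlonglongrightarrow> ?f 2 y"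
      proof (intro AE_I2)
        fix y :: real
        show "(\<lambda>k. ?f (X k) y) \<longlonglongrightarrow> ?f 2 y"
        proof (cases "y = 2")
          case False
          then show ?thesis by (intro tendsto_intros Xlim) auto
        qed simp
      qed
      show "AE y in lborel. norm (?f (X k) y) \<le> 24 * indicator {- 2..2} y" for k
        using semicircle_log_density_bound[of _ "X k"] X[of k]
        by (intro AE_I2) (auto simp: indicator_def less_imp_le)
    qed auto
    then have "(\<lambda>k. (LINT y|lborel. ?f (X k) y) / (2 * pi)) \<longlonglongrightarrow> (LINT y|lborel. ?f 2 y) / (2 * pi)"
      by (intro tendsto_intros) auto
    then have "(\<lambda>k. line_potential (X k)) \<longlonglongrightarrow> (LINT y|semicircle. ln \<bar>2 - y\<bar>)"
      by (simp add: semicircle_integral flip: gt[OF X(1)])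
    moreover have "(\<lambda>k. line_potential (X k)) \<longlonglongrightarrow> line_potential 2"
    proof -
      have "(\<lambda>k. (X k)\<^sup>2 / 4 - 1 / 2 - excess (X k)) \<longlonglongrightarrow> 2\<^sup>2 / 4 - 1 / 2 - excess 2"
      proof (intro tendsto_intros Xlim continuous_on_tendsto_compose[OF continuous_on_excess])
        show "\<forall>\<^sub>F k in sequentially. X k \<in> {2..}" using X by (simp add: less_imp_le)
      qed auto
      then show ?thesis by (simp add: excess_def)
    qed
    ultimately show ?thesis using LIMSEQ_unique True by blast
  next
    case False
    then show ?thesis using gt assms by simp
  qed
qed

lemma rate_J_eq: "rate_J x = (if x \<ge> 2 then ereal (excess x) else \<infinity>)"
  by (simp add: rate_J_def excess_def semicircle_log_integral)

section \<open>The Gaussian ensemble and its last coordinate\<close>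

abbreviation lebn :: "nat \<Rightarrow> (nat \<Rightarrow> real) measure"
  where "lebn N \<equiv> Pi\<^sub>M {..<N} (\<lambda>_. lborel)"

interpretation lebn: product_sigma_finite "\<lambda>_::nat. lborel :: real measure"
  by standard

lemma measurable_coordinate [measurable (raw)]:
  "i < N \<Longrightarrow> (\<lambda>x. x i) \<in> borel_measurable (lebn N)"
  using measurable_component_singleton[of i "{..<N}" "\<lambda>_. lborel"] by simp

lemma gbe_weight_measurable [measurable]: "gbe_weight N \<alpha> \<beta> \<in> borel_measurable (lebn N)"
  unfolding gbe_weight_def
  by (intro borel_measurable_times borel_measurable_exp borel_measurable_sum borel_measurable_prod
      borel_measurable_power powr_real_measurable borel_measurable_abs borel_measurable_diff
      measurable_coordinate borel_measurable_const) auto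

lemma gbe_weight_nonneg: "gbe_weight N \<alpha> \<beta> x \<ge> 0"
  unfolding gbe_weight_def by (intro mult_nonneg_nonneg prod_nonneg ballI) auto

text \<open>
  The factor by which the weight grows when a particle at \<open>t\<close> is added to the configuration \<open>x\<close>.
\<close>

definition insertion_kernel :: "real \<Rightarrow> real \<Rightarrow> nat \<Rightarrow> (nat \<Rightarrow> real) \<Rightarrow> real \<Rightarrow> real"
  where "insertion_kernel \<alpha> \<beta> N x t = exp (- (\<alpha> / 2) * t\<^sup>2) * (\<Prod>i<N. \<bar>x i - t\<bar> powr \<beta>)"

lemma insertion_kernel_nonneg: "insertion_kernel \<alpha> \<beta> N x t \<ge> 0"
  unfolding insertion_kernel_def by (intro mult_nonneg_nonneg prod_nonneg ballI) auto

lemma insertion_kernel_measurable [measurable]: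
  "(\<lambda>(x, t). insertion_kernel \<alpha> \<beta> N x t) \<in> borel_measurable (lebn N \<Otimes>\<^sub>M borel)"
proof -
  have "(\<lambda>p. fst p i) \<in> borel_measurable (lebn N \<Otimes>\<^sub>M (borel :: real measure))" if "i < N" for i
    by (rule measurable_compose[OF measurable_fst measurable_coordinate[OF that]])
  then show ?thesis
    unfolding insertion_kernel_def case_prod_beta
    by (intro borel_measurable_times borel_measurable_exp borel_measurable_prod
      borel_measurable_power powr_real_measurable borel_measurable_abs borel_measurable_diff
      borel_measurable_const measurable_snd) auto
qed

lemma insertion_kernel_measurable_real [measurable]:
  "insertion_kernel \<alpha> \<beta> N x \<in> borel_measurable borel"
  unfolding insertion_kernel_def by measurable

lemma gbe_weight_Suc:
  "gbe_weight (Suc N) \<alpha> \<beta> (x(N := t)) = gbe_weight N \<alpha> \<beta> x * insertion_kernel \<alpha> \<beta> N x t"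
proof -
  have "(\<Sum>i<Suc N. ((x(N := t)) i)\<^sup>2) = (\<Sum>i<N. (x i)\<^sup>2) + t\<^sup>2"
    by (auto intro!: sum.cong)
  moreover have "(\<Prod>j<Suc N. \<Prod>i<j. \<bar>(x(N := t)) i - (x(N := t)) j\<bar> powr \<beta>)
     = (\<Prod>j<N. \<Prod>i<j. \<bar>x i - x j\<bar> powr \<beta>) * (\<Prod>i<N. \<bar>x i - t\<bar> powr \<beta>)"
    by (auto intro!: arg_cong2[where f = "(*)"] prod.cong)
  moreover have "exp (- (\<alpha> / 2) * (s + t\<^sup>2)) = exp (- (\<alpha> / 2) * s) * exp (- (\<alpha> / 2) * t\<^sup>2)" for s
    by (simp only: exp_add[symmetric] distrib_left)
  ultimately show ?thesis
    by (simp only: gbe_weight_def insertion_kernel_def mult_ac)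
qed

lemma nn_integral_lebn_Suc:
  assumes "f \<in> borel_measurable (lebn (Suc N))"
  shows "integral\<^sup>N (lebn (Suc N)) f = (\<integral>\<^sup>+ x. (\<integral>\<^sup>+ t. f (x(N := t)) \<partial>lborel) \<partial>lebn N)"
  using lebn.product_nn_integral_insert[of "{..<N}" N f] assms by (simp add: lessThan_Suc)

lemma gaussian_integral_finite:
  assumes "c > 0" shows "(\<integral>\<^sup>+ t. ennreal (exp (- c * t\<^sup>2)) \<partial>lborel) < \<infinity>"
proof -
  define s where "s = 1 / sqrt (2 * c)"
  have s: "s > 0" "2 * s\<^sup>2 = 1 / c" using assms by (auto simp: s_def power_divide field_simps)
  have eq: "exp (- c * t\<^sup>2) = sqrt (2 * pi * s\<^sup>2) * normal_density 0 s t" for t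
    using s assms by (simp add: normal_density_def)
  interpret prob_space "density lborel (normal_density 0 s)"
    by (rule prob_space_normal_density[OF s(1)])
  have "(\<integral>\<^sup>+ t. ennreal (normal_density 0 s t) \<partial>lborel) = 1"
    using emeasure_space_1 by (simp add: emeasure_density cong: nn_integral_cong)
  then have "(\<integral>\<^sup>+ t. ennreal (exp (- c * t\<^sup>2)) \<partial>lborel) = ennreal (sqrt (2 * pi * s\<^sup>2))"
    unfolding eq by (simp add: ennreal_mult nn_integral_cmult)
  then show ?thesis by simp
qed

lemma abs_diff_le_sqrt: "\<bar>x - y\<bar> \<le> sqrt (1 + x\<^sup>2) * sqrt (1 + y\<^sup>2)" for x y :: real
proof -
  have "(x - y)\<^sup>2 \<le> (1 + x\<^sup>2) * (1 + y\<^sup>2)"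
  proof -
    have "(1 + x\<^sup>2) * (1 + y\<^sup>2) - (x - y)\<^sup>2 = (1 + x * y)\<^sup>2" by (simp add: power2_eq_square algebra_simps)
    then show ?thesis using zero_le_power2[of "1 + x * y"] by linarith
  qed
  then have "sqrt ((x - y)\<^sup>2) \<le> sqrt ((1 + x\<^sup>2) * (1 + y\<^sup>2))" by (rule real_sqrt_le_mono)
  then show ?thesis by (simp add: real_sqrt_mult)
qed

text \<open>
  Particles far away are controlled through \<open>\<bar>x - t\<bar>\<^sup>2 \<le> (1 + x\<^sup>2) * (1 + t\<^sup>2)\<close>, which separates the variables.
\<close>

lemma insertion_kernel_le:
  assumes "\<beta> > 0"
  shows "insertion_kernel \<alpha> \<beta> N x t \<le> exp (- (\<alpha> / 2) * t\<^sup>2 + \<beta> * real N * ln (sqrt (1 + t\<^sup>2)))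
     * exp (\<beta> * (\<Sum>i<N. sqrt (1 + (x i)\<^sup>2)))"
proof -
  have le: "\<bar>x i - t\<bar> powr \<beta> \<le> exp (\<beta> * ln (sqrt (1 + t\<^sup>2))) * exp (\<beta> * sqrt (1 + (x i)\<^sup>2))" for i
  proof -
    have p: "sqrt (1 + (x i)\<^sup>2) > 0" "sqrt (1 + t\<^sup>2) > 0" by (simp_all add: add_pos_nonneg)
    have "\<bar>x i - t\<bar> powr \<beta> \<le> (sqrt (1 + (x i)\<^sup>2) * sqrt (1 + t\<^sup>2)) powr \<beta>"
      using assms by (intro powr_mono2 abs_diff_le_sqrt) auto
    also have "\<dots> = exp (\<beta> * ln (sqrt (1 + t\<^sup>2))) * exp (\<beta> * ln (sqrt (1 + (x i)\<^sup>2)))"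
      using p by (simp only: powr_def ln_mult exp_add[symmetric] distrib_left) (auto simp: distrib_left)
    also have "\<dots> \<le> exp (\<beta> * ln (sqrt (1 + t\<^sup>2))) * exp (\<beta> * sqrt (1 + (x i)\<^sup>2))"
      using assms p ln_le_minus_one[OF p(1)] by (intro mult_left_mono) auto
    finally show ?thesis .
  qed
  have "(\<Prod>i<N. \<bar>x i - t\<bar> powr \<beta>) \<le> (\<Prod>i<N. exp (\<beta> * ln (sqrt (1 + t\<^sup>2))) * exp (\<beta> * sqrt (1 + (x i)\<^sup>2)))"
    using le by (intro prod_mono) auto
  also have "\<dots> = exp (\<beta> * real N * ln (sqrt (1 + t\<^sup>2))) * exp (\<beta> * (\<Sum>i<N. sqrt (1 + (x i)\<^sup>2)))"
    by (simp add: prod.distrib exp_sum sum_distrib_left mult_ac flip: exp_of_nat_mult)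
  finally have "insertion_kernel \<alpha> \<beta> N x t \<le> exp (- (\<alpha> / 2) * t\<^sup>2) *
     (exp (\<beta> * real N * ln (sqrt (1 + t\<^sup>2))) * exp (\<beta> * (\<Sum>i<N. sqrt (1 + (x i)\<^sup>2))))"
    unfolding insertion_kernel_def by (intro mult_left_mono) auto
  then show ?thesis by (simp only: exp_add mult.assoc)
qed

lemma insertion_tail_finite:
  assumes "\<alpha> > 0" "K \<ge> 0"
  shows "(\<integral>\<^sup>+ t. ennreal (exp (- (\<alpha> / 2) * t\<^sup>2 + K * sqrt (1 + t\<^sup>2))) \<partial>lborel) < \<infinity>"
proof -
  have le: "- (\<alpha> / 2) * t\<^sup>2 + K * sqrt (1 + t\<^sup>2) \<le> (\<alpha> / 4 + K\<^sup>2 / \<alpha>) + (- (\<alpha> / 4) * t\<^sup>2)" for t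
  proof -
    define r where "r = sqrt (1 + t\<^sup>2)"
    have r: "r\<^sup>2 = 1 + t\<^sup>2" by (simp add: r_def)
    have "0 \<le> \<alpha> * (r / 2 - K / \<alpha>)\<^sup>2" using assms by simp
    also have "\<dots> = \<alpha> / 4 * r\<^sup>2 - K * r + K\<^sup>2 / \<alpha>"
      using assms by (simp add: power2_eq_square field_simps)
    finally show ?thesis unfolding r r_def[symmetric] by (simp add: algebra_simps)
  qed
  have "(\<integral>\<^sup>+ t. ennreal (exp (- (\<alpha> / 2) * t\<^sup>2 + K * sqrt (1 + t\<^sup>2))) \<partial>lborel)
      \<le> (\<integral>\<^sup>+ t. ennreal (exp (\<alpha> / 4 + K\<^sup>2 / \<alpha>)) * ennreal (exp (- (\<alpha> / 4) * t\<^sup>2)) \<partial>lborel)"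
    using le by (intro nn_integral_mono) (auto simp only: ennreal_mult''[symmetric] exp_ge_zero exp_add[symmetric] intro!: ennreal_leI)
  also have "\<dots> < \<infinity>"
    using gaussian_integral_finite[of "\<alpha> / 4"] assms
    by (simp add: nn_integral_cmult ennreal_mult_less_top)
  finally show ?thesis .
qed

lemma sum_sqrt_measurable: "(\<lambda>x. \<Sum>i<N. sqrt (1 + (x i)\<^sup>2)) \<in> borel_measurable (lebn N)"
proof (rule borel_measurable_sum)
  fix i assume "i \<in> {..<N}"
  then have [measurable]: "(\<lambda>x. x i) \<in> borel_measurable (lebn N)" by (simp add: measurable_coordinate)
  show "(\<lambda>x. sqrt (1 + (x i)\<^sup>2)) \<in> borel_measurable (lebn N)" by measurable
qed

text \<open>
  Adding one particle at a time: each step raises \<open>c\<close> by \<open>\<beta>\<close> and leaves a one-dimensional Gaussian tail.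
\<close>

lemma gbe_weight_exp_moment_finite:
  assumes "\<alpha> > 0" "\<beta> > 0"
  shows "c \<ge> 0 \<Longrightarrow> (\<integral>\<^sup>+ x. ennreal (gbe_weight N \<alpha> \<beta> x * exp (c * (\<Sum>i<N. sqrt (1 + (x i)\<^sup>2)))) \<partial>lebn N) < \<infinity>"
proof (induction N arbitrary: c)
  case 0
  show ?case by (simp add: PiM_empty nn_integral_count_space_finite)
next
  case (Suc N)
  let ?S = "\<lambda>x. \<Sum>i<N. sqrt (1 + (x i)\<^sup>2)"
  have sum: "(\<Sum>i<Suc N. sqrt (1 + ((x(N := t)) i)\<^sup>2)) = ?S x + sqrt (1 + t\<^sup>2)" for x :: "nat \<Rightarrow> real" and t
    by (auto intro!: sum.cong)
  define T where "T = (\<integral>\<^sup>+ t. ennreal (exp (- (\<alpha> / 2) * t\<^sup>2 + (\<beta> * real N + c) * sqrt (1 + t\<^sup>2))) \<partial>lborel)"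
  note sum_sqrt_measurable [measurable]
  have "(\<integral>\<^sup>+ x. ennreal (gbe_weight (Suc N) \<alpha> \<beta> x * exp (c * (\<Sum>i<Suc N. sqrt (1 + (x i)\<^sup>2)))) \<partial>lebn (Suc N))
     = (\<integral>\<^sup>+ x. (\<integral>\<^sup>+ t. ennreal (gbe_weight N \<alpha> \<beta> x * insertion_kernel \<alpha> \<beta> N x t
          * exp (c * (?S x + sqrt (1 + t\<^sup>2)))) \<partial>lborel) \<partial>lebn N)"
    by (subst nn_integral_lebn_Suc) (simp_all only: gbe_weight_Suc sum, measurable)
  also have "\<dots> \<le> (\<integral>\<^sup>+ x. (\<integral>\<^sup>+ t. ennreal (gbe_weight N \<alpha> \<beta> x * exp ((c + \<beta>) * ?S x))
          * ennreal (exp (- (\<alpha> / 2) * t\<^sup>2 + (\<beta> * real N + c) * sqrt (1 + t\<^sup>2))) \<partial>lborel) \<partial>lebn N)"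
  proof (intro nn_integral_mono)
    fix x t
    have "sqrt (1 + t\<^sup>2) > 0" by (simp add: add_pos_nonneg)
    then have ln: "ln (sqrt (1 + t\<^sup>2)) \<le> sqrt (1 + t\<^sup>2)" using ln_le_minus_one[of "sqrt (1 + t\<^sup>2)"] by simp
    have "insertion_kernel \<alpha> \<beta> N x t * exp (c * (?S x + sqrt (1 + t\<^sup>2)))
        \<le> (exp (- (\<alpha> / 2) * t\<^sup>2 + \<beta> * real N * ln (sqrt (1 + t\<^sup>2))) * exp (\<beta> * ?S x))
          * exp (c * (?S x + sqrt (1 + t\<^sup>2)))"
      by (intro mult_right_mono insertion_kernel_le assms) auto
    also have "\<dots> = exp (- (\<alpha> / 2) * t\<^sup>2 + \<beta> * real N * ln (sqrt (1 + t\<^sup>2)) + c * sqrt (1 + t\<^sup>2)) * exp ((c + \<beta>) * ?S x)"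
      by (simp only: exp_add[symmetric]) (simp add: algebra_simps)
    also have "\<dots> \<le> exp (- (\<alpha> / 2) * t\<^sup>2 + (\<beta> * real N + c) * sqrt (1 + t\<^sup>2)) * exp ((c + \<beta>) * ?S x)"
      using assms mult_left_mono[OF ln, of "\<beta> * real N"] by (intro mult_right_mono) (auto simp: algebra_simps)
    finally have "gbe_weight N \<alpha> \<beta> x * (insertion_kernel \<alpha> \<beta> N x t * exp (c * (?S x + sqrt (1 + t\<^sup>2))))
       \<le> gbe_weight N \<alpha> \<beta> x * (exp (- (\<alpha> / 2) * t\<^sup>2 + (\<beta> * real N + c) * sqrt (1 + t\<^sup>2)) * exp ((c + \<beta>) * ?S x))"
      by (intro mult_left_mono gbe_weight_nonneg)
    then show "ennreal (gbe_weight N \<alpha> \<beta> x * insertion_kernel \<alpha> \<beta> N x t * exp (c * (?S x + sqrt (1 + t\<^sup>2))))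
       \<le> ennreal (gbe_weight N \<alpha> \<beta> x * exp ((c + \<beta>) * ?S x))
          * ennreal (exp (- (\<alpha> / 2) * t\<^sup>2 + (\<beta> * real N + c) * sqrt (1 + t\<^sup>2)))"
      by (simp add: gbe_weight_nonneg mult_ac ennreal_leI flip: ennreal_mult'')
  qed
  also have "\<dots> = (\<integral>\<^sup>+ x. ennreal (gbe_weight N \<alpha> \<beta> x * exp ((c + \<beta>) * ?S x)) \<partial>lebn N) * T"
    unfolding T_def by (simp add: nn_integral_cmult nn_integral_multc)
  also have "\<dots> < \<infinity>"
    using Suc.IH[of "c + \<beta>"] Suc.prems assms insertion_tail_finite[of \<alpha> "\<beta> * real N + c"]
    by (simp add: ennreal_mult_less_top T_def)
  finally show ?case .
qed

definition gbe_mass :: "nat \<Rightarrow> real \<Rightarrow> real \<Rightarrow> ennreal"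
  where "gbe_mass N \<alpha> \<beta> = (\<integral>\<^sup>+ x. ennreal (gbe_weight N \<alpha> \<beta> x) \<partial>lebn N)"

lemma gbe_mass_finite:
  assumes "\<alpha> > 0" "\<beta> > 0" shows "gbe_mass N \<alpha> \<beta> < \<infinity>"
  using gbe_weight_exp_moment_finite[OF assms, of 0 N] by (simp add: gbe_mass_def)

lemma insertion_integral_pos: "(\<integral>\<^sup>+ t. ennreal (insertion_kernel \<alpha> \<beta> N x t) \<partial>lborel) \<noteq> 0"
proof
  have meas: "insertion_kernel \<alpha> \<beta> N x \<in> borel_measurable lborel"
    unfolding insertion_kernel_def by measurable
  assume "(\<integral>\<^sup>+ t. ennreal (insertion_kernel \<alpha> \<beta> N x t) \<partial>lborel) = 0"
  then have "AE t in lborel. ennreal (insertion_kernel \<alpha> \<beta> N x t) = 0"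
    using meas by (subst (asm) nn_integral_0_iff_AE) auto
  moreover have "AE t in lborel. t \<notin> x ` {..<N}"
    by (intro AE_not_in countable_imp_null_set_lborel) auto
  ultimately have "AE t in (lborel :: real measure). False"
  proof eventually_elim
    fix t assume "ennreal (insertion_kernel \<alpha> \<beta> N x t) = 0" "t \<notin> x ` {..<N}"
    moreover then have "(\<Prod>i<N. \<bar>x i - t\<bar> powr \<beta>) > 0" by (intro prod_pos) auto
    ultimately show False
      using insertion_kernel_nonneg[of \<alpha> \<beta> N x t] by (simp add: ennreal_eq_0_iff insertion_kernel_def mult_le_0_iff)
  qed
  then show False by (simp add: eventually_False ae_filter_eq_bot_iff)
qed

lemma gbe_mass_pos: "gbe_mass N \<alpha> \<beta> \<noteq> 0"
proof (induction N)
  case 0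
  show ?case by (simp add: gbe_mass_def gbe_weight_def PiM_empty nn_integral_count_space_finite)
next
  case (Suc N)
  have m: "(\<lambda>x. \<integral>\<^sup>+ t. ennreal (insertion_kernel \<alpha> \<beta> N x t) \<partial>lborel) \<in> borel_measurable (lebn N)"
    by measurable
  show ?case
  proof
    assume "gbe_mass (Suc N) \<alpha> \<beta> = 0"
    then have "(\<integral>\<^sup>+ x. ennreal (gbe_weight N \<alpha> \<beta> x) * (\<integral>\<^sup>+ t. ennreal (insertion_kernel \<alpha> \<beta> N x t) \<partial>lborel) \<partial>lebn N) = 0"
      unfolding gbe_mass_def
      by (subst (asm) nn_integral_lebn_Suc)
         (simp_all add: gbe_weight_Suc gbe_weight_nonneg ennreal_mult insertion_kernel_nonneg nn_integral_cmult)
    then have "AE x in lebn N. ennreal (gbe_weight N \<alpha> \<beta> x) * (\<integral>\<^sup>+ t. ennreal (insertion_kernel \<alpha> \<beta> N x t) \<partial>lborel) = 0"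
      using m by (subst (asm) nn_integral_0_iff_AE) auto
    then have "AE x in lebn N. ennreal (gbe_weight N \<alpha> \<beta> x) = 0"
      by eventually_elim (simp add: insertion_integral_pos)
    then have "gbe_mass N \<alpha> \<beta> = 0" by (simp add: gbe_mass_def nn_integral_0_iff_AE)
    with Suc.IH show False by simp
  qed
qed

lemma gbe_mass_eq:
  assumes "\<alpha> > 0" "\<beta> > 0"
  shows "gbe_mass N \<alpha> \<beta> = ennreal (gbe_Z N \<alpha> \<beta>)" "gbe_Z N \<alpha> \<beta> > 0"
proof -
  have "gbe_Z N \<alpha> \<beta> = enn2real (gbe_mass N \<alpha> \<beta>)"
    unfolding gbe_Z_def gbe_mass_def by (rule integral_eq_nn_integral) (auto simp: gbe_weight_nonneg)
  then show "gbe_mass N \<alpha> \<beta> = ennreal (gbe_Z N \<alpha> \<beta>)" "gbe_Z N \<alpha> \<beta> > 0"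
    using gbe_mass_finite[OF assms, of N] gbe_mass_pos[of N \<alpha> \<beta>]
    by (simp_all add: enn2real_positive_iff zero_less_iff_neq_zero)
qed

lemma sets_gbe [measurable_cong]: "sets (gbe N \<alpha> \<beta>) = sets (lebn N)"
  by (simp add: gbe_def)

lemma space_gbe: "space (gbe N \<alpha> \<beta>) = space (lebn N)"
  by (simp add: gbe_def)

lemma nn_integral_gbe:
  assumes "\<alpha> > 0" "\<beta> > 0" and [measurable]: "f \<in> borel_measurable (lebn N)"
  shows "integral\<^sup>N (gbe N \<alpha> \<beta>) f = (\<integral>\<^sup>+ x. ennreal (gbe_weight N \<alpha> \<beta> x) * f x \<partial>lebn N) / gbe_mass N \<alpha> \<beta>"
proof -
  have "ennreal (gbe_weight N \<alpha> \<beta> x / gbe_Z N \<alpha> \<beta>) * f x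
      = ennreal (gbe_weight N \<alpha> \<beta> x) * f x / gbe_mass N \<alpha> \<beta>" for x
    using gbe_mass_eq[OF assms(1,2), of N]
    by (simp add: divide_ennreal[symmetric] gbe_weight_nonneg ennreal_divide_times ennreal_times_divide)
  then show ?thesis
    unfolding gbe_def by (subst nn_integral_density) (auto simp: nn_integral_divide)
qed

lemma prob_space_gbe:
  assumes "\<alpha> > 0" "\<beta> > 0" shows "prob_space (gbe N \<alpha> \<beta>)"
proof
  have "emeasure (gbe N \<alpha> \<beta>) (space (gbe N \<alpha> \<beta>)) = (\<integral>\<^sup>+ x. 1 \<partial>gbe N \<alpha> \<beta>)" by simp
  also have "\<dots> = gbe_mass N \<alpha> \<beta> / gbe_mass N \<alpha> \<beta>"
    by (subst nn_integral_gbe[OF assms]) (auto simp: gbe_mass_def)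
  also have "\<dots> = 1"
    using gbe_mass_finite[OF assms, of N] gbe_mass_pos[of N \<alpha> \<beta>] by (simp add: ennreal_divide_self)
  finally show "emeasure (gbe N \<alpha> \<beta>) (space (gbe N \<alpha> \<beta>)) = 1" .
qed

text \<open>
  The quantity \<open>D A\<close> of the introduction.
\<close>

definition insertion_mass :: "nat \<Rightarrow> real \<Rightarrow> real \<Rightarrow> real set \<Rightarrow> ennreal"
  where "insertion_mass N \<alpha> \<beta> A =
    (\<integral>\<^sup>+ x. (\<integral>\<^sup>+ t. ennreal (insertion_kernel \<alpha> \<beta> N x t) * indicator A t \<partial>lborel) \<partial>gbe N \<alpha> \<beta>)"

lemma gbe_mass_Suc:
  assumes "\<alpha> > 0" "\<beta> > 0" and [measurable]: "A \<in> sets borel"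
  shows "(\<integral>\<^sup>+ x. ennreal (gbe_weight (Suc N) \<alpha> \<beta> x) * indicator A (x N) \<partial>lebn (Suc N))
    = gbe_mass N \<alpha> \<beta> * insertion_mass N \<alpha> \<beta> A"
proof -
  have m: "(\<lambda>x. \<integral>\<^sup>+ t. ennreal (insertion_kernel \<alpha> \<beta> N x t) * indicator A t \<partial>lborel) \<in> borel_measurable (lebn N)"
    by measurable
  have "(\<integral>\<^sup>+ x. ennreal (gbe_weight (Suc N) \<alpha> \<beta> x) * indicator A (x N) \<partial>lebn (Suc N))
    = (\<integral>\<^sup>+ x. ennreal (gbe_weight N \<alpha> \<beta> x) * (\<integral>\<^sup>+ t. ennreal (insertion_kernel \<alpha> \<beta> N x t) * indicator A t \<partial>lborel) \<partial>lebn N)"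
    by (subst nn_integral_lebn_Suc)
       (simp_all add: gbe_weight_Suc gbe_weight_nonneg ennreal_mult insertion_kernel_nonneg mult.assoc nn_integral_cmult)
  also have "\<dots> = gbe_mass N \<alpha> \<beta> * insertion_mass N \<alpha> \<beta> A"
    unfolding insertion_mass_def using gbe_mass_finite[OF assms(1,2), of N] gbe_mass_pos[of N \<alpha> \<beta>]
    by (subst nn_integral_gbe[OF assms(1,2) m])
       (simp add: ennreal_times_divide mult.commute[of "gbe_mass N \<alpha> \<beta>"] mult_divide_eq_ennreal)
  finally show ?thesis .
qed

text \<open>
  Fubini for the last coordinate; the partition function of the smaller ensemble cancels.
\<close>

lemma emeasure_gbe_last:
  assumes "\<alpha> > 0" "\<beta> > 0" and [measurable]: "A \<in> sets borel"
  shows "emeasure (gbe (Suc N) \<alpha> \<beta>) {x \<in> space (gbe (Suc N) \<alpha> \<beta>). x N \<in> A}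
     = insertion_mass N \<alpha> \<beta> A / insertion_mass N \<alpha> \<beta> UNIV"
proof -
  let ?E = "{x \<in> space (lebn (Suc N)). x N \<in> A}"
  have [measurable]: "(\<lambda>x. x N) \<in> borel_measurable (lebn (Suc N))" by (rule measurable_coordinate) simp
  have [measurable]: "?E \<in> sets (lebn (Suc N))" by measurable
  have eq: "gbe_mass (Suc N) \<alpha> \<beta> = gbe_mass N \<alpha> \<beta> * insertion_mass N \<alpha> \<beta> UNIV"
    using gbe_mass_Suc[OF assms(1,2), of UNIV N] by (simp add: gbe_mass_def)
  have "emeasure (gbe (Suc N) \<alpha> \<beta>) ?E = (\<integral>\<^sup>+ x. indicator ?E x \<partial>gbe (Suc N) \<alpha> \<beta>)"
    by (simp add: sets_gbe)
  also have "\<dots> = (\<integral>\<^sup>+ x. ennreal (gbe_weight (Suc N) \<alpha> \<beta> x) * indicator A (x N) \<partial>lebn (Suc N)) / gbe_mass (Suc N) \<alpha> \<beta>"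
    by (subst nn_integral_gbe[OF assms(1,2)]) (auto intro!: arg_cong2[where f = "(/)"] nn_integral_cong simp: indicator_def)
  also have "\<dots> = gbe_mass N \<alpha> \<beta> * insertion_mass N \<alpha> \<beta> A / (gbe_mass N \<alpha> \<beta> * insertion_mass N \<alpha> \<beta> UNIV)"
    by (simp only: gbe_mass_Suc[OF assms] eq)
  also have "\<dots> = insertion_mass N \<alpha> \<beta> A / insertion_mass N \<alpha> \<beta> UNIV"
    using gbe_mass_finite[OF assms(1,2), of N] gbe_mass_pos[of N \<alpha> \<beta>]
    by (simp add: mult.commute[of "gbe_mass N \<alpha> \<beta>"] divide_mult_eq)
  finally show ?thesis by (simp add: space_gbe)
qed

section \<open>The change of variables inequality\<close>

lemma lborel_substitution:
  fixes \<phi> \<phi>' :: "real \<Rightarrow> real"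
  assumes der: "\<And>t. (\<phi> has_real_derivative \<phi>' t) (at t)" and cont: "continuous_on UNIV \<phi>'"
    and pos: "\<And>t. \<phi>' t > 0" and disp: "\<And>t. \<bar>\<phi> t - t\<bar> \<le> C"
    and [measurable]: "f \<in> borel_measurable borel"
  shows "(\<integral>\<^sup>+ t. f (\<phi> t) * ennreal (\<phi>' t) \<partial>lborel) = (\<integral>\<^sup>+ t. f t \<partial>lborel)"
proof -
  have [measurable]: "\<phi>' \<in> borel_measurable borel" by (rule borel_measurable_continuous_onI[OF cont])
  have cphi: "continuous_on UNIV \<phi>"
    using der by (meson DERIV_continuous_on has_field_derivative_at_within)
  have [measurable]: "\<phi> \<in> borel_measurable borel" by (rule borel_measurable_continuous_onI[OF cphi])
  have mono: "\<phi> s < \<phi> t" if "s < t" for s t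
    using DERIV_pos_imp_increasing[OF that, of \<phi>] der pos by blast
  have surj: "\<exists>t. \<phi> t = l" for l
  proof -
    have "C \<ge> 0" using disp[of 0] abs_ge_zero order_trans by blast
    moreover have "\<phi> (l - C) \<le> l" "l \<le> \<phi> (l + C)" using disp[of "l - C"] disp[of "l + C"] by (auto simp: abs_le_iff)
    ultimately show ?thesis
      using IVT'[of \<phi> "l - C" l "l + C"] continuous_on_subset[OF cphi] by auto
  qed
  let ?M = "distr (density lborel (\<lambda>t. ennreal (\<phi>' t))) borel \<phi>"
  have "lborel = ?M"
  proof (rule lborel_eqI)
    fix l u :: real assume "\<And>b. b \<in> Basis \<Longrightarrow> l \<bullet> b \<le> u \<bullet> b"
    then have lu: "l \<le> u" by simp
    obtain p q where pq: "\<phi> p = l" "\<phi> q = u" using surj by metis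
    have "p \<le> q" using mono[of q p] lu pq by (metis not_less)
    have pre: "\<phi> -` box l u = {p<..<q}"
      using mono pq by (auto simp: box_real) (metis less_asym less_irrefl linorder_neqE)+
    have "emeasure ?M (box l u) = (\<integral>\<^sup>+ t. ennreal (\<phi>' t) * indicator {p<..<q} t \<partial>lborel)"
      by (subst emeasure_distr, simp, simp, unfold pre) (simp add: emeasure_density)
    also have "\<dots> = (\<integral>\<^sup>+ t. ennreal (\<phi>' t) * indicator {p..q} t \<partial>lborel)"
    proof (intro nn_integral_cong_AE)
      have "AE t in lborel. t \<noteq> p" "AE t in lborel. t \<noteq> q" by (rule AE_lborel_singleton)+
      then show "AE t in lborel. ennreal (\<phi>' t) * indicator {p<..<q} t = ennreal (\<phi>' t) * indicator {p..q} t"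
        by eventually_elim (auto simp: indicator_def)
    qed
    also have "\<dots> = ennreal (\<phi> q - \<phi> p)"
      by (rule nn_integral_FTC_Icc) (auto simp: der pos less_imp_le \<open>p \<le> q\<close>)
    finally show "emeasure ?M (box l u) = (\<Prod>b\<in>Basis. (u - l) \<bullet> b)" by (simp add: pq)
  qed simp
  then have "(\<integral>\<^sup>+ t. f t \<partial>lborel) = (\<integral>\<^sup>+ t. f t \<partial>?M)" by simp
  also have "\<dots> = (\<integral>\<^sup>+ t. f (\<phi> t) * ennreal (\<phi>' t) \<partial>lborel)"
    by (simp add: nn_integral_distr nn_integral_density mult.commute)
  finally show ?thesis by simp
qed

text \<open>
  The same increasing substitution in every coordinate, by induction on the dimension.
\<close>

lemma lebn_substitution:
  fixes \<phi> \<phi>' :: "real \<Rightarrow> real"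
  assumes der: "\<And>t. (\<phi> has_real_derivative \<phi>' t) (at t)" and cont: "continuous_on UNIV \<phi>'"
    and pos: "\<And>t. \<phi>' t > 0" and disp: "\<And>t. \<bar>\<phi> t - t\<bar> \<le> C"
  shows "f \<in> borel_measurable (lebn N) \<Longrightarrow>
    (\<integral>\<^sup>+ x. f (\<lambda>i\<in>{..<N}. \<phi> (x i)) * (\<Prod>i<N. ennreal (\<phi>' (x i))) \<partial>lebn N) = (\<integral>\<^sup>+ x. f x \<partial>lebn N)"
proof (induction N arbitrary: f)
  case 0
  then show ?case by (simp add: PiM_empty nn_integral_count_space_finite restrict_def)
next
  case (Suc N)
  note [measurable] = Suc.prems
  have [measurable]: "\<phi>' \<in> borel_measurable borel" by (rule borel_measurable_continuous_onI[OF cont])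
  have "continuous_on UNIV \<phi>"
    using der by (meson DERIV_continuous_on has_field_derivative_at_within)
  then have [measurable]: "\<phi> \<in> borel_measurable borel" by (rule borel_measurable_continuous_onI)
  have upd: "(\<lambda>p. (fst p)(N := snd p)) \<in> lebn N \<Otimes>\<^sub>M lborel \<rightarrow>\<^sub>M lebn (Suc N)"
    using measurable_add_dim[of N "{..<N}" "\<lambda>_. lborel"] by (simp add: case_prod_beta lessThan_Suc)
  have fupd [measurable]: "(\<lambda>p. f ((fst p)(N := snd p))) \<in> borel_measurable (lebn N \<Otimes>\<^sub>M lborel)"
    by (rule measurable_compose[OF upd Suc.prems])
  define g where "g x = (\<integral>\<^sup>+ t. f (x(N := t)) \<partial>lborel)" for x
  have g [measurable]: "g \<in> borel_measurable (lebn N)"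
    unfolding g_def using lborel.borel_measurable_nn_integral_fst[OF fupd] by simp
  have res [measurable]: "(\<lambda>x. \<lambda>i\<in>{..<M}. \<phi> (x i)) \<in> lebn M \<rightarrow>\<^sub>M lebn M" for M
    by (rule measurable_restrict) (auto intro!: measurable_compose[OF measurable_coordinate])
  have prod [measurable]: "(\<lambda>x. \<Prod>i<M. ennreal (\<phi>' (x i))) \<in> borel_measurable (lebn M)" for M
    by (rule borel_measurable_prod_ennreal) (auto intro!: measurable_compose[OF measurable_coordinate])
  have eq: "(\<lambda>i\<in>{..<Suc N}. \<phi> ((x(N := t)) i)) = (\<lambda>i\<in>{..<N}. \<phi> (x i))(N := \<phi> t)" for x :: "nat \<Rightarrow> real" and t
    by (auto simp: restrict_def)
  have eqp: "(\<Prod>i<Suc N. ennreal (\<phi>' ((x(N := t)) i))) = (\<Prod>i<N. ennreal (\<phi>' (x i))) * ennreal (\<phi>' t)" for x :: "nat \<Rightarrow> real" and t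
    by (auto intro!: arg_cong2[where f = "(*)"] prod.cong)
  have "(\<integral>\<^sup>+ x. f (\<lambda>i\<in>{..<Suc N}. \<phi> (x i)) * (\<Prod>i<Suc N. ennreal (\<phi>' (x i))) \<partial>lebn (Suc N))
     = (\<integral>\<^sup>+ x. (\<integral>\<^sup>+ t. f ((\<lambda>i\<in>{..<N}. \<phi> (x i))(N := \<phi> t)) * ((\<Prod>i<N. ennreal (\<phi>' (x i))) * ennreal (\<phi>' t)) \<partial>lborel) \<partial>lebn N)"
    by (subst nn_integral_lebn_Suc)
       (simp_all only: eq eqp borel_measurable_times_ennreal prod measurable_compose[OF res Suc.prems])
  also have "\<dots> = (\<integral>\<^sup>+ x. g (\<lambda>i\<in>{..<N}. \<phi> (x i)) * (\<Prod>i<N. ennreal (\<phi>' (x i))) \<partial>lebn N)"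
  proof (rule nn_integral_cong)
    fix x :: "nat \<Rightarrow> real"
    let ?y = "\<lambda>i\<in>{..<N}. \<phi> (x i)"
    have "?y \<in> space (lebn N)" by (auto simp: space_PiM)
    then have m: "(\<lambda>t. f (?y(N := t))) \<in> borel_measurable borel"
      using measurable_compose[OF measurable_component_update[of ?y "{..<N}" "\<lambda>_. lborel" N] , of f borel] Suc.prems
      by (simp add: lessThan_Suc)
    have "(\<integral>\<^sup>+ t. f (?y(N := \<phi> t)) * ((\<Prod>i<N. ennreal (\<phi>' (x i))) * ennreal (\<phi>' t)) \<partial>lborel)
        = (\<integral>\<^sup>+ t. (\<Prod>i<N. ennreal (\<phi>' (x i))) * (f (?y(N := \<phi> t)) * ennreal (\<phi>' t)) \<partial>lborel)"
      by (simp add: mult_ac)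
    also have "\<dots> = (\<Prod>i<N. ennreal (\<phi>' (x i))) * (\<integral>\<^sup>+ t. f (?y(N := \<phi> t)) * ennreal (\<phi>' t) \<partial>lborel)"
      using measurable_compose[OF \<open>\<phi> \<in> borel_measurable borel\<close> m] by (intro nn_integral_cmult) auto
    also have "(\<integral>\<^sup>+ t. f (?y(N := \<phi> t)) * ennreal (\<phi>' t) \<partial>lborel) = g ?y"
      unfolding g_def by (rule lborel_substitution[OF der cont pos disp m])
    finally show "(\<integral>\<^sup>+ t. f (?y(N := \<phi> t)) * ((\<Prod>i<N. ennreal (\<phi>' (x i))) * ennreal (\<phi>' t)) \<partial>lborel)
       = g ?y * (\<Prod>i<N. ennreal (\<phi>' (x i)))" unfolding mult.commute[of "g ?y"] .
  qed
  also have "\<dots> = (\<integral>\<^sup>+ x. g x \<partial>lebn N)" by (rule Suc.IH[OF g])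
  also have "\<dots> = (\<integral>\<^sup>+ x. f x \<partial>lebn (Suc N))"
    unfolding g_def by (rule nn_integral_lebn_Suc[symmetric]) (rule Suc.prems)
  finally show ?case .
qed

definition divdiff :: "(real \<Rightarrow> real) \<Rightarrow> (real \<Rightarrow> real) \<Rightarrow> real \<Rightarrow> real \<Rightarrow> real"
  where "divdiff f f' x y = (if x = y then f' x else (f x - f y) / (x - y))"

text \<open>
  Its expectation vanishes to leading order by the loop (Schwinger--Dyson) equation. Two sizes occur: \<open>N\<close> is the number of
  particles and \<open>n\<close> fixes the strength \<open>n * \<beta> / 2\<close> of the confinement; \<open>N\<close> will be \<open>n\<close> or \<open>n - 1\<close>.
\<close>

definition loop_defect :: "(real \<Rightarrow> real) \<Rightarrow> (real \<Rightarrow> real) \<Rightarrow> nat \<Rightarrow> nat \<Rightarrow> (nat \<Rightarrow> real) \<Rightarrow> real"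
  where "loop_defect f f' n N x =
    (\<Sum>i<N. \<Sum>j<N. divdiff f f' (x i) (x j)) - real n * (\<Sum>i<N. x i * f (x i))"

lemma divdiff_commute: "divdiff f f' x y = divdiff f f' y x"
  using minus_divide_divide[of "f x - f y" "x - y"] by (simp add: divdiff_def)

lemma divdiff_bound:
  assumes der: "\<And>t. (f has_real_derivative f' t) (at t)" and "\<And>t. \<bar>f' t\<bar> \<le> L"
  shows "\<bar>divdiff f f' x y\<bar> \<le> L"
proof -
  have *: "\<bar>divdiff f f' x y\<bar> \<le> L" if "x < y" for x y
  proof -
    have "\<exists>t>x. t < y \<and> f y - f x = (y - x) * f' t" by (rule MVT2[OF that der])
    then obtain t where "f y - f x = (y - x) * f' t" by blast
    then have "divdiff f f' x y = f' t" using that by (simp add: divdiff_def field_simps)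
    then show ?thesis using assms(2) by simp
  qed
  show ?thesis
  proof (cases x y rule: linorder_cases)
    case less
    then show ?thesis by (rule *)
  next
    case equal
    then show ?thesis using assms(2)[of x] by (simp add: divdiff_def)
  next
    case greater
    then show ?thesis by (subst divdiff_commute) (rule *)
  qed
qed

lemma symmetric_double_sum:
  fixes d :: "nat \<Rightarrow> nat \<Rightarrow> real"
  assumes "\<And>i j. d i j = d j i"
  shows "(\<Sum>i<N. \<Sum>j<N. d i j) = 2 * (\<Sum>j<N. \<Sum>i<j. d i j) + (\<Sum>i<N. d i i)"
proof (induction N)
  case (Suc N)
  have "(\<Sum>j<N. d N j) = (\<Sum>i<N. d i N)" using assms by (intro sum.cong) auto
  then show ?case using Suc by (simp add: sum.distrib)
qed simp

lemma exp_le_one_plus: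
  fixes u :: real assumes "\<bar>u\<bar> \<le> b" "b \<le> 1 / 2" shows "exp (u - 2 * b\<^sup>2) \<le> 1 + u"
proof -
  have u: "\<bar>u\<bar> \<le> 1 / 2" using assms by simp
  have "u - ln (1 + u) \<le> 2 * u\<^sup>2" using abs_ln_one_plus_x_minus_x_bound[OF u] by simp
  moreover have "u\<^sup>2 \<le> b\<^sup>2" using assms abs_le_square_iff[of u b] by simp
  ultimately have "u - 2 * b\<^sup>2 \<le> ln (1 + u)" by simp
  then have "exp (u - 2 * b\<^sup>2) \<le> exp (ln (1 + u))" by simp
  then show ?thesis using u by (simp add: abs_le_iff)
qed

text \<open>
  The substitution multiplies each gap \<open>x i - x j\<close> by \<open>1 + \<epsilon> * divdiff f f' (x i) (x j)\<close>, so coinciding or close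
  particles cause no singularity. The first-order terms in \<open>\<epsilon>\<close> add up to \<open>\<epsilon> * \<beta> / 2 * loop_defect\<close>, apart from diagonal and
  Jacobian terms of size \<open>\<epsilon> * N * L\<close>; second-order terms are bounded by means of \<open>exp (u - 2 * b\<^sup>2) \<le> 1 + u\<close>.
\<close>

lemma weight_change:
  assumes der: "\<And>t. (f has_real_derivative f' t) (at t)"
    and A: "\<And>t. \<bar>f t\<bar> \<le> A" and L: "\<And>t. \<bar>f' t\<bar> \<le> L"
    and e: "\<epsilon> \<ge> 0" "\<epsilon> * L \<le> 1 / 2" and b: "\<beta> > 0" and N: "N \<le> n"
  shows "gbe_weight N (real n * \<beta> / 2) \<beta> x * exp (\<epsilon> * \<beta> / 2 * loop_defect f f' n N x
       - (\<epsilon> * real N * L * (1 + \<beta> / 2) + 2 * real N * (\<epsilon> * L)\<^sup>2 + \<epsilon>\<^sup>2 * (real n)\<^sup>2 * \<beta> * (A\<^sup>2 + 2 * L\<^sup>2)))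
    \<le> gbe_weight N (real n * \<beta> / 2) \<beta> (\<lambda>i\<in>{..<N}. x i + \<epsilon> * f (x i)) * (\<Prod>i<N. 1 + \<epsilon> * f' (x i))"
proof -
  let ?\<alpha> = "real n * \<beta> / 2"
  let ?y = "\<lambda>i. x i + \<epsilon> * f (x i)"
  let ?d = "\<lambda>i j. divdiff f f' (x i) (x j)"
  have L0: "L \<ge> 0" using L[of 0] by simp
  have small: "\<bar>\<epsilon> * u\<bar> \<le> \<epsilon> * L" if "\<bar>u\<bar> \<le> L" for u using that e by (simp add: abs_mult mult_left_mono)
  have dL: "\<bar>?d i j\<bar> \<le> L" for i j by (rule divdiff_bound[OF der L])
  define P where "P = (\<Sum>j<N. \<Sum>i<j. ?d i j)"
  define S where "S = (\<Sum>i<N. x i * f (x i))"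
  have pair: "\<bar>x i - x j\<bar> powr \<beta> * exp (\<beta> * (\<epsilon> * ?d i j - 2 * (\<epsilon> * L)\<^sup>2)) \<le> \<bar>?y i - ?y j\<bar> powr \<beta>" for i j
  proof -
    have "?y i - ?y j = (x i - x j) * (1 + \<epsilon> * ?d i j)"
      by (simp add: divdiff_def field_simps)
    then have "\<bar>?y i - ?y j\<bar> = \<bar>x i - x j\<bar> * \<bar>1 + \<epsilon> * ?d i j\<bar>" by (simp add: abs_mult)
    also have "\<dots> \<ge> \<bar>x i - x j\<bar> * exp (\<epsilon> * ?d i j - 2 * (\<epsilon> * L)\<^sup>2)"
      using exp_le_one_plus[OF small[OF dL] e(2)] by (intro mult_left_mono) (auto intro: order_trans[OF _ abs_ge_self])
    finally have "(\<bar>x i - x j\<bar> * exp (\<epsilon> * ?d i j - 2 * (\<epsilon> * L)\<^sup>2)) powr \<beta> \<le> \<bar>?y i - ?y j\<bar> powr \<beta>"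
      using b by (intro powr_mono2) auto
    then show ?thesis by (simp add: powr_mult exp_powr_real mult.commute)
  qed
  have pairs: "(\<Prod>j<N. \<Prod>i<j. \<bar>x i - x j\<bar> powr \<beta>) * exp (\<beta> * (\<epsilon> * P - 2 * (\<epsilon> * L)\<^sup>2 * (real N)\<^sup>2))
     \<le> (\<Prod>j<N. \<Prod>i<j. \<bar>?y i - ?y j\<bar> powr \<beta>)"
  proof -
    have "(\<Sum>j<N. \<Sum>i<j. 2 * (\<epsilon> * L)\<^sup>2) \<le> (\<Sum>j<N. \<Sum>i<N. 2 * (\<epsilon> * L)\<^sup>2)"
      by (intro sum_mono sum_mono2) auto
    then have le: "(\<Sum>j<N. \<Sum>i<j. 2 * (\<epsilon> * L)\<^sup>2) \<le> 2 * (\<epsilon> * L)\<^sup>2 * (real N)\<^sup>2"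
      by (simp add: power2_eq_square mult_ac)
    have "(\<Prod>j<N. \<Prod>i<j. \<bar>x i - x j\<bar> powr \<beta>) * exp (\<beta> * (\<epsilon> * P - 2 * (\<epsilon> * L)\<^sup>2 * (real N)\<^sup>2))
       \<le> (\<Prod>j<N. \<Prod>i<j. \<bar>x i - x j\<bar> powr \<beta>) * exp (\<beta> * (\<Sum>j<N. \<Sum>i<j. \<epsilon> * ?d i j - 2 * (\<epsilon> * L)\<^sup>2))"
      using b le by (intro mult_left_mono prod_nonneg ballI) (auto simp: P_def sum_subtractf sum_distrib_left)
    also have "\<dots> = (\<Prod>j<N. \<Prod>i<j. \<bar>x i - x j\<bar> powr \<beta> * exp (\<beta> * (\<epsilon> * ?d i j - 2 * (\<epsilon> * L)\<^sup>2)))"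
      by (simp add: prod.distrib exp_sum sum_distrib_left)
    also have "\<dots> \<le> (\<Prod>j<N. \<Prod>i<j. \<bar>?y i - ?y j\<bar> powr \<beta>)"
      using pair by (intro prod_mono conjI prod_nonneg ballI) auto
    finally show ?thesis .
  qed
  have diag: "exp (\<Sum>i<N. \<epsilon> * f' (x i) - 2 * (\<epsilon> * L)\<^sup>2) \<le> (\<Prod>i<N. 1 + \<epsilon> * f' (x i))"
    unfolding exp_sum[OF finite_lessThan]
    using exp_le_one_plus[OF small[OF L] e(2)] by (intro prod_mono) auto
  have fl: "(\<Sum>i<N. \<epsilon> * f' (x i) - 2 * (\<epsilon> * L)\<^sup>2) \<ge> - (\<epsilon> * real N * L) - 2 * real N * (\<epsilon> * L)\<^sup>2"
  proof -
    have "(\<Sum>i<N. - (\<epsilon> * L) - 2 * (\<epsilon> * L)\<^sup>2) \<le> (\<Sum>i<N. \<epsilon> * f' (x i) - 2 * (\<epsilon> * L)\<^sup>2)"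
      using small[OF L] by (intro sum_mono) (auto simp: abs_le_iff minus_le_iff)
    then show ?thesis by (simp add: algebra_simps)
  qed
  have gauss: "exp (- (?\<alpha> / 2) * (\<Sum>i<N. (x i)\<^sup>2)) * exp (- ?\<alpha> * \<epsilon> * S - \<epsilon>\<^sup>2 * (real n)\<^sup>2 * \<beta> * A\<^sup>2)
      \<le> exp (- (?\<alpha> / 2) * (\<Sum>i<N. (?y i)\<^sup>2))"
  proof -
    have "(\<Sum>i<N. (f (x i))\<^sup>2) \<le> (\<Sum>i<N. A\<^sup>2)"
      using A by (intro sum_mono) (metis abs_ge_zero power2_abs power_mono)
    also have "\<dots> \<le> real n * A\<^sup>2" using N by (simp add: mult_right_mono)
    finally have "?\<alpha> / 2 * \<epsilon>\<^sup>2 * (\<Sum>i<N. (f (x i))\<^sup>2) \<le> ?\<alpha> / 2 * \<epsilon>\<^sup>2 * (real n * A\<^sup>2)"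
      using b by (intro mult_left_mono) auto
    also have "\<dots> = (\<epsilon>\<^sup>2 * (real n)\<^sup>2 * \<beta> * A\<^sup>2) / 4" by (simp add: power2_eq_square)
    also have "\<dots> \<le> \<epsilon>\<^sup>2 * (real n)\<^sup>2 * \<beta> * A\<^sup>2" using b by simp
    finally have "?\<alpha> / 2 * \<epsilon>\<^sup>2 * (\<Sum>i<N. (f (x i))\<^sup>2) \<le> \<epsilon>\<^sup>2 * (real n)\<^sup>2 * \<beta> * A\<^sup>2" .
    moreover have "(\<Sum>i<N. (?y i)\<^sup>2) = (\<Sum>i<N. (x i)\<^sup>2) + 2 * \<epsilon> * S + \<epsilon>\<^sup>2 * (\<Sum>i<N. (f (x i))\<^sup>2)"
      by (simp add: S_def power2_eq_square algebra_simps sum.distrib sum_distrib_left)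
    ultimately show ?thesis by (simp add: exp_add[symmetric] algebra_simps)
  qed
  have exponent: "\<epsilon> * \<beta> / 2 * loop_defect f f' n N x
       - (\<epsilon> * real N * L * (1 + \<beta> / 2) + 2 * real N * (\<epsilon> * L)\<^sup>2 + \<epsilon>\<^sup>2 * (real n)\<^sup>2 * \<beta> * (A\<^sup>2 + 2 * L\<^sup>2))
     \<le> (- ?\<alpha> * \<epsilon> * S - \<epsilon>\<^sup>2 * (real n)\<^sup>2 * \<beta> * A\<^sup>2) + \<beta> * (\<epsilon> * P - 2 * (\<epsilon> * L)\<^sup>2 * (real N)\<^sup>2)
        + (\<Sum>i<N. \<epsilon> * f' (x i) - 2 * (\<epsilon> * L)\<^sup>2)"
  proof -
    have "(\<Sum>i<N. ?d i i) \<le> (\<Sum>i<N. L)" using dL by (intro sum_mono) (auto simp: abs_le_iff)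
    then have d: "(\<Sum>i<N. ?d i i) \<le> real N * L" by simp
    have "loop_defect f f' n N x = 2 * P + (\<Sum>i<N. ?d i i) - real n * S"
      unfolding loop_defect_def P_def S_def by (subst symmetric_double_sum) (auto simp: divdiff_commute)
    also have "\<dots> \<le> 2 * P + real N * L - real n * S" using d by simp
    finally have "\<epsilon> * \<beta> / 2 * loop_defect f f' n N x \<le> \<epsilon> * \<beta> / 2 * (2 * P + real N * L - real n * S)"
      using e b by (intro mult_left_mono) auto
    moreover have "\<beta> * (2 * (\<epsilon> * L)\<^sup>2 * (real N)\<^sup>2) \<le> \<beta> * (2 * (\<epsilon> * L)\<^sup>2 * (real n)\<^sup>2)"
      using b N by (intro mult_left_mono power_mono) auto
    ultimately show ?thesis using fl by (simp add: algebra_simps power_mult_distrib)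
  qed
  let ?W = "\<Prod>j<N. \<Prod>i<j. \<bar>x i - x j\<bar> powr \<beta>" and ?G = "exp (- (?\<alpha> / 2) * (\<Sum>i<N. (x i)\<^sup>2))"
  have W0: "?W \<ge> 0" by (intro prod_nonneg ballI) auto
  have "gbe_weight N ?\<alpha> \<beta> x * exp (\<epsilon> * \<beta> / 2 * loop_defect f f' n N x
       - (\<epsilon> * real N * L * (1 + \<beta> / 2) + 2 * real N * (\<epsilon> * L)\<^sup>2 + \<epsilon>\<^sup>2 * (real n)\<^sup>2 * \<beta> * (A\<^sup>2 + 2 * L\<^sup>2)))
    \<le> gbe_weight N ?\<alpha> \<beta> x * exp ((- ?\<alpha> * \<epsilon> * S - \<epsilon>\<^sup>2 * (real n)\<^sup>2 * \<beta> * A\<^sup>2) + \<beta> * (\<epsilon> * P - 2 * (\<epsilon> * L)\<^sup>2 * (real N)\<^sup>2)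
        + (\<Sum>i<N. \<epsilon> * f' (x i) - 2 * (\<epsilon> * L)\<^sup>2))"
    using exponent by (intro mult_left_mono gbe_weight_nonneg) simp
  also have "\<dots> = (?G * exp (- ?\<alpha> * \<epsilon> * S - \<epsilon>\<^sup>2 * (real n)\<^sup>2 * \<beta> * A\<^sup>2))
     * (?W * exp (\<beta> * (\<epsilon> * P - 2 * (\<epsilon> * L)\<^sup>2 * (real N)\<^sup>2))) * exp (\<Sum>i<N. \<epsilon> * f' (x i) - 2 * (\<epsilon> * L)\<^sup>2)"
    unfolding gbe_weight_def exp_add by (simp only: mult_ac)
  also have "\<dots> \<le> exp (- (?\<alpha> / 2) * (\<Sum>i<N. (?y i)\<^sup>2)) * (\<Prod>j<N. \<Prod>i<j. \<bar>?y i - ?y j\<bar> powr \<beta>)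
     * (\<Prod>i<N. 1 + \<epsilon> * f' (x i))"
    using W0 by (intro mult_mono gauss pairs diag mult_nonneg_nonneg prod_nonneg ballI) auto
  also have "exp (- (?\<alpha> / 2) * (\<Sum>i<N. (?y i)\<^sup>2)) * (\<Prod>j<N. \<Prod>i<j. \<bar>?y i - ?y j\<bar> powr \<beta>)
     = gbe_weight N ?\<alpha> \<beta> (\<lambda>i\<in>{..<N}. ?y i)"
    unfolding gbe_weight_def by (intro arg_cong2[where f = "(*)"] arg_cong[where f = exp] sum.cong prod.cong refl) auto
  finally show ?thesis .
qed

lemma loop_defect_measurable:
  assumes [measurable]: "f \<in> borel_measurable borel" "f' \<in> borel_measurable borel"
  shows "loop_defect f f' n N \<in> borel_measurable (lebn N)"
proof -
  have m: "(\<lambda>x. divdiff f f' (x i) (x j)) \<in> borel_measurable (lebn N)" if "i < N" "j < N" for i j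
  proof -
    have [measurable]: "(\<lambda>x. x i) \<in> borel_measurable (lebn N)" "(\<lambda>x. x j) \<in> borel_measurable (lebn N)"
      using that by (auto intro: measurable_coordinate)
    show ?thesis unfolding divdiff_def by measurable
  qed
  have m': "(\<lambda>x. x i * f (x i)) \<in> borel_measurable (lebn N)" if "i < N" for i
  proof -
    have [measurable]: "(\<lambda>x. x i) \<in> borel_measurable (lebn N)"
      using that by (auto intro: measurable_coordinate)
    show ?thesis by measurable
  qed
  show ?thesis
    unfolding loop_defect_def[abs_def] using m m'
    by (intro borel_measurable_diff borel_measurable_times borel_measurable_const borel_measurable_sum) auto
qed

text \<open>
  Integrating \<open>weight_change\<close>: the right-hand side there is the weight after a change of variables, so it has the same
  integral as the weight itself.
\<close>

lemma loop_defect_exponential_bound: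
  assumes der: "\<And>t. (f has_real_derivative f' t) (at t)" and cont: "continuous_on UNIV f'"
    and A: "\<And>t. \<bar>f t\<bar> \<le> A" and L: "\<And>t. \<bar>f' t\<bar> \<le> L"
    and e: "\<epsilon> \<ge> 0" "\<epsilon> * L \<le> 1 / 2" and b: "\<beta> > 0" and N: "N \<le> n" "n > 0"
  shows "(\<integral>\<^sup>+ x. ennreal (exp (\<epsilon> * \<beta> / 2 * loop_defect f f' n N x)) \<partial>gbe N (real n * \<beta> / 2) \<beta>)
    \<le> ennreal (exp (\<epsilon> * real N * L * (1 + \<beta> / 2) + 2 * real N * (\<epsilon> * L)\<^sup>2
        + \<epsilon>\<^sup>2 * (real n)\<^sup>2 * \<beta> * (A\<^sup>2 + 2 * L\<^sup>2)))"
proof -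
  let ?\<alpha> = "real n * \<beta> / 2"
  define C where "C = \<epsilon> * real N * L * (1 + \<beta> / 2) + 2 * real N * (\<epsilon> * L)\<^sup>2
        + \<epsilon>\<^sup>2 * (real n)\<^sup>2 * \<beta> * (A\<^sup>2 + 2 * L\<^sup>2)"
  have al: "?\<alpha> > 0" using b N by simp
  let ?phi = "\<lambda>t. t + \<epsilon> * f t" and ?phi' = "\<lambda>t. 1 + \<epsilon> * f' t"
  have "continuous_on UNIV f"
    using der by (meson DERIV_continuous_on has_field_derivative_at_within)
  then have fm: "f \<in> borel_measurable borel" by (rule borel_measurable_continuous_onI)
  have fm': "f' \<in> borel_measurable borel" by (rule borel_measurable_continuous_onI[OF cont])
  note [measurable] = loop_defect_measurable[OF fm fm']
  have pos: "?phi' t > 0" for t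
  proof -
    have "\<bar>\<epsilon> * f' t\<bar> \<le> \<epsilon> * L" using L e by (simp add: abs_mult mult_left_mono)
    then show ?thesis using e by (simp add: abs_le_iff)
  qed
  have "(\<integral>\<^sup>+ x. ennreal (gbe_weight N ?\<alpha> \<beta> x) * ennreal (exp (\<epsilon> * \<beta> / 2 * loop_defect f f' n N x)) \<partial>lebn N)
      \<le> (\<integral>\<^sup>+ x. ennreal (exp C) * (ennreal (gbe_weight N ?\<alpha> \<beta> (\<lambda>i\<in>{..<N}. ?phi (x i))) * (\<Prod>i<N. ennreal (?phi' (x i)))) \<partial>lebn N)"
  proof (intro nn_integral_mono)
    fix x :: "nat \<Rightarrow> real"
    let ?w = "gbe_weight N ?\<alpha> \<beta> x" and ?v = "gbe_weight N ?\<alpha> \<beta> (\<lambda>i\<in>{..<N}. ?phi (x i)) * (\<Prod>i<N. ?phi' (x i))"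
    have "?w * exp (\<epsilon> * \<beta> / 2 * loop_defect f f' n N x - C) \<le> ?v"
      unfolding C_def by (rule weight_change[OF der A L e b N(1)])
    then have "exp C * (?w * exp (\<epsilon> * \<beta> / 2 * loop_defect f f' n N x - C)) \<le> exp C * ?v"
      by (rule mult_left_mono) simp
    then have "?w * exp (\<epsilon> * \<beta> / 2 * loop_defect f f' n N x) \<le> exp C * ?v"
      by (simp add: exp_diff)
    then have "ennreal (?w * exp (\<epsilon> * \<beta> / 2 * loop_defect f f' n N x)) \<le> ennreal (exp C * ?v)"
      by (rule ennreal_leI)
    then show "ennreal ?w * ennreal (exp (\<epsilon> * \<beta> / 2 * loop_defect f f' n N x))
       \<le> ennreal (exp C) * (ennreal (gbe_weight N ?\<alpha> \<beta> (\<lambda>i\<in>{..<N}. ?phi (x i))) * (\<Prod>i<N. ennreal (?phi' (x i))))"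
      using pos by (simp add: ennreal_mult gbe_weight_nonneg prod_nonneg prod_ennreal less_imp_le)
  qed
  also have "\<dots> = ennreal (exp C) * gbe_mass N ?\<alpha> \<beta>"
  proof -
    have res: "(\<lambda>x. \<lambda>i\<in>{..<N}. ?phi (x i)) \<in> lebn N \<rightarrow>\<^sub>M lebn N"
      using fm by (intro measurable_restrict) (auto intro!: measurable_compose[OF measurable_coordinate])
    have "(\<lambda>x. ennreal (gbe_weight N ?\<alpha> \<beta> (\<lambda>i\<in>{..<N}. ?phi (x i))) * (\<Prod>i<N. ennreal (?phi' (x i)))) \<in> borel_measurable (lebn N)"
      using fm' measurable_compose[OF res gbe_weight_measurable]
      by (intro borel_measurable_times_ennreal borel_measurable_prod_ennreal measurable_compose[OF _ measurable_ennreal])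
         (auto intro!: measurable_compose[OF measurable_coordinate])
    then have "(\<integral>\<^sup>+ x. ennreal (exp C) * (ennreal (gbe_weight N ?\<alpha> \<beta> (\<lambda>i\<in>{..<N}. ?phi (x i))) * (\<Prod>i<N. ennreal (?phi' (x i)))) \<partial>lebn N)
      = ennreal (exp C) * (\<integral>\<^sup>+ x. ennreal (gbe_weight N ?\<alpha> \<beta> (\<lambda>i\<in>{..<N}. ?phi (x i))) * (\<Prod>i<N. ennreal (?phi' (x i))) \<partial>lebn N)"
      by (rule nn_integral_cmult)
    also have "(\<integral>\<^sup>+ x. ennreal (gbe_weight N ?\<alpha> \<beta> (\<lambda>i\<in>{..<N}. ?phi (x i))) * (\<Prod>i<N. ennreal (?phi' (x i))) \<partial>lebn N) = gbe_mass N ?\<alpha> \<beta>"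
      unfolding gbe_mass_def
    proof (rule lebn_substitution[where C = "\<epsilon> * A"])
      show "(?phi has_real_derivative ?phi' t) (at t)" for t
        by (auto intro!: derivative_eq_intros der)
      show "continuous_on UNIV ?phi'" by (intro continuous_intros cont)
      show "\<bar>?phi t - t\<bar> \<le> \<epsilon> * A" for t using A e by (simp add: abs_mult mult_left_mono)
    qed (use pos in auto)
    finally show ?thesis .
  qed
  finally have le: "(\<integral>\<^sup>+ x. ennreal (gbe_weight N ?\<alpha> \<beta> x) * ennreal (exp (\<epsilon> * \<beta> / 2 * loop_defect f f' n N x)) \<partial>lebn N)
     \<le> ennreal (exp C) * gbe_mass N ?\<alpha> \<beta>" .
  have "(\<integral>\<^sup>+ x. ennreal (exp (\<epsilon> * \<beta> / 2 * loop_defect f f' n N x)) \<partial>gbe N ?\<alpha> \<beta>)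
     \<le> ennreal (exp C) * gbe_mass N ?\<alpha> \<beta> / gbe_mass N ?\<alpha> \<beta>"
    using le by (subst nn_integral_gbe[OF al b]) (auto intro!: divide_right_mono_ennreal)
  also have "\<dots> = ennreal (exp C)"
    using gbe_mass_finite[OF al b, of N] gbe_mass_pos[of N ?\<alpha> \<beta>] by (simp add: mult_divide_eq_ennreal)
  finally show ?thesis by (simp only: C_def)
qed

section \<open>Consequences for resolvents and for moments\<close>

text \<open>
  The bounds needed for \<open>loop_defect_exponential_bound\<close>; the unimodular \<open>c\<close> selects real or imaginary part and the sign.
\<close>

lemma resolvent_test_function:
  assumes c: "cmod c = 1" and z: "Im z > 0"
  defines "f \<equiv> \<lambda>t. Re (c / (z - complex_of_real t))"
    and "f' \<equiv> \<lambda>t. Re (c / (z - complex_of_real t)\<^sup>2)"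
  shows "(f has_real_derivative f' t) (at t)" "continuous_on UNIV f'"
    "\<bar>f t\<bar> \<le> 1 / Im z" "\<bar>f' t\<bar> \<le> 1 / (Im z)\<^sup>2"
    "divdiff f f' s t = Re (c / ((z - complex_of_real s) * (z - complex_of_real t)))"
proof -
  have nz: "z - complex_of_real t \<noteq> 0" for t using z by (auto simp: complex_eq_iff)
  have ge: "Im z \<le> cmod (z - complex_of_real t)" for t
    using abs_Im_le_cmod[of "z - complex_of_real t"] z by simp
  have "((\<lambda>u. c / (z - u)) has_field_derivative c / (z - complex_of_real t)\<^sup>2) (at (complex_of_real t))"
    using nz[of t] by (auto intro!: derivative_eq_intros simp: power2_eq_square)
  then have "((\<lambda>t. c / (z - complex_of_real t)) has_vector_derivative c / (z - complex_of_real t)\<^sup>2) (at t)"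
    by (rule has_vector_derivative_real_field)
  then show "(f has_real_derivative f' t) (at t)"
    by (auto simp: f_def f'_def has_vector_derivative_complex_iff)
  show "continuous_on UNIV f'"
    unfolding f'_def using nz by (intro continuous_intros) auto
  have "\<bar>f t\<bar> \<le> cmod (c / (z - complex_of_real t))" unfolding f_def by (rule abs_Re_le_cmod)
  also have "\<dots> \<le> 1 / Im z" using c z ge[of t] by (simp add: norm_divide frac_le)
  finally show "\<bar>f t\<bar> \<le> 1 / Im z" .
  have "\<bar>f' t\<bar> \<le> cmod (c / (z - complex_of_real t)\<^sup>2)" unfolding f'_def by (rule abs_Re_le_cmod)
  also have "\<dots> \<le> 1 / (Im z)\<^sup>2" using c z ge[of t] by (auto simp: norm_divide norm_power intro!: frac_le power_mono)
  finally show "\<bar>f' t\<bar> \<le> 1 / (Im z)\<^sup>2" .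
  show "divdiff f f' s t = Re (c / ((z - complex_of_real s) * (z - complex_of_real t)))"
  proof (cases "s = t")
    case True
    then show ?thesis by (simp add: divdiff_def f'_def power2_eq_square)
  next
    case False
    have "c / (z - complex_of_real s) - c / (z - complex_of_real t)
        = complex_of_real (s - t) * (c / ((z - complex_of_real s) * (z - complex_of_real t)))"
      using nz[of s] nz[of t] by (simp add: field_simps)
    then have "f s - f t = Re (complex_of_real (s - t) * (c / ((z - complex_of_real s) * (z - complex_of_real t))))"
      unfolding f_def by (simp only: minus_complex.sel(1)[symmetric])
    also have "\<dots> = (s - t) * Re (c / ((z - complex_of_real s) * (z - complex_of_real t)))"
      by (simp only: Re_complex_of_real Im_complex_of_real times_complex.sel(1))
    finally show ?thesis using False by (simp add: divdiff_def)
  qed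
qed

text \<open>
  For resolvents the double sum factorises, and \<open>t / (z - t) = z / (z - t) - 1\<close> handles the linear sum.
\<close>

lemma loop_defect_resolvent:
  fixes x :: "nat \<Rightarrow> real"
  assumes c: "cmod c = 1" and z: "Im z > 0" and N: "N > 0"
  shows "loop_defect (\<lambda>t. Re (c / (z - complex_of_real t))) (\<lambda>t. Re (c / (z - complex_of_real t)\<^sup>2)) n N x
     = Re (c * ((of_nat N * resolvent_mean N x z)\<^sup>2 - of_nat n * of_nat N * (z * resolvent_mean N x z - 1)))"
proof -
  have nz: "z - complex_of_real t \<noteq> 0" for t using z by (auto simp: complex_eq_iff)
  let ?r = "\<lambda>i. 1 / (z - complex_of_real (x i))"
  let ?s = "resolvent_mean N x z"
  have Ns: "of_nat N * ?s = (\<Sum>i<N. ?r i)" using N by (simp add: resolvent_mean_def)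
  have "(\<Sum>i<N. \<Sum>j<N. divdiff (\<lambda>t. Re (c / (z - complex_of_real t))) (\<lambda>t. Re (c / (z - complex_of_real t)\<^sup>2)) (x i) (x j))
     = (\<Sum>i<N. \<Sum>j<N. Re (c * (?r i * ?r j)))"
    by (simp add: resolvent_test_function(5)[OF c z])
  also have "\<dots> = Re (c * (\<Sum>i<N. \<Sum>j<N. ?r i * ?r j))"
    by (simp only: sum_distrib_left Re_sum)
  also have "(\<Sum>i<N. \<Sum>j<N. ?r i * ?r j) = (of_nat N * ?s)\<^sup>2"
    unfolding Ns power2_eq_square by (rule sum_product[symmetric])
  finally have 1: "(\<Sum>i<N. \<Sum>j<N. divdiff (\<lambda>t. Re (c / (z - complex_of_real t))) (\<lambda>t. Re (c / (z - complex_of_real t)\<^sup>2)) (x i) (x j))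
     = Re (c * (of_nat N * ?s)\<^sup>2)" .
  have "x i * Re (c / (z - complex_of_real (x i))) = Re (c * (z * ?r i - 1))" for i
  proof -
    have "complex_of_real (x i) * (c / (z - complex_of_real (x i))) = c * (z * ?r i - 1)"
      using nz[of "x i"] by (simp add: field_simps)
    then show ?thesis by (metis Re_complex_of_real Im_complex_of_real times_complex.sel(1) mult_zero_left diff_zero)
  qed
  then have "(\<Sum>i<N. x i * Re (c / (z - complex_of_real (x i)))) = Re (c * (\<Sum>i<N. z * ?r i - 1))"
    by (simp only: sum_distrib_left Re_sum)
  also have "(\<Sum>i<N. z * ?r i - 1) = of_nat N * (z * ?s - 1)"
    by (simp only: sum_subtractf sum_distrib_left[symmetric] Ns[symmetric]) (simp add: algebra_simps)
  finally have 2: "(\<Sum>i<N. x i * Re (c / (z - complex_of_real (x i)))) = Re (c * (of_nat N * (z * ?s - 1)))" .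
  have "real n * Re w = Re (of_nat n * w)" for w by simp
  then show ?thesis
    unfolding loop_defect_def 1 2 by (simp only: minus_complex.sel(1)[symmetric]) (simp only: right_diff_distrib mult_ac)
qed

lemma Re_unit_multiple:
  obtains c where "c \<in> {1, -1, \<i>, -\<i>}" "cmod w \<le> 2 * Re (c * w)"
proof -
  have "cmod w \<le> \<bar>Re w\<bar> + \<bar>Im w\<bar>" by (rule cmod_le)
  then consider "cmod w \<le> 2 * Re w" | "cmod w \<le> 2 * - Re w" | "cmod w \<le> 2 * - Im w" | "cmod w \<le> 2 * Im w"
    by linarith
  then show thesis
  proof cases
    case 1
    then show ?thesis by (intro that[of 1]) auto
  next
    case 2
    then show ?thesis by (intro that[of "-1"]) auto
  next
    case 3
    then show ?thesis by (intro that[of "\<i>"]) auto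
  next
    case 4
    then show ?thesis by (intro that[of "-\<i>"]) auto
  qed
qed

lemma resolvent_mean_bound:
  assumes "Im z > 0" shows "cmod (resolvent_mean N x z) \<le> 1 / Im z"
proof (cases "N = 0")
  case False
  have "cmod (\<Sum>i<N. 1 / (z - complex_of_real (x i))) \<le> (\<Sum>i<N. 1 / Im z)"
  proof (intro sum_norm_le)
    fix i
    show "cmod (1 / (z - complex_of_real (x i))) \<le> 1 / Im z"
      using abs_Im_le_cmod[of "z - complex_of_real (x i)"] assms by (simp add: norm_divide frac_le)
  qed
  then show ?thesis using False by (simp add: resolvent_mean_def norm_divide field_simps)
qed (use assms in \<open>simp add: resolvent_mean_def\<close>)

text \<open>
  One of the four directions \<open>c\<close> sees at least half of the modulus. The mismatch between \<open>n\<close> and \<open>N\<close> only contributes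
  \<open>O(N)\<close>, since the resolvent mean is bounded.
\<close>

lemma large_defect_large_loop:
  fixes x :: "nat \<Rightarrow> real"
  assumes z: "Im z > 0" and N: "N > 0" "N \<le> n" "n \<le> N + 1"
    and big: "real N * \<delta> \<ge> 2 * (1 + cmod z / Im z)" and d: "cmod (resolvent_defect N x z) > \<delta>"
  obtains c where "c \<in> {1, -1, \<i>, -\<i>}"
    "loop_defect (\<lambda>t. Re (c / (z - complex_of_real t))) (\<lambda>t. Re (c / (z - complex_of_real t)\<^sup>2)) n N x \<ge> (real N)\<^sup>2 * \<delta> / 4"
proof -
  let ?s = "resolvent_mean N x z"
  define Y where "Y = (of_nat N * ?s)\<^sup>2 - of_nat n * of_nat N * (z * ?s - 1)"
  have eq: "(of_nat N)\<^sup>2 * resolvent_defect N x z = Y + (of_nat n - of_nat N) * of_nat N * (z * ?s - 1)"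
    by (simp add: Y_def resolvent_defect_def power2_eq_square algebra_simps)
  have "cmod (z * ?s - 1) \<le> cmod z * cmod ?s + 1"
    using norm_triangle_ineq4[of "z * ?s" 1] by (simp add: norm_mult)
  also have "\<dots> \<le> 1 + cmod z / Im z"
    using mult_left_mono[OF resolvent_mean_bound[OF z, of N x], of "cmod z"] by simp
  finally have zs: "cmod (z * ?s - 1) \<le> 1 + cmod z / Im z" .
  have "cmod (of_nat n - of_nat N) = real n - real N"
    using N by (metis norm_of_nat of_nat_diff)
  then have "cmod (of_nat n - of_nat N) \<le> 1" using N by simp
  then have "cmod ((of_nat n - of_nat N) * of_nat N * (z * ?s - 1)) \<le> (1 * real N) * (1 + cmod z / Im z)"
    unfolding norm_mult using zs by (intro mult_mono) auto
  also have "\<dots> \<le> real N * (real N * \<delta> / 2)"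
  proof -
    have "1 + cmod z / Im z \<le> real N * \<delta> / 2" using divide_right_mono[OF big, of 2] by simp
    then show ?thesis unfolding mult_1_left by (rule mult_left_mono) simp
  qed
  finally have "cmod ((of_nat n - of_nat N) * of_nat N * (z * ?s - 1)) \<le> (real N)\<^sup>2 * \<delta> / 2"
    by (simp add: power2_eq_square)
  moreover have "cmod ((of_nat N)\<^sup>2 * resolvent_defect N x z) \<le> cmod Y + cmod ((of_nat n - of_nat N) * of_nat N * (z * ?s - 1))"
    unfolding eq by (rule norm_triangle_ineq)
  moreover have "(real N)\<^sup>2 * \<delta> \<le> cmod ((of_nat N)\<^sup>2 * resolvent_defect N x z)"
    using d by (simp add: norm_mult norm_power mult_left_mono)
  ultimately have Y: "(real N)\<^sup>2 * \<delta> / 2 \<le> cmod Y" by linarith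
  obtain c where c: "c \<in> {1, -1, \<i>, -\<i>}" "cmod Y \<le> 2 * Re (c * Y)" by (rule Re_unit_multiple)
  have "cmod c = 1" using c by auto
  from loop_defect_resolvent[OF this z N(1)] c Y show thesis
    by (intro that[OF c(1)]) (simp add: Y_def)
qed

lemma exp_Markov:
  assumes [measurable]: "f \<in> borel_measurable M"
    and le: "(\<integral>\<^sup>+ x. ennreal (exp (t * f x)) \<partial>M) \<le> ennreal (exp C)" and t: "t \<ge> 0"
  shows "emeasure M {x \<in> space M. f x \<ge> r} \<le> ennreal (exp (C - t * r))"
proof -
  have "emeasure M {x \<in> space M. f x \<ge> r} \<le> emeasure M {x \<in> space M. 1 \<le> ennreal (exp (- (t * r))) * ennreal (exp (t * f x))}"
  proof (intro emeasure_mono, safe)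
    fix x assume "r \<le> f x"
    then have "t * r \<le> t * f x" using t by (rule mult_left_mono)
    then show "1 \<le> ennreal (exp (- (t * r))) * ennreal (exp (t * f x))"
      by (simp add: exp_add[symmetric] flip: ennreal_mult'')
  qed measurable
  also have "\<dots> \<le> ennreal (exp (- (t * r))) * (\<integral>\<^sup>+ x. ennreal (exp (t * f x)) * indicator (space M) x \<partial>M)"
    by (rule nn_integral_Markov_inequality) measurable
  also have "(\<integral>\<^sup>+ x. ennreal (exp (t * f x)) * indicator (space M) x \<partial>M) = (\<integral>\<^sup>+ x. ennreal (exp (t * f x)) \<partial>M)"
    by (intro nn_integral_cong) auto
  also have "ennreal (exp (- (t * r))) * (\<integral>\<^sup>+ x. ennreal (exp (t * f x)) \<partial>M) \<le> ennreal (exp (- (t * r))) * ennreal (exp C)"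
    by (intro mult_left_mono le) auto
  also have "\<dots> = ennreal (exp (C - t * r))"
    by (simp add: exp_diff exp_minus field_simps flip: ennreal_mult'')
  finally show ?thesis .
qed

lemma resolvent_mean_measurable:
  "(\<lambda>x. resolvent_mean N x z) \<in> borel_measurable (lebn N)"
proof -
  have "(\<lambda>x. 1 / (z - complex_of_real (x i))) \<in> borel_measurable (lebn N)" if "i < N" for i
  proof -
    have [measurable]: "(\<lambda>x. x i) \<in> borel_measurable (lebn N)"
      using that by (auto intro: measurable_coordinate)
    show ?thesis by measurable
  qed
  then have "(\<lambda>x. \<Sum>i<N. 1 / (z - complex_of_real (x i))) \<in> borel_measurable (lebn N)"
    by (intro borel_measurable_sum) auto
  then show ?thesis unfolding resolvent_mean_def by measurable
qed

lemma resolvent_defect_measurable: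
  "(\<lambda>x. resolvent_defect N x z) \<in> borel_measurable (lebn N)"
proof -
  note [measurable] = resolvent_mean_measurable
  show ?thesis unfolding resolvent_defect_def by measurable
qed

lemma resolvent_defect_tail:
  assumes z: "Im z > 0" and N: "N > 0" "N \<le> n" "n \<le> N + 1" and b: "\<beta> > 0"
    and big: "real N * \<delta> \<ge> 2 * (1 + cmod z / Im z)"
    and e: "\<epsilon> \<ge> 0" "\<epsilon> * (1 / (Im z)\<^sup>2) \<le> 1 / 2"
  shows "emeasure (gbe N (real n * \<beta> / 2) \<beta>) {x \<in> space (lebn N). cmod (resolvent_defect N x z) > \<delta>}
    \<le> 4 * ennreal (exp (\<epsilon> * real N * (1 / (Im z)\<^sup>2) * (1 + \<beta> / 2) + 2 * real N * (\<epsilon> * (1 / (Im z)\<^sup>2))\<^sup>2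
        + \<epsilon>\<^sup>2 * (real n)\<^sup>2 * \<beta> * ((1 / Im z)\<^sup>2 + 2 * (1 / (Im z)\<^sup>2)\<^sup>2)
        - \<epsilon> * \<beta> / 2 * ((real N)\<^sup>2 * \<delta> / 4)))"
proof -
  let ?M = "gbe N (real n * \<beta> / 2) \<beta>"
  let ?Y = "\<lambda>c. loop_defect (\<lambda>t. Re (c / (z - complex_of_real t))) (\<lambda>t. Re (c / (z - complex_of_real t)\<^sup>2)) n N"
  let ?E = "\<lambda>c. {x \<in> space ?M. ?Y c x \<ge> (real N)\<^sup>2 * \<delta> / 4}"
  let ?C = "{1, -1, \<i>, -\<i>}"
  define b where "b = ennreal (exp (\<epsilon> * real N * (1 / (Im z)\<^sup>2) * (1 + \<beta> / 2) + 2 * real N * (\<epsilon> * (1 / (Im z)\<^sup>2))\<^sup>2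
        + \<epsilon>\<^sup>2 * (real n)\<^sup>2 * \<beta> * ((1 / Im z)\<^sup>2 + 2 * (1 / (Im z)\<^sup>2)\<^sup>2)
        - \<epsilon> * \<beta> / 2 * ((real N)\<^sup>2 * \<delta> / 4)))"
  have Ym: "?Y c \<in> borel_measurable ?M" for c
  proof -
    have "?Y c \<in> borel_measurable (lebn N)" by (rule loop_defect_measurable) measurable
    then show ?thesis by (simp add: measurable_cong_sets[OF sets_gbe refl])
  qed
  have bound: "emeasure ?M (?E c) \<le> b" if "c \<in> ?C" for c
  proof -
    have c: "cmod c = 1" using that by auto
    note T = resolvent_test_function[OF c z]
    show ?thesis unfolding b_def
      by (rule exp_Markov[OF Ym loop_defect_exponential_bound[OF T(1) T(2) T(3) T(4) e \<open>\<beta> > 0\<close> N(2)]])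
         (use e N \<open>\<beta> > 0\<close> in auto)
  qed
  have "emeasure ?M {x \<in> space (lebn N). cmod (resolvent_defect N x z) > \<delta>} \<le> emeasure ?M (\<Union>c\<in>?C. ?E c)"
  proof (rule emeasure_mono)
    show "{x \<in> space (lebn N). cmod (resolvent_defect N x z) > \<delta>} \<subseteq> (\<Union>c\<in>?C. ?E c)"
    proof
      fix x assume "x \<in> {x \<in> space (lebn N). cmod (resolvent_defect N x z) > \<delta>}"
      then obtain c where "c \<in> ?C" "?Y c x \<ge> (real N)\<^sup>2 * \<delta> / 4"
        using large_defect_large_loop[OF z N big, of x] by auto
      with \<open>x \<in> _\<close> show "x \<in> (\<Union>c\<in>?C. ?E c)" by (auto simp: space_gbe)
    qed
    have "?E c \<in> sets ?M" for c using Ym[of c] by measurable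
    then show "(\<Union>c\<in>?C. ?E c) \<in> sets ?M" by blast
  qed
  also have "\<dots> \<le> (\<Sum>c\<in>?C. emeasure ?M (?E c))"
  proof (rule emeasure_subadditive_finite)
    have "?E c \<in> sets ?M" for c using Ym[of c] by measurable
    then show "?E ` ?C \<subseteq> sets ?M" by blast
  qed simp
  also have "\<dots> \<le> (\<Sum>c\<in>?C. b)" by (intro sum_mono bound)
  also have "\<dots> \<le> 4 * b"
  proof -
    have "card ?C \<le> 4" by (rule order_trans[OF card_insert_le_m1] card_insert_le_m1 | simp)+
    then show ?thesis by (simp del: insert_iff add: mult_right_mono)
  qed
  finally show ?thesis unfolding b_def .
qed

text \<open>
  A bounded function with bounded derivative for which \<open>- t * f t\<close> still grows linearly.
\<close>

lemma root_test_function: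
  defines "f \<equiv> \<lambda>t::real. - (t / sqrt (1 + t\<^sup>2))" and "f' \<equiv> \<lambda>t::real. - (1 / (sqrt (1 + t\<^sup>2)) ^ 3)"
  shows "(f has_real_derivative f' t) (at t)" "continuous_on UNIV f'" "\<bar>f t\<bar> \<le> 1" "\<bar>f' t\<bar> \<le> 1"
    "- (t * f t) \<ge> sqrt (1 + t\<^sup>2) - 1"
proof -
  have pos: "1 + t\<^sup>2 > 0" for t :: real by (simp add: add_pos_nonneg)
  define r where "r = sqrt (1 + t\<^sup>2)"
  have r: "r \<ge> 1" "r * r = 1 + t * t" using pos[of t] by (auto simp: r_def power2_eq_square)
  have "((\<lambda>t. sqrt (1 + t\<^sup>2)) has_real_derivative (2 * t) * (inverse r / 2)) (at t)"
    using pos[of t] by (auto intro!: derivative_eq_intros simp: r_def)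
  from DERIV_divide[OF DERIV_ident this]
  have "((\<lambda>t. t / sqrt (1 + t\<^sup>2)) has_real_derivative (1 * r - t * ((2 * t) * (inverse r / 2))) / (r * r)) (at t)"
    using r(1) by (simp add: r_def[symmetric])
  moreover have "(1 * r - t * ((2 * t) * (inverse r / 2))) / (r * r) = 1 / r ^ 3"
  proof -
    have "1 * r - t * ((2 * t) * (inverse r / 2)) = (r * r - t * t) / r" using r(1) by (simp add: field_simps)
    then show ?thesis using r by (simp add: power3_eq_cube)
  qed
  ultimately show "(f has_real_derivative f' t) (at t)"
    unfolding f_def f'_def r_def by (intro DERIV_minus) simp
  show "continuous_on UNIV f'" unfolding f'_def using pos by (intro continuous_intros) (auto simp: less_imp_neq[symmetric])
  have "\<bar>t\<bar> \<le> r" unfolding r_def by (intro real_le_rsqrt) auto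
  then show "\<bar>f t\<bar> \<le> 1" using r(1) by (simp add: f_def r_def[symmetric])
  have "1 \<le> r ^ 3" using r(1) by (rule one_le_power)
  then show "\<bar>f' t\<bar> \<le> 1" using r(1) by (simp add: f'_def r_def[symmetric])
  have "- (t * f t) = r - 1 / r" using r by (simp add: f_def r_def[symmetric] field_simps)
  moreover have "1 / r \<le> 1" using r(1) by simp
  ultimately show "- (t * f t) \<ge> sqrt (1 + t\<^sup>2) - 1" by (simp add: r_def[symmetric])
qed

text \<open>
  Here \<open>\<epsilon> = 2 * t / n\<close>: for such a small shift the error terms are of lower order than \<open>n * \<beta>\<close>, and
  \<open>\<epsilon> * \<beta> / 2 * loop_defect\<close> dominates \<open>t * \<beta>\<close> times the linear statistic up to the constant
  \<open>2 * t * \<beta> * n\<close>.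
\<close>

lemma sqrt_exponential_moment:
  assumes N: "N \<le> n" "n > 0" and b: "\<beta> > 0" and t: "t \<ge> 0" "4 * t \<le> real n"
  shows "(\<integral>\<^sup>+ x. ennreal (exp (t * \<beta> * (\<Sum>i<N. sqrt (1 + (x i)\<^sup>2)))) \<partial>gbe N (real n * \<beta> / 2) \<beta>)
    \<le> ennreal (exp (2 * t * \<beta> * real n + 2 * t * (1 + \<beta> / 2) + 8 * t\<^sup>2 / real n + 12 * t\<^sup>2 * \<beta>))"
proof -
  let ?f = "\<lambda>t::real. - (t / sqrt (1 + t\<^sup>2))" and ?f' = "\<lambda>t::real. - (1 / (sqrt (1 + t\<^sup>2)) ^ 3)"
  note T = root_test_function
  let ?M = "gbe N (real n * \<beta> / 2) \<beta>"
  let ?Y = "loop_defect ?f ?f' n N"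
  define e where "e = 2 * t / real n"
  define C where "C = e * real N * 1 * (1 + \<beta> / 2) + 2 * real N * (e * 1)\<^sup>2 + e\<^sup>2 * (real n)\<^sup>2 * \<beta> * (1\<^sup>2 + 2 * 1\<^sup>2)"
  have n0: "real n > 0" using N by simp
  have e: "e \<ge> 0" "e * 1 \<le> 1 / 2" using t n0 by (auto simp: e_def field_simps)
  have Ym: "?Y \<in> borel_measurable ?M"
  proof -
    have "?Y \<in> borel_measurable (lebn N)" by (rule loop_defect_measurable) measurable
    then show ?thesis by (simp add: measurable_cong_sets[OF sets_gbe refl])
  qed
  have le: "t * \<beta> * (\<Sum>i<N. sqrt (1 + (x i)\<^sup>2)) \<le> e * \<beta> / 2 * ?Y x + 2 * t * \<beta> * real n" for x
  proof -
    have "(\<Sum>i<N. sqrt (1 + (x i)\<^sup>2) - 1) \<le> (\<Sum>i<N. - (x i * ?f (x i)))" by (intro sum_mono T(5))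
    then have 1: "(\<Sum>i<N. sqrt (1 + (x i)\<^sup>2)) \<le> real N - (\<Sum>i<N. x i * ?f (x i))"
      by (simp add: sum_subtractf sum_negf)
    have "(\<Sum>i<N. \<Sum>j<N. - 1) \<le> (\<Sum>i<N. \<Sum>j<N. divdiff ?f ?f' (x i) (x j))"
      using divdiff_bound[OF T(1) T(4)] by (intro sum_mono) (auto simp: abs_le_iff minus_le_iff)
    then have "?Y x \<ge> - (real N * real N) - real n * (\<Sum>i<N. x i * ?f (x i))"
      unfolding loop_defect_def by simp
    moreover have "real n * (\<Sum>i<N. sqrt (1 + (x i)\<^sup>2)) \<le> real n * (real N - (\<Sum>i<N. x i * ?f (x i)))"
      using 1 by (intro mult_left_mono) auto
    moreover have "real N * real N \<le> real n * real n" "real n * real N \<le> real n * real n"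
      using N by (auto intro!: mult_mono)
    ultimately have "real n * (\<Sum>i<N. sqrt (1 + (x i)\<^sup>2)) \<le> ?Y x + 2 * real n * real n"
      by (simp add: right_diff_distrib)
    then have "t * \<beta> / real n * (real n * (\<Sum>i<N. sqrt (1 + (x i)\<^sup>2))) \<le> t * \<beta> / real n * (?Y x + 2 * real n * real n)"
      using t b by (intro mult_left_mono) auto
    then show ?thesis using n0 by (simp add: e_def distrib_left)
  qed
  have "(\<integral>\<^sup>+ x. ennreal (exp (t * \<beta> * (\<Sum>i<N. sqrt (1 + (x i)\<^sup>2)))) \<partial>?M)
     \<le> (\<integral>\<^sup>+ x. ennreal (exp (2 * t * \<beta> * real n)) * ennreal (exp (e * \<beta> / 2 * ?Y x)) \<partial>?M)"
    using le by (intro nn_integral_mono) (simp add: exp_add[symmetric] add.commute flip: ennreal_mult'')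
  also have "\<dots> = ennreal (exp (2 * t * \<beta> * real n)) * (\<integral>\<^sup>+ x. ennreal (exp (e * \<beta> / 2 * ?Y x)) \<partial>?M)"
    by (intro nn_integral_cmult measurable_compose[OF _ measurable_ennreal] measurable_compose[OF _ borel_measurable_exp]
        borel_measurable_times Ym borel_measurable_const)
  also have "\<dots> \<le> ennreal (exp (2 * t * \<beta> * real n)) * ennreal (exp C)"
    unfolding C_def by (intro mult_left_mono loop_defect_exponential_bound[OF T(1) T(2) T(3) T(4) e b N]) auto
  also have "\<dots> = ennreal (exp (2 * t * \<beta> * real n + C))"
    by (simp add: exp_add flip: ennreal_mult'')
  also have "\<dots> \<le> ennreal (exp (2 * t * \<beta> * real n + 2 * t * (1 + \<beta> / 2) + 8 * t\<^sup>2 / real n + 12 * t\<^sup>2 * \<beta>))"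
  proof -
    have "e * real N \<le> e * real n" using N e by (intro mult_left_mono) auto
    moreover have "e * real n = 2 * t" using n0 by (simp add: e_def)
    ultimately have eN: "e * real N \<le> 2 * t" by simp
    have 1: "e * real N * 1 * (1 + \<beta> / 2) \<le> 2 * t * (1 + \<beta> / 2)"
      using eN b by (intro mult_right_mono) auto
    have "2 * real N * (e * 1)\<^sup>2 = 2 * (e * real N) * e" by (simp add: power2_eq_square)
    also have "\<dots> \<le> 2 * (2 * t) * e" using eN e by (intro mult_right_mono) auto
    also have "\<dots> = 8 * t\<^sup>2 / real n" by (simp add: e_def power2_eq_square)
    finally have 2: "2 * real N * (e * 1)\<^sup>2 \<le> 8 * t\<^sup>2 / real n" .
    have "e\<^sup>2 * (real n)\<^sup>2 * \<beta> * (1\<^sup>2 + 2 * 1\<^sup>2) = (e * real n)\<^sup>2 * 3 * \<beta>" by (simp add: power_mult_distrib)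
    also have "\<dots> = 12 * t\<^sup>2 * \<beta>" using n0 by (simp add: e_def power_mult_distrib)
    finally have 3: "e\<^sup>2 * (real n)\<^sup>2 * \<beta> * (1\<^sup>2 + 2 * 1\<^sup>2) = 12 * t\<^sup>2 * \<beta>" .
    show ?thesis unfolding C_def
      by (intro ennreal_leI, simp only: exp_le_cancel_iff) (use 1 2 3 in linarith)
  qed
  finally show ?thesis .
qed

section \<open>Superexponential concentration\<close>

text \<open>
  Lipschitz bounds are what lets finitely many points \<open>z\<close> control a whole rectangle in \<open>log_mean_superexponential\<close>.
\<close>

lemma resolvent_mean_lipschitz:
  assumes h: "h > 0" and z: "h \<le> Im z" "h \<le> Im z'"
  shows "cmod (resolvent_mean N x z - resolvent_mean N x z') \<le> cmod (z - z') / h\<^sup>2"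
proof (cases "N = 0")
  case False
  have ge: "h \<le> cmod (w - complex_of_real t)" if "h \<le> Im w" for w t
    using abs_Im_le_cmod[of "w - complex_of_real t"] that h by simp
  have nz: "w - complex_of_real t \<noteq> 0" if "h \<le> Im w" for w t
    using that h by (auto simp: complex_eq_iff)
  have "cmod (\<Sum>i<N. 1 / (z - complex_of_real (x i)) - 1 / (z' - complex_of_real (x i)))
      \<le> (\<Sum>i<N. cmod (z - z') / h\<^sup>2)"
  proof (intro sum_norm_le)
    fix i
    let ?u = "z - complex_of_real (x i)" and ?v = "z' - complex_of_real (x i)"
    have "1 / ?u - 1 / ?v = (z' - z) / (?u * ?v)"
      using nz[OF z(1), of "x i"] nz[OF z(2), of "x i"] by (simp add: field_simps)
    then have "cmod (1 / ?u - 1 / ?v) = cmod (z - z') / (cmod ?u * cmod ?v)"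
      by (simp add: norm_divide norm_mult norm_minus_commute)
    also have "\<dots> \<le> cmod (z - z') / (h * h)"
      using ge[OF z(1), of "x i"] ge[OF z(2), of "x i"] h by (intro divide_left_mono mult_mono mult_pos_pos) auto
    finally show "cmod (1 / ?u - 1 / ?v) \<le> cmod (z - z') / h\<^sup>2" by (simp add: power2_eq_square)
  qed
  then show ?thesis
    using False by (simp add: resolvent_mean_def norm_divide sum_subtractf field_simps flip: diff_divide_distrib)
qed (simp add: resolvent_mean_def)

lemma resolvent_defect_lipschitz:
  assumes h: "h > 0" and z: "h \<le> Im z" "h \<le> Im z'" and Q: "cmod z \<le> Q"
  shows "cmod (resolvent_defect N x z - resolvent_defect N x z')
     \<le> cmod (z - z') * (2 / h ^ 3 + Q / h\<^sup>2 + 1 / h)"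
proof -
  let ?s = "resolvent_mean N x z" and ?t = "resolvent_mean N x z'"
  let ?d = "cmod (z - z')"
  have lip: "cmod (?s - ?t) \<le> ?d / h\<^sup>2" by (rule resolvent_mean_lipschitz[OF h z])
  have s: "cmod ?s \<le> 1 / h"
    using resolvent_mean_bound[of z N x] z h by (auto intro: order_trans[OF _ frac_le])
  have t: "cmod ?t \<le> 1 / h"
    using resolvent_mean_bound[of z' N x] z h by (auto intro: order_trans[OF _ frac_le])
  have "resolvent_defect N x z - resolvent_defect N x z'
      = (?s - ?t) * (?s + ?t) - (z * (?s - ?t) + (z - z') * ?t)"
    by (simp add: resolvent_defect_def power2_eq_square algebra_simps)
  then have "cmod (resolvent_defect N x z - resolvent_defect N x z')
      \<le> cmod (?s - ?t) * cmod (?s + ?t) + (cmod z * cmod (?s - ?t) + ?d * cmod ?t)"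
    by (simp add: norm_mult[symmetric]) (meson add_mono_thms_linordered_semiring(1) norm_triangle_ineq norm_triangle_ineq4 order_refl order_trans)
  also have "\<dots> \<le> ?d / h\<^sup>2 * (2 / h) + (Q * (?d / h\<^sup>2) + ?d * (1 / h))"
  proof (intro add_mono mult_mono lip Q t order_refl)
    show "cmod (?s + ?t) \<le> 2 / h" using norm_triangle_ineq[of ?s ?t] s t by simp
    show "0 \<le> Q" using Q norm_ge_zero order_trans by blast
  qed (use h in auto)
  also have "\<dots> = ?d * (2 / h ^ 3 + Q / h\<^sup>2 + 1 / h)"
    using h by (simp add: field_simps eval_nat_numeral)
  finally show ?thesis .
qed

locale beta_regime =
  fixes \<beta> :: "nat \<Rightarrow> real"
  assumes beta_pos: "n \<ge> 1 \<Longrightarrow> \<beta> n > 0"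
    and ln_negligible: "(\<lambda>n. ln (real n) / (real n * \<beta> n)) \<longlonglongrightarrow> 0"
begin

definition speed :: "nat \<Rightarrow> real"
  where "speed n = real n * \<beta> n"

abbreviation ens :: "nat \<Rightarrow> nat \<Rightarrow> (nat \<Rightarrow> real) measure"
  where "ens n N \<equiv> gbe N (real n * \<beta> n / 2) (\<beta> n)"

lemma speed_at_top: "filterlim speed at_top sequentially"
proof (rule filterlim_at_top_mono)
  show "filterlim (\<lambda>n. ln (real n)) at_top sequentially"
    by (rule filterlim_compose[OF ln_at_top filterlim_real_sequentially])
  have "\<forall>\<^sub>F n in sequentially. ln (real n) / speed n < 1"
    using order_tendstoD(2)[OF ln_negligible zero_less_one] by (simp add: speed_def)
  then show "\<forall>\<^sub>F n in sequentially. ln (real n) \<le> speed n"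
    using eventually_ge_at_top[of 1]
  proof eventually_elim
    case (elim n)
    then have "speed n > 0" using beta_pos[of n] by (simp add: speed_def)
    with elim show ?case by (simp add: divide_less_eq)
  qed
qed

lemma speed_ge: "\<forall>\<^sub>F n in sequentially. speed n \<ge> c"
  using speed_at_top by (simp add: filterlim_at_top)

lemma real_ge: "\<forall>\<^sub>F n in sequentially. real n \<ge> c"
  using filterlim_real_sequentially by (simp add: filterlim_at_top)

text \<open>
  With \<open>\<epsilon>\<close> fixed and small compared to \<open>\<delta>\<close>, the exponent in \<open>resolvent_defect_tail\<close> is at most
  \<open>O(n + a) - c3 * n * a\<close>, which beats every multiple of \<open>a\<close> because \<open>n\<close> and \<open>a\<close> both tend to infinity.
\<close>

lemma resolvent_defect_superexponential:
  assumes z: "Im z > 0" and d: "\<delta> > 0"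
  shows "\<forall>\<^sub>F n in sequentially. \<forall>N. N \<le> n \<and> n \<le> N + 1 \<longrightarrow>
    emeasure (ens n N) {x \<in> space (lebn N). cmod (resolvent_defect N x z) > \<delta>} \<le> ennreal (exp (- (M * speed n)))"
proof -
  define K where "K = 1 / (Im z)\<^sup>2"
  define c0 where "c0 = (1 / Im z)\<^sup>2 + 2 * K\<^sup>2"
  \<comment> \<open>The first entry makes the substitution increasing, the second one makes the quadratic error
    \<open>e\<^sup>2 * n\<^sup>2 * \<beta> * c0\<close> at most a quarter of the gain \<open>e * n\<^sup>2 * \<beta> * \<delta> / 32\<close>.\<close>
  define e where "e = min (1 / (2 * K)) (\<delta> / (128 * c0))"
  have K: "K > 0" using z by (simp add: K_def)
  have c0: "c0 > 0" using z K by (simp add: c0_def add_pos_nonneg)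
  have e: "e > 0" using K c0 d by (simp add: e_def)
  have "e * K \<le> 1 / (2 * K) * K" using K by (intro mult_right_mono) (auto simp: e_def)
  then have eK: "e * K \<le> 1 / 2" using K by simp
  have "e * c0 \<le> \<delta> / (128 * c0) * c0" using c0 by (intro mult_right_mono) (auto simp: e_def)
  then have ec: "e * c0 \<le> \<delta> / 128" using c0 by simp
  define C1 where "C1 = e * K + 2 * (e * K)\<^sup>2"
  define c3 where "c3 = 3 * e * \<delta> / 128"
  have c3: "c3 > 0" using e d by (simp add: c3_def)
  show ?thesis
    using real_ge[of 2] real_ge[of "2 * (2 * (1 + cmod z / Im z)) / \<delta>"]
      real_ge[of "3 * (e * K / 2 + M) / c3"] speed_ge[of 1] speed_ge[of "3 * C1 / c3"] speed_ge[of "3 * ln 4 / c3"]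
  proof eventually_elim
    case (elim n)
    define a where "a = speed n"
    show ?case
    proof (intro allI impI)
      fix N assume N: "N \<le> n \<and> n \<le> N + 1"
      have n: "n \<ge> 1" "real n \<ge> 1" using elim by auto
      have b: "\<beta> n > 0" using beta_pos n by simp
      have a: "a = real n * \<beta> n" "a > 0" using b n by (simp_all add: a_def speed_def)
      have N2: "real n / 2 \<le> real N" "N > 0" using N elim by auto
      have "real n * \<delta> \<ge> 2 * (2 * (1 + cmod z / Im z))" using elim d by (simp add: pos_divide_le_eq)
      moreover have "real n / 2 * \<delta> \<le> real N * \<delta>" using N2 d by (intro mult_right_mono) auto
      ultimately have big: "real N * \<delta> \<ge> 2 * (1 + cmod z / Im z)" by simp
      let ?E = "e * real N * (1 / (Im z)\<^sup>2) * (1 + \<beta> n / 2) + 2 * real N * (e * (1 / (Im z)\<^sup>2))\<^sup>2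
        + e\<^sup>2 * (real n)\<^sup>2 * \<beta> n * ((1 / Im z)\<^sup>2 + 2 * (1 / (Im z)\<^sup>2)\<^sup>2)
        - e * \<beta> n / 2 * ((real N)\<^sup>2 * \<delta> / 4)"
      have "?E \<le> - (M * a) - ln 4"
      proof -
        have 1: "e * real N * K * (1 + \<beta> n / 2) \<le> e * real n * K * (1 + \<beta> n / 2)"
          using e K b N by (intro mult_right_mono mult_left_mono) auto
        have 2: "2 * real N * (e * K)\<^sup>2 \<le> 2 * real n * (e * K)\<^sup>2"
          using N by (intro mult_right_mono) auto
        have 3: "e\<^sup>2 * (real n)\<^sup>2 * \<beta> n * c0 \<le> e * real n * a * (\<delta> / 128)"
        proof -
          have "e\<^sup>2 * (real n)\<^sup>2 * \<beta> n * c0 = e * real n * a * (e * c0)"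
            by (simp add: a power2_eq_square)
          also have "\<dots> \<le> e * real n * a * (\<delta> / 128)" using e a ec by (intro mult_left_mono) auto
          finally show ?thesis .
        qed
        have 4: "e * real n * a * (\<delta> / 32) \<le> e * \<beta> n / 2 * ((real N)\<^sup>2 * \<delta> / 4)"
        proof -
          have "(real n / 2)\<^sup>2 \<le> (real N)\<^sup>2" using N2 by (intro power_mono) auto
          then have "e * \<beta> n * \<delta> / 8 * (real n / 2)\<^sup>2 \<le> e * \<beta> n * \<delta> / 8 * (real N)\<^sup>2"
            using e b d by (intro mult_left_mono) auto
          then show ?thesis by (simp add: a power2_eq_square mult_ac)
        qed
        have "?E \<le> e * real n * K * (1 + \<beta> n / 2) + 2 * real n * (e * K)\<^sup>2 + e * real n * a * (\<delta> / 128)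
            - e * real n * a * (\<delta> / 32)"
          using 1 2 3 4 unfolding K_def[symmetric] c0_def[symmetric] by linarith
        also have "\<dots> = C1 * real n + e * K / 2 * a - c3 * (real n * a)"
          by (simp add: C1_def c3_def a algebra_simps)
        also have "\<dots> \<le> - (M * a) - ln 4"
        proof -
          have "C1 \<le> c3 / 3 * a" using elim c3 by (simp add: a_def pos_divide_le_eq mult_ac)
          then have i: "C1 * real n \<le> c3 / 3 * a * real n" by (rule mult_right_mono) simp
          have "e * K / 2 + M \<le> c3 / 3 * real n" using elim c3 by (simp add: pos_divide_le_eq mult_ac)
          then have ii: "(e * K / 2 + M) * a \<le> c3 / 3 * real n * a" by (rule mult_right_mono) (use a in simp)
          have "ln 4 \<le> c3 / 3 * a" using elim c3 by (simp add: a_def pos_divide_le_eq mult_ac)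
          also have "\<dots> \<le> c3 / 3 * a * real n"
            using mult_left_mono[of 1 "real n" "c3 / 3 * a"] c3 a(2) n(2) by simp
          finally have iii: "ln 4 \<le> c3 / 3 * a * real n" .
          show ?thesis using i ii iii by (simp add: algebra_simps)
        qed
        finally show ?thesis .
      qed
      then have "exp ?E \<le> exp (- (M * a) - ln 4)" by simp
      also have "\<dots> = exp (- (M * a)) / 4" by (simp add: exp_diff)
      finally have E: "4 * exp ?E \<le> exp (- (M * a))" by simp
      have "emeasure (ens n N) {x \<in> space (lebn N). cmod (resolvent_defect N x z) > \<delta>} \<le> 4 * ennreal (exp ?E)"
        using N eK e unfolding K_def by (intro resolvent_defect_tail[OF z N2(2) _ _ b big]) auto
      also have "\<dots> = ennreal (4 * exp ?E)" by (simp add: ennreal_mult)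
      also have "\<dots> \<le> ennreal (exp (- (M * a)))" using E by (rule ennreal_leI)
      finally show "emeasure (ens n N) {x \<in> space (lebn N). cmod (resolvent_defect N x z) > \<delta>}
         \<le> ennreal (exp (- (M * speed n)))" by (simp only: a_def)
    qed
  qed
qed

lemma sqrt_moment_bound:
  assumes t: "t \<ge> 0"
  shows "\<forall>\<^sub>F n in sequentially. \<forall>N \<le> n.
    (\<integral>\<^sup>+ x. ennreal (exp (t * \<beta> n * (\<Sum>i<N. sqrt (1 + (x i)\<^sup>2)))) \<partial>ens n N) \<le> ennreal (exp (3 * t * speed n))"
  using real_ge[of 1] real_ge[of "4 * t"] real_ge[of "2 * (1 + 12 * t)"] speed_ge[of "4 + 16 * t"]
proof eventually_elim
  case (elim n)
  show ?case
  proof (intro allI impI)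
    fix N assume N: "N \<le> n"
    have n: "n > 0" "real n \<ge> 1" using elim by auto
    have b: "\<beta> n > 0" using beta_pos n by simp
    have "\<beta> n * (2 * (1 + 12 * t)) \<le> \<beta> n * real n" using b elim by (intro mult_left_mono) auto
    then have 1: "\<beta> n + 12 * t * \<beta> n \<le> speed n / 2" by (simp add: speed_def algebra_simps)
    have "8 * t / real n \<le> 8 * t" using t n mult_left_mono[of 1 "real n" t] by (simp add: divide_le_eq)
    then have 2: "2 + 8 * t / real n \<le> speed n / 2" using elim t by simp
    have "2 + \<beta> n + 8 * t / real n + 12 * t * \<beta> n \<le> speed n" using 1 2 by linarith
    then have "t * (2 + \<beta> n + 8 * t / real n + 12 * t * \<beta> n) \<le> t * speed n"
      using t by (rule mult_left_mono)
    then have le: "2 * t * \<beta> n * real n + 2 * t * (1 + \<beta> n / 2) + 8 * t\<^sup>2 / real n + 12 * t\<^sup>2 * \<beta> n \<le> 3 * t * speed n"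
      by (simp add: speed_def power2_eq_square algebra_simps)
    show "(\<integral>\<^sup>+ x. ennreal (exp (t * \<beta> n * (\<Sum>i<N. sqrt (1 + (x i)\<^sup>2)))) \<partial>ens n N) \<le> ennreal (exp (3 * t * speed n))"
      using elim by (intro order_trans[OF sqrt_exponential_moment[OF N n(1) b t]] ennreal_leI) (use le in auto)
  qed
qed

lemma sqrt_sum_superexponential:
  "\<forall>\<^sub>F n in sequentially. \<forall>N \<le> n.
    emeasure (ens n N) {x \<in> space (lebn N). (\<Sum>i<N. sqrt (1 + (x i)\<^sup>2)) \<ge> 5 * real n} \<le> ennreal (exp (- (M * speed n)))"
proof -
  define t where "t = \<bar>M\<bar> / 2"
  have t: "t \<ge> 0" "M \<le> 2 * t" by (auto simp: t_def)
  show ?thesis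
    using sqrt_moment_bound[OF t(1)] real_ge[of 1]
  proof eventually_elim
    case (elim n)
    have b: "\<beta> n > 0" using beta_pos[of n] elim by simp
    show ?case
    proof (intro allI impI)
      fix N assume N: "N \<le> n"
      have meas: "(\<lambda>x. \<Sum>i<N. sqrt (1 + (x i)\<^sup>2)) \<in> borel_measurable (ens n N)"
        using sum_sqrt_measurable by (simp add: measurable_cong_sets[OF sets_gbe refl])
      have "emeasure (ens n N) {x \<in> space (ens n N). (\<Sum>i<N. sqrt (1 + (x i)\<^sup>2)) \<ge> 5 * real n}
         \<le> ennreal (exp (3 * t * speed n - t * \<beta> n * (5 * real n)))"
        using elim N t b by (intro exp_Markov[OF meas]) auto
      also have "\<dots> \<le> ennreal (exp (- (M * speed n)))"
      proof (intro ennreal_leI, simp)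
        have "M * speed n \<le> 2 * t * speed n" using t b by (intro mult_right_mono) (auto simp: speed_def)
        then show "3 * t * speed n - t * \<beta> n * (5 * real n) \<le> - (M * speed n)"
          by (simp add: speed_def algebra_simps)
      qed
      finally show "emeasure (ens n N) {x \<in> space (lebn N). (\<Sum>i<N. sqrt (1 + (x i)\<^sup>2)) \<ge> 5 * real n}
         \<le> ennreal (exp (- (M * speed n)))" by (simp add: space_gbe)
    qed
  qed
qed

text \<open>
  First \<open>R\<close> is chosen large, then the defect \<open>d\<close> small, then a finite net of the rectangle with real parts in \<open>[-B, B]\<close>
  and imaginary parts in \<open>[h, R]\<close>. The union bound over the net costs a constant factor only.
\<close>

lemma log_mean_superexponential:
  assumes B: "B \<ge> 0" and h: "h > 0" and e: "e > 0"
  shows "\<forall>\<^sub>F n in sequentially. \<forall>N. N \<le> n \<and> n \<le> N + 1 \<longrightarrow>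
    (\<exists>G \<in> sets (lebn N). emeasure (ens n N) (space (lebn N) - G) \<le> ennreal (exp (- (M * speed n))) \<and>
      (\<forall>x\<in>G. \<forall>t. \<bar>t\<bar> \<le> B \<longrightarrow> \<bar>log_mean N x (Complex t h) - plane_potential (Complex t h)\<bar> \<le> e))"
proof -
  define R where "R = max (max 2 h) (2 * (2 * B + 13) / e)"
  have R: "R \<ge> 2" "h \<le> R" "(2 * B + 13) / R \<le> e / 2"
  proof -
    show "R \<ge> 2" "h \<le> R" by (auto simp: R_def)
    have "2 * (2 * B + 13) / e \<le> R" by (simp add: R_def)
    then show "(2 * B + 13) / R \<le> e / 2" using e \<open>R \<ge> 2\<close> by (simp add: field_simps)
  qed
  define d where "d = e * h / (4 * R)"
  have d: "d > 0" "R * (2 * d) / h = e / 2" using e h R by (auto simp: d_def)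
  define S where "S = cbox (Complex (-B) h) (Complex B R)"
  have S: "z \<in> S \<longleftrightarrow> \<bar>Re z\<bar> \<le> B \<and> h \<le> Im z \<and> Im z \<le> R" for z
    by (auto simp: S_def in_cbox_complex_iff abs_le_iff)
  define Q where "Q = B + R"
  have Q: "cmod z \<le> Q" if "z \<in> S" for z
    using cmod_le[of z] that h by (simp add: S Q_def)
  define Lip where "Lip = 2 / h ^ 3 + Q / h\<^sup>2 + 1 / h"
  have Lip: "Lip > 0" using h B R by (simp add: Lip_def Q_def add_pos_nonneg)
  have "compact S" unfolding S_def by (rule compact_cbox)
  then obtain k where k: "finite k" "k \<subseteq> S" "S \<subseteq> (\<Union>z\<in>k. ball z (d / Lip))"
    using seq_compact_imp_totally_bounded[OF compact_imp_seq_compact] d Lip by (metis divide_pos_pos)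
  have ev: "\<forall>\<^sub>F n in sequentially. \<forall>z\<in>k. \<forall>N. N \<le> n \<and> n \<le> N + 1 \<longrightarrow>
    emeasure (ens n N) {x \<in> space (lebn N). cmod (resolvent_defect N x z) > d} \<le> ennreal (exp (- ((M + 1) * speed n)))"
    using k h d by (intro eventually_ball_finite[OF k(1)] ballI resolvent_defect_superexponential) (auto simp: S subset_eq)
  show ?thesis
    using ev sqrt_sum_superexponential[of "M + 1"] speed_ge[of "ln (real (card k) + 1)"] real_ge[of 2]
  proof eventually_elim
    case (elim n)
    show ?case
    proof (intro allI impI)
      fix N assume N: "N \<le> n \<and> n \<le> N + 1"
      have N2: "real n \<le> 2 * real N" "N > 0" using N elim by auto
      let ?S = "\<lambda>x. \<Sum>i<N. sqrt (1 + (x i)\<^sup>2)"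
      let ?E = "\<lambda>z. {x \<in> space (lebn N). cmod (resolvent_defect N x z) > d}"
      let ?F = "{x \<in> space (lebn N). ?S x \<ge> 5 * real n}"
      define b where "b = ennreal (exp (- ((M + 1) * speed n)))"
      have Em: "?E z \<in> sets (lebn N)" for z
      proof -
        note [measurable] = resolvent_defect_measurable
        show ?thesis by measurable
      qed
      have Fm: "?F \<in> sets (lebn N)"
      proof -
        note [measurable] = sum_sqrt_measurable
        show ?thesis by measurable
      qed
      define G where "G = space (lebn N) - (?F \<union> (\<Union>z\<in>k. ?E z))"
      have bad: "?F \<union> (\<Union>z\<in>k. ?E z) \<in> sets (lebn N)" using Em Fm k(1) by blast
      have "emeasure (ens n N) (space (lebn N) - G) = emeasure (ens n N) (?F \<union> (\<Union>z\<in>k. ?E z))"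
        by (intro arg_cong[where f = "emeasure (ens n N)"]) (auto simp: G_def)
      also have "\<dots> \<le> emeasure (ens n N) ?F + emeasure (ens n N) (\<Union>z\<in>k. ?E z)"
        using Em Fm k(1) by (intro emeasure_subadditive) (auto simp: sets_gbe)
      also have "\<dots> \<le> b + (\<Sum>z\<in>k. b)"
      proof (intro add_mono)
        show "emeasure (ens n N) ?F \<le> b" using elim N by (simp add: b_def)
        have "emeasure (ens n N) (\<Union>z\<in>k. ?E z) \<le> (\<Sum>z\<in>k. emeasure (ens n N) (?E z))"
          using Em k(1) by (intro emeasure_subadditive_finite) (auto simp: sets_gbe)
        also have "\<dots> \<le> (\<Sum>z\<in>k. b)" using elim N by (intro sum_mono) (simp add: b_def)
        finally show "emeasure (ens n N) (\<Union>z\<in>k. ?E z) \<le> (\<Sum>z\<in>k. b)" .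
      qed
      also have "\<dots> = ennreal ((real (card k) + 1) * exp (- ((M + 1) * speed n)))"
        by (simp add: b_def ennreal_mult distrib_right ennreal_of_nat_eq_real_of_nat add.commute)
      also have "\<dots> \<le> ennreal (exp (- (M * speed n)))"
      proof (rule ennreal_leI)
        have "real (card k) + 1 = exp (ln (real (card k) + 1))" by simp
        also have "\<dots> \<le> exp (speed n)" using elim by (subst exp_le_cancel_iff)
        finally have "(real (card k) + 1) * exp (- ((M + 1) * speed n)) \<le> exp (speed n) * exp (- ((M + 1) * speed n))"
          by (rule mult_right_mono) simp
        then show "(real (card k) + 1) * exp (- ((M + 1) * speed n)) \<le> exp (- (M * speed n))"
          by (simp add: exp_add[symmetric] algebra_simps)
      qed
      finally have P: "emeasure (ens n N) (space (lebn N) - G) \<le> ennreal (exp (- (M * speed n)))" .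
      have "\<bar>log_mean N x (Complex t h) - plane_potential (Complex t h)\<bar> \<le> e" if x: "x \<in> G" and t: "\<bar>t\<bar> \<le> B" for x t
      proof -
        have def_le: "cmod (resolvent_defect N x (Complex t s)) \<le> 2 * d" if s: "h \<le> s" "s \<le> R" for s
        proof -
          let ?z = "Complex t s"
          have zS: "?z \<in> S" using s t by (simp add: S)
          then obtain w where w: "w \<in> k" "dist w ?z < d / Lip" using k(3) by auto
          have wS: "w \<in> S" using w k(2) by auto
          have "cmod (?z - w) \<le> d / Lip" using w(2) by (simp add: dist_norm norm_minus_commute)
          then have "cmod (?z - w) * Lip \<le> d" using Lip by (simp add: pos_le_divide_eq)
          then have "cmod (resolvent_defect N x ?z - resolvent_defect N x w) \<le> d"
            using resolvent_defect_lipschitz[OF h _ _ Q[OF zS], of w N x] wS zS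
            by (auto simp: S Lip_def intro: order_trans)
          moreover have "cmod (resolvent_defect N x w) \<le> d" using x w by (auto simp: G_def)
          ultimately show ?thesis
            using norm_triangle_sub[of "resolvent_defect N x ?z" "resolvent_defect N x w"] by simp
        qed
        have "?S x \<le> 10 * real N" using x N2 by (auto simp: G_def)
        from log_mean_close[OF N2(2) h R(2,1) t def_le this]
        have "\<bar>log_mean N x (Complex t h) - plane_potential (Complex t h)\<bar> \<le> R * (2 * d) / h + (2 * B + 10 + 3) / R"
          .
        moreover have "2 * B + 10 + 3 = 2 * B + (13::real)" by simp
        ultimately show ?thesis using R(3) by (simp only: d(2))
      qed
      then show "\<exists>G \<in> sets (lebn N). emeasure (ens n N) (space (lebn N) - G) \<le> ennreal (exp (- (M * speed n))) \<and>
        (\<forall>x\<in>G. \<forall>t. \<bar>t\<bar> \<le> B \<longrightarrow> \<bar>log_mean N x (Complex t h) - plane_potential (Complex t h)\<bar> \<le> e)"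
        using P bad by (intro bexI[of _ G]) (auto simp: G_def)
    qed
  qed
qed

end

section \<open>Asymptotics of the insertion mass\<close>

lemma plane_potential_ge:
  assumes "t > 0" shows "plane_potential (Complex x t) \<ge> - 1 / 2"
proof -
  define w where "w = outer_root (Complex x t)"
  have w: "cmod w > 1" using outer_root_bounds(1)[of "Complex x t"] assms by (simp add: w_def)
  have "\<bar>Re (1 / w\<^sup>2)\<bar> \<le> cmod (1 / w\<^sup>2)" by (rule abs_Re_le_cmod)
  also have "\<dots> \<le> 1"
  proof -
    have "1 \<le> (cmod w)\<^sup>2" using w by (intro one_le_power) simp
    then show ?thesis by (simp add: norm_divide norm_power divide_le_eq)
  qed
  finally have "Re (1 / w\<^sup>2) \<ge> - 1" by (simp add: abs_le_iff)
  moreover have "ln (cmod w) \<ge> 0" using w by simp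
  ultimately show ?thesis by (simp add: plane_potential_def w_def)
qed

text \<open>
  The confinement \<open>t\<^sup>2 / 4\<close> of a particle beats the repulsion \<open>ln (sqrt (1 + t\<^sup>2))\<close> with half of its strength left over.
\<close>

lemma ln_one_plus_square_le: "ln (sqrt (1 + t\<^sup>2)) \<le> t\<^sup>2 / 8 + 1" for t :: real
proof -
  have p: "1 + t\<^sup>2 > 0" by (simp add: add_pos_nonneg)
  have "ln (1 + t\<^sup>2) = ln ((1 + t\<^sup>2) / 4) + ln 4" using p by (simp add: ln_div)
  also have "ln ((1 + t\<^sup>2) / 4) \<le> (1 + t\<^sup>2) / 4 - 1" using p by (intro ln_le_minus_one) simp
  also have "ln (4::real) = ln (2 ^ 2)" by simp
  also have "\<dots> = 2 * ln 2" by (simp only: ln_realpow zero_less_numeral)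
  also have "ln (2::real) \<le> 1" using ln_le_minus_one[of "2::real"] by simp
  finally have "ln (1 + t\<^sup>2) \<le> t\<^sup>2 / 4 + 2" by (simp add: add_divide_distrib)
  then show ?thesis using p by (simp add: ln_sqrt)
qed

lemma insertion_kernel_le_smoothed:
  assumes b: "\<beta> > 0" and h: "h > 0" and N: "N > 0"
  shows "insertion_kernel \<alpha> \<beta> N x t \<le> exp (- (\<alpha> / 2) * t\<^sup>2 + \<beta> * real N * log_mean N x (Complex t h))"
proof -
  have nz: "Complex t h - complex_of_real y \<noteq> 0" for y using h by (auto simp: complex_eq_iff)
  have le: "\<bar>y - t\<bar> \<le> cmod (Complex t h - complex_of_real y)" for y
    using abs_Re_le_cmod[of "Complex t h - complex_of_real y"] by simp
  have "(\<Prod>i<N. \<bar>x i - t\<bar> powr \<beta>) \<le> (\<Prod>i<N. exp (\<beta> * ln (cmod (Complex t h - complex_of_real (x i)))))"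
  proof (intro prod_mono conjI)
    fix i
    have "\<bar>x i - t\<bar> powr \<beta> \<le> cmod (Complex t h - complex_of_real (x i)) powr \<beta>"
      using b le by (intro powr_mono2) auto
    then show "\<bar>x i - t\<bar> powr \<beta> \<le> exp (\<beta> * ln (cmod (Complex t h - complex_of_real (x i))))"
      using nz by (simp add: powr_def)
  qed auto
  also have "\<dots> = exp (\<beta> * real N * log_mean N x (Complex t h))"
    using N by (simp add: log_mean_def exp_sum[symmetric] sum_distrib_left[symmetric])
  finally show ?thesis
    unfolding insertion_kernel_def exp_add by (intro mult_left_mono) auto
qed

definition gaussian_mass :: real
  where "gaussian_mass = enn2real (\<integral>\<^sup>+ t. ennreal (exp (- (1 / 2) * t\<^sup>2)) \<partial>lborel)"

lemma gaussian_mass: "(\<integral>\<^sup>+ t. ennreal (exp (- (1 / 2) * t\<^sup>2)) \<partial>lborel) = ennreal gaussian_mass"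
  using gaussian_integral_finite[of "1 / 2"] by (simp add: gaussian_mass_def)

lemma gaussian_mass_nonneg: "gaussian_mass \<ge> 0"
  by (simp add: gaussian_mass_def)

context beta_regime
begin

text \<open>
  The inner integral is split into three parts. On the good event and for \<open>\<bar>t\<bar> \<le> B\<close> the smoothed potential is close to
  its limit. On the bad event and for \<open>\<bar>t\<bar> > B\<close> the crude bound \<open>insertion_kernel_le\<close> suffices: its exponential moments
  are at most \<open>exp (O a)\<close>, while the bad event has probability \<open>exp (- M a)\<close> with \<open>M\<close> as large as needed, and the Gaussian factor is
  as small as needed once \<open>B\<close> is large.
\<close>

lemma insertion_mass_upper:
  assumes [measurable]: "A \<in> sets borel"
    and V: "\<And>\<kappa>. \<kappa> > 0 \<Longrightarrow> \<exists>h>0. \<forall>t\<in>A. plane_potential (Complex t h) - t\<^sup>2 / 4 \<le> V + \<kappa>"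
    and k: "\<kappa> > 0"
  shows "\<forall>\<^sub>F n in sequentially. insertion_mass (n - 1) (real n * \<beta> n / 2) (\<beta> n) A \<le> ennreal (exp (speed n * (V + \<kappa>)))"
proof -
  define e where "e = \<kappa> / 4"
  have e: "e > 0" using k by (simp add: e_def)
  obtain h where h: "h > 0" "\<And>t. t \<in> A \<Longrightarrow> plane_potential (Complex t h) - t\<^sup>2 / 4 \<le> V + e"
    using V[OF e] by blast
  define B where "B = 4 * (4 + \<bar>V\<bar>)"
  have B: "B \<ge> 0" "B\<^sup>2 / 16 \<ge> 4 - V"
  proof -
    show "B \<ge> 0" by (simp add: B_def)
    have "4 + \<bar>V\<bar> \<le> (4 + \<bar>V\<bar>)\<^sup>2" by (rule self_le_power) auto
    moreover have "B\<^sup>2 = 16 * (4 + \<bar>V\<bar>)\<^sup>2" by (simp only: B_def power_mult_distrib) simp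
    ultimately show "B\<^sup>2 / 16 \<ge> 4 - V" by linarith
  qed
  \<comment> \<open>\<open>exp (K * a)\<close> is the level at which the linear statistic is cut off on the bad event; \<open>K\<close> and \<open>M\<close> make both halves of the
    resulting bound equal to \<open>exp (a * (V - 1))\<close>.\<close>
  define K where "K = 7 - V"
  define M where "M = K + 1 - V"
  define C0 where "C0 = 2 * B + 3 * gaussian_mass"
  have C0: "C0 \<ge> 0" using B gaussian_mass_nonneg by (simp add: C0_def)
  note moments = sqrt_moment_bound[of 1] sqrt_moment_bound[of 2]
  show ?thesis
    using log_mean_superexponential[OF B(1) h(1) e, of M] moments[simplified]
      real_ge[of 2] real_ge[of "1 / e"] speed_ge[of 8] speed_ge[of "ln (C0 + 1) / e"]
  proof eventually_elim
    case (elim n)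
    define a where "a = speed n"
    define N where "N = n - 1"
    have n: "n \<ge> 2" using elim by simp
    have N: "N \<le> n" "n \<le> N + 1" "N > 0" "real N = real n - 1" using n by (auto simp: N_def)
    have b: "\<beta> n > 0" using beta_pos[of n] n by simp
    have a: "a = real n * \<beta> n" "a > 0" "a \<ge> 8" using b n elim by (simp_all add: a_def speed_def)
    let ?\<alpha> = "real n * \<beta> n / 2"
    let ?M = "ens n N"
    let ?S = "\<lambda>x. \<Sum>i<N. sqrt (1 + (x i)\<^sup>2)"
    let ?g = "\<lambda>t. exp (- (1 / 2) * t\<^sup>2) :: real"
    interpret prob_space ?M using b a by (intro prob_space_gbe) auto
    from mp[OF spec[OF elim(1), of N] conjI[OF N(1,2)]]
    obtain G where G01: "G \<in> sets (lebn N)" "emeasure ?M (space (lebn N) - G) \<le> ennreal (exp (- (M * speed n)))"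
      and G2: "\<forall>x\<in>G. \<forall>t. \<bar>t\<bar> \<le> B \<longrightarrow> \<bar>log_mean N x (Complex t h) - plane_potential (Complex t h)\<bar> \<le> e"
      by (elim bexE conjE)
    note G = G01[folded a_def] G2[rule_format]
    have main: "insertion_kernel ?\<alpha> (\<beta> n) N x t \<le> exp (a * (V + 3 * e))"
      if x: "x \<in> G" and t: "\<bar>t\<bar> \<le> B" "t \<in> A" for x t
    proof -
      let ?p = "plane_potential (Complex t h)"
      have lm: "log_mean N x (Complex t h) \<le> ?p + e" using G(3)[OF x t(1)] by (simp add: abs_le_iff)
      have "\<beta> n * real N * log_mean N x (Complex t h) \<le> \<beta> n * real N * (?p + e)"
        using b by (intro mult_left_mono lm) auto
      also have "\<dots> = a * (?p + e) - \<beta> n * (?p + e)" by (simp add: a N algebra_simps)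
      \<comment> \<open>There are only \<open>n - 1\<close> factors; the missing one matters little as the potential is bounded below.\<close>
      also have "\<dots> \<le> a * (?p + e) + a * e"
      proof -
        have "- (?p + e) \<le> 1" using plane_potential_ge[OF h(1), of t] e by simp
        then have "\<beta> n * (- (?p + e)) \<le> \<beta> n * 1" using b by (intro mult_left_mono) auto
        moreover have "1 \<le> real n * e" using elim e by (simp add: pos_divide_le_eq)
        then have "\<beta> n * 1 \<le> \<beta> n * (real n * e)" using b by (intro mult_left_mono) auto
        ultimately show ?thesis by (simp add: a algebra_simps)
      qed
      finally have 1: "\<beta> n * real N * log_mean N x (Complex t h) \<le> a * (?p + 2 * e)" by (simp add: algebra_simps)
      have "?p - t\<^sup>2 / 4 \<le> V + e" by (rule h(2)[OF t(2)])
      then have "a * (?p - t\<^sup>2 / 4) \<le> a * (V + e)" using a by (intro mult_left_mono) auto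
      then have "- (?\<alpha> / 2) * t\<^sup>2 + \<beta> n * real N * log_mean N x (Complex t h) \<le> a * (V + 3 * e)"
        using 1 by (simp add: a algebra_simps)
      then show ?thesis
        by (intro order_trans[OF insertion_kernel_le_smoothed[OF b h(1) N(3)]]) simp
    qed
    have crude: "insertion_kernel ?\<alpha> (\<beta> n) N x t \<le> exp a * exp (- (a * t\<^sup>2 / 8)) * exp (\<beta> n * ?S x)" for x t
    proof -
      have l: "0 \<le> ln (sqrt (1 + t\<^sup>2))" by simp
      have "\<beta> n * real N * ln (sqrt (1 + t\<^sup>2)) \<le> \<beta> n * real n * ln (sqrt (1 + t\<^sup>2))"
        using b N l by (intro mult_right_mono mult_left_mono) auto
      also have "\<dots> \<le> a * (t\<^sup>2 / 8 + 1)"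
        unfolding a(1) using b by (simp only: mult.commute[of "\<beta> n"]) (intro mult_left_mono ln_one_plus_square_le, simp)
      finally have "- (?\<alpha> / 2) * t\<^sup>2 + \<beta> n * real N * ln (sqrt (1 + t\<^sup>2)) \<le> a - a * t\<^sup>2 / 8"
        by (simp add: a algebra_simps)
      then have "exp (- (?\<alpha> / 2) * t\<^sup>2 + \<beta> n * real N * ln (sqrt (1 + t\<^sup>2))) \<le> exp a * exp (- (a * t\<^sup>2 / 8))"
        by (simp add: exp_add[symmetric])
      then have "exp (- (?\<alpha> / 2) * t\<^sup>2 + \<beta> n * real N * ln (sqrt (1 + t\<^sup>2))) * exp (\<beta> n * ?S x)
          \<le> exp a * exp (- (a * t\<^sup>2 / 8)) * exp (\<beta> n * ?S x)"
        by (rule mult_right_mono) simp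
      then show ?thesis by (rule order_trans[OF insertion_kernel_le[OF b]])
    qed
    have bad: "insertion_kernel ?\<alpha> (\<beta> n) N x t
      \<le> ?g t * (exp a * exp (\<beta> n * ?S x))" for x t
    proof -
      have "4 * t\<^sup>2 \<le> a * t\<^sup>2" using a by (intro mult_right_mono) auto
      then have "exp (- (a * t\<^sup>2 / 8)) \<le> ?g t" by simp
      then have le: "exp (- (a * t\<^sup>2 / 8)) * (exp a * exp (\<beta> n * ?S x)) \<le> ?g t * (exp a * exp (\<beta> n * ?S x))"
        by (rule mult_right_mono) simp
      have "exp a * exp (- (a * t\<^sup>2 / 8)) * exp (\<beta> n * ?S x) = exp (- (a * t\<^sup>2 / 8)) * (exp a * exp (\<beta> n * ?S x))"
        by (simp only: mult_ac)
      from order_trans[OF crude[of x t, unfolded this] le] show ?thesis .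
    qed
    have tail: "insertion_kernel ?\<alpha> (\<beta> n) N x t
      \<le> ?g t * (exp (a * (V - 3)) * exp (\<beta> n * ?S x))" if t: "\<bar>t\<bar> > B" for x t
    proof -
      have "B\<^sup>2 \<le> t\<^sup>2" using t B power_mono[of B "\<bar>t\<bar>" 2] by simp
      then have "4 - V \<le> t\<^sup>2 / 16" using B(2) by linarith
      then have "a * (4 - V) \<le> a * (t\<^sup>2 / 16)" using a by (intro mult_left_mono) auto
      moreover have "8 * t\<^sup>2 \<le> a * t\<^sup>2" using a by (intro mult_right_mono) auto
      ultimately have "a + - (a * t\<^sup>2 / 8) \<le> - (1 / 2) * t\<^sup>2 + a * (V - 3)" by (simp add: algebra_simps)
      then have "exp a * exp (- (a * t\<^sup>2 / 8)) \<le> ?g t * exp (a * (V - 3))"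
        unfolding exp_add[symmetric] by simp
      then have "exp a * exp (- (a * t\<^sup>2 / 8)) * exp (\<beta> n * ?S x) \<le> ?g t * exp (a * (V - 3)) * exp (\<beta> n * ?S x)"
        by (rule mult_right_mono) simp
      from order_trans[OF crude[of x t] this] show ?thesis by (simp only: mult.assoc)
    qed
    define c1 where "c1 = ennreal (exp (a * (V + 3 * e)))"
    define Y where "Y x = ennreal (exp (\<beta> n * ?S x))" for x
    define Z where "Z x = ennreal (exp (2 * \<beta> n * ?S x))" for x
    have Ym [measurable]: "Y \<in> borel_measurable ?M" and Zm [measurable]: "Z \<in> borel_measurable ?M"
      using sum_sqrt_measurable[of N] unfolding Y_def[abs_def] Z_def[abs_def]
      by (simp_all add: measurable_cong_sets[OF sets_gbe refl])
    have Gm [measurable]: "G \<in> sets ?M" "space (lebn N) - G \<in> sets ?M" using G(1) by (auto simp: sets_gbe)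
    have EY: "(\<integral>\<^sup>+ x. Y x \<partial>?M) \<le> ennreal (exp (3 * a))"
      using elim(2) N by (simp add: Y_def a_def)
    have EZ: "(\<integral>\<^sup>+ x. Z x \<partial>?M) \<le> ennreal (exp (6 * a))"
      using elim(3) N by (simp add: Z_def a_def)
    let ?bad = "indicator (space (lebn N) - G) :: (nat \<Rightarrow> real) \<Rightarrow> ennreal"
    have inner: "(\<integral>\<^sup>+ t. ennreal (insertion_kernel ?\<alpha> (\<beta> n) N x t) * indicator A t \<partial>lborel)
       \<le> c1 * ennreal (2 * B) + ennreal gaussian_mass * (ennreal (exp a) * Y x * ?bad x + ennreal (exp (a * (V - 3))) * Y x)"
      if x: "x \<in> space ?M" for x
    proof -
      have "(\<integral>\<^sup>+ t. ennreal (insertion_kernel ?\<alpha> (\<beta> n) N x t) * indicator A t \<partial>lborel)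
         \<le> (\<integral>\<^sup>+ t. c1 * indicator {-B..B} t + ennreal (?g t) * (ennreal (exp a) * Y x * ?bad x + ennreal (exp (a * (V - 3))) * Y x) \<partial>lborel)"
      proof (rule nn_integral_mono)
        fix t
        show "ennreal (insertion_kernel ?\<alpha> (\<beta> n) N x t) * indicator A t
          \<le> c1 * indicator {-B..B} t + ennreal (?g t) * (ennreal (exp a) * Y x * ?bad x + ennreal (exp (a * (V - 3))) * Y x)"
        proof (cases "t \<in> A")
          case True
          consider "\<bar>t\<bar> > B" | "\<bar>t\<bar> \<le> B" "x \<in> G" | "x \<notin> G" by linarith
          then show ?thesis
          proof cases
            case 1
            have "ennreal (insertion_kernel ?\<alpha> (\<beta> n) N x t) \<le> ennreal (?g t * (exp (a * (V - 3)) * exp (\<beta> n * ?S x)))"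
              by (intro ennreal_leI tail 1)
            also have "\<dots> = ennreal (?g t) * (ennreal (exp (a * (V - 3))) * Y x)" by (simp add: Y_def ennreal_mult)
            finally show ?thesis using True by (simp add: distrib_left add_increasing)
          next
            case 2
            then have "ennreal (insertion_kernel ?\<alpha> (\<beta> n) N x t) \<le> c1"
              unfolding c1_def by (intro ennreal_leI main True)
            moreover have "t \<in> {-B..B}" using 2 by (auto simp: abs_le_iff)
            ultimately show ?thesis using True by (simp add: add_increasing2)
          next
            case 3
            have "ennreal (insertion_kernel ?\<alpha> (\<beta> n) N x t) \<le> ennreal (?g t * (exp a * exp (\<beta> n * ?S x)))"
              by (intro ennreal_leI bad)
            also have "\<dots> = ennreal (?g t) * (ennreal (exp a) * Y x)" by (simp add: Y_def ennreal_mult)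
            finally have *: "ennreal (insertion_kernel ?\<alpha> (\<beta> n) N x t) \<le> ennreal (?g t) * (ennreal (exp a) * Y x)" .
            have "?bad x = 1" using 3 x by (simp add: space_gbe)
            then show ?thesis using True * by (simp add: distrib_left add_increasing add_increasing2)
          qed
        qed simp
      qed
      also have "\<dots> = c1 * ennreal (2 * B) + ennreal gaussian_mass * (ennreal (exp a) * Y x * ?bad x + ennreal (exp (a * (V - 3))) * Y x)"
        using B(1) by (simp add: nn_integral_add nn_integral_cmult nn_integral_multc gaussian_mass[simplified])
      finally show ?thesis .
    qed
    have badE: "(\<integral>\<^sup>+ x. Y x * ?bad x \<partial>?M) \<le> 2 * ennreal (exp (a * (V - 1)))"
    proof -
      have "(\<integral>\<^sup>+ x. Y x * ?bad x \<partial>?M) \<le> (\<integral>\<^sup>+ x. ennreal (exp (K * a)) * ?bad x + ennreal (exp (- (K * a))) * Z x \<partial>?M)"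
      proof (rule nn_integral_mono)
        fix x
        show "Y x * ?bad x \<le> ennreal (exp (K * a)) * ?bad x + ennreal (exp (- (K * a))) * Z x"
        proof (cases "\<beta> n * ?S x \<le> K * a")
          case True
          then have "Y x \<le> ennreal (exp (K * a))" by (simp add: Y_def ennreal_leI)
          then have "Y x * ?bad x \<le> ennreal (exp (K * a)) * ?bad x" by (rule mult_right_mono) simp
          then show ?thesis by (simp add: add_increasing2)
        next
          case False
          then have "exp (\<beta> n * ?S x) \<le> exp (- (K * a)) * exp (2 * \<beta> n * ?S x)"
            by (simp add: exp_add[symmetric])
          then have "Y x \<le> ennreal (exp (- (K * a)) * exp (2 * \<beta> n * ?S x))"
            unfolding Y_def by (rule ennreal_leI)
          then have "Y x * ?bad x \<le> ennreal (exp (- (K * a))) * Z x * 1"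
            by (intro mult_mono) (auto simp: Z_def ennreal_mult indicator_def)
          then show ?thesis by (simp add: add_increasing)
        qed
      qed
      also have "\<dots> = ennreal (exp (K * a)) * emeasure ?M (space (lebn N) - G) + ennreal (exp (- (K * a))) * (\<integral>\<^sup>+ x. Z x \<partial>?M)"
        by (simp add: nn_integral_add nn_integral_cmult)
      also have "\<dots> \<le> ennreal (exp (K * a)) * ennreal (exp (- (M * a))) + ennreal (exp (- (K * a))) * ennreal (exp (6 * a))"
        by (intro add_mono mult_left_mono G(2) EZ) auto
      also have "\<dots> = ennreal (exp (a * (V - 1))) + ennreal (exp (a * (V - 1)))"
        by (simp add: exp_add[symmetric] M_def K_def algebra_simps flip: ennreal_mult'')
      finally show ?thesis by (simp add: mult_2)
    qed
    have "insertion_mass N ?\<alpha> (\<beta> n) A \<le> (\<integral>\<^sup>+ x. c1 * ennreal (2 * B) + ennreal gaussian_mass * (ennreal (exp a) * Y x * ?bad x + ennreal (exp (a * (V - 3))) * Y x) \<partial>?M)"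
      unfolding insertion_mass_def by (intro nn_integral_mono inner)
    also have "\<dots> = c1 * ennreal (2 * B) + ennreal gaussian_mass * (ennreal (exp a) * (\<integral>\<^sup>+ x. Y x * ?bad x \<partial>?M) + ennreal (exp (a * (V - 3))) * (\<integral>\<^sup>+ x. Y x \<partial>?M))"
      by (simp add: nn_integral_add nn_integral_cmult mult.assoc emeasure_space_1)
    also have "\<dots> \<le> c1 * ennreal (2 * B) + ennreal gaussian_mass * (ennreal (exp a) * (2 * ennreal (exp (a * (V - 1)))) + ennreal (exp (a * (V - 3))) * ennreal (exp (3 * a)))"
      by (intro add_mono mult_left_mono badE EY order_refl) auto
    also have "\<dots> = ennreal (exp (a * (V + 3 * e)) * (2 * B) + gaussian_mass * (3 * exp (a * V)))"
    proof -
      have "ennreal (exp a) * (2 * ennreal (exp (a * (V - 1)))) + ennreal (exp (a * (V - 3))) * ennreal (exp (3 * a))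
         = ennreal (exp a * (2 * exp (a * (V - 1))) + exp (a * (V - 3)) * exp (3 * a))"
        by (simp add: ennreal_mult)
      also have "exp a * (2 * exp (a * (V - 1))) + exp (a * (V - 3)) * exp (3 * a) = 3 * exp (a * V)"
        by (simp add: exp_add[symmetric] algebra_simps)
      finally show ?thesis using B(1) gaussian_mass_nonneg by (simp add: c1_def ennreal_mult)
    qed
    also have "\<dots> \<le> ennreal (exp (a * (V + \<kappa>)))"
    proof (rule ennreal_leI)
      have "a * V \<le> a * (V + 3 * e)" using a(2) e by (intro mult_left_mono) auto
      then have "gaussian_mass * (3 * exp (a * V)) \<le> gaussian_mass * (3 * exp (a * (V + 3 * e)))"
        using gaussian_mass_nonneg by (intro mult_left_mono) auto
      then have "exp (a * (V + 3 * e)) * (2 * B) + gaussian_mass * (3 * exp (a * V)) \<le> exp (a * (V + 3 * e)) * C0"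
        by (simp add: C0_def algebra_simps)
      also have "\<dots> \<le> exp (a * (V + 3 * e)) * exp (a * e)"
      proof (rule mult_left_mono)
        have "ln (C0 + 1) \<le> a * e" using elim e by (simp add: a_def pos_divide_le_eq)
        then have "exp (ln (C0 + 1)) \<le> exp (a * e)" by (subst exp_le_cancel_iff)
        then show "C0 \<le> exp (a * e)" using C0 by simp
      qed simp
      also have "\<dots> = exp (a * (V + \<kappa>))" by (simp add: exp_add[symmetric] e_def algebra_simps)
      finally show "exp (a * (V + 3 * e)) * (2 * B) + gaussian_mass * (3 * exp (a * V)) \<le> exp (a * (V + \<kappa>))" .
    qed
    finally show ?case by (simp add: N_def a_def)
  qed
qed

end

text \<open>
  The function \<open>sqrt\<close> is odd on the whole real line, so \<open>2 * sqrt (t - y)\<close> is a continuous primitive across the singularity.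
\<close>

lemma inverse_sqrt_integral:
  assumes pq: "p < q"
  shows "(\<integral>\<^sup>+ t. ennreal (1 / sqrt \<bar>t - y\<bar>) * indicator {p..q} t \<partial>lborel) \<le> ennreal (4 * sqrt (q - p))"
proof -
  have "((\<lambda>t. 1 / sqrt \<bar>t - y\<bar>) has_integral 2 * sqrt (q - y) - 2 * sqrt (p - y)) {p..q}"
  proof (rule fundamental_theorem_of_calculus_interior_strong[of "{y}"])
    fix t assume "t \<in> {p<..<q} - {y}"
    then consider "t > y" | "t < y" by force
    then have "((\<lambda>t. 2 * sqrt (t - y)) has_real_derivative 1 / sqrt \<bar>t - y\<bar>) (at t)"
    proof cases
      case 1
      have "((\<lambda>t. 2 * sqrt (t - y)) has_real_derivative 2 * ((1 - 0) * (inverse (sqrt (t - y)) / 2))) (at t)"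
        using 1 by (auto intro!: derivative_eq_intros)
      then show ?thesis using 1 by (simp add: inverse_eq_divide)
    next
      case 2
      have "(sqrt has_real_derivative - inverse (sqrt (t - y)) / 2) (at (t - y))"
        by (rule DERIV_real_sqrt_generic) (use 2 in auto)
      then have "((\<lambda>t. sqrt (t - y)) has_real_derivative - inverse (sqrt (t - y)) / 2 * 1) (at t)"
        by (rule DERIV_chain2) (auto intro!: derivative_eq_intros)
      from DERIV_cmult[OF this, of 2]
      have "((\<lambda>t. 2 * sqrt (t - y)) has_real_derivative 2 * (- inverse (sqrt (t - y)) / 2 * 1)) (at t)" .
      moreover have "sqrt (t - y) = - sqrt (y - t)" using real_sqrt_minus[of "y - t"] by simp
      ultimately show ?thesis using 2 by (simp add: inverse_eq_divide)
    qed
    then show "((\<lambda>t. 2 * sqrt (t - y)) has_vector_derivative 1 / sqrt \<bar>t - y\<bar>) (at t)"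
      by (simp add: has_real_derivative_iff_has_vector_derivative)
  next
    show "continuous_on {p..q} (\<lambda>t. 2 * sqrt (t - y))" by (intro continuous_intros)
  qed (use pq in auto)
  then have "(\<integral>\<^sup>+ t. ennreal (indicator {p..q} t * (1 / sqrt \<bar>t - y\<bar>)) \<partial>lborel) = ennreal (2 * sqrt (q - y) - 2 * sqrt (p - y))"
    by (intro nn_integral_has_integral_lebesgue) auto
  moreover have "2 * sqrt (q - y) - 2 * sqrt (p - y) \<le> 4 * sqrt (q - p)"
  proof -
    have nn: "sqrt (q - p) \<ge> 0" using pq by simp
    have neg: "sqrt (u - y) = - sqrt (y - u)" for u using real_sqrt_minus[of "y - u"] by simp
    consider "y \<le> p" | "p < y" "y < q" | "q \<le> y" by linarith
    then show ?thesis
    proof cases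
      case 1
      then have "sqrt (q - y) \<le> sqrt (q - p) + sqrt (p - y)"
        using sqrt_add_le_add_sqrt[of "q - p" "p - y"] pq by simp
      then show ?thesis using nn by linarith
    next
      case 2
      then have "sqrt (q - y) \<le> sqrt (q - p)" "sqrt (y - p) \<le> sqrt (q - p)" by auto
      then show ?thesis using neg[of p] by linarith
    next
      case 3
      then have "sqrt (y - p) \<le> sqrt (q - p) + sqrt (y - q)"
        using sqrt_add_le_add_sqrt[of "q - p" "y - q"] pq by simp
      then show ?thesis using neg[of p] neg[of q] nn by linarith
    qed
  qed
  moreover have "(\<integral>\<^sup>+ t. ennreal (1 / sqrt \<bar>t - y\<bar>) * indicator {p..q} t \<partial>lborel)
      = (\<integral>\<^sup>+ t. ennreal (indicator {p..q} t * (1 / sqrt \<bar>t - y\<bar>)) \<partial>lborel)"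
    by (intro nn_integral_cong) (auto simp: indicator_def)
  ultimately show ?thesis by (simp only: ennreal_leI)
qed

text \<open>
  Integrate the tangent inequality \<open>exp (- y0) * (1 + y0 - y) \<le> exp (- y)\<close>, written without subtraction so that it makes
  sense for nonnegative extended reals.
\<close>

lemma Jensen_exp_interval:
  fixes y :: "real \<Rightarrow> real"
  assumes pq: "p \<le> q" and [measurable]: "y \<in> borel_measurable borel" and nn: "\<And>t. y t \<ge> 0" "y0 \<ge> 0"
    and int: "(\<integral>\<^sup>+ t. ennreal (y t) * indicator {p..q} t \<partial>lborel) \<le> ennreal ((q - p) * y0)"
  shows "ennreal ((q - p) * exp (- y0)) \<le> (\<integral>\<^sup>+ t. ennreal (exp (- y t)) * indicator {p..q} t \<partial>lborel)"
proof -
  let ?I = "\<integral>\<^sup>+ t. ennreal (exp (- y t)) * indicator {p..q} t \<partial>lborel"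
  have le: "exp (- y0) * (1 + y0) \<le> exp (- y t) + exp (- y0) * y t" for t
  proof -
    have "1 + (y0 - y t) \<le> exp (y0 - y t)" by (rule exp_ge_add_one_self)
    then have "exp (- y0) * (1 + (y0 - y t)) \<le> exp (- y0) * exp (y0 - y t)" by (rule mult_left_mono) simp
    then show ?thesis by (simp add: exp_add[symmetric] algebra_simps)
  qed
  have "ennreal ((q - p) * (exp (- y0) * y0)) + ennreal ((q - p) * exp (- y0)) = ennreal (exp (- y0) * (1 + y0) * (q - p))"
  proof -
    have "(q - p) * (exp (- y0) * y0) + (q - p) * exp (- y0) = exp (- y0) * (1 + y0) * (q - p)"
      by (simp add: algebra_simps)
    then show ?thesis
      by (subst ennreal_plus[symmetric]) (simp_all add: pq nn)
  qed
  also have "\<dots> = (\<integral>\<^sup>+ t. ennreal (exp (- y0) * (1 + y0)) * indicator {p..q} t \<partial>lborel)"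
    using pq nn by (simp add: nn_integral_cmult ennreal_mult)
  also have "\<dots> \<le> (\<integral>\<^sup>+ t. ennreal (exp (- y t)) * indicator {p..q} t + ennreal (exp (- y0)) * (ennreal (y t) * indicator {p..q} t) \<partial>lborel)"
    using le nn by (intro nn_integral_mono) (auto simp: indicator_def ennreal_leI simp flip: ennreal_plus ennreal_mult)
  also have "\<dots> = ?I + ennreal (exp (- y0)) * (\<integral>\<^sup>+ t. ennreal (y t) * indicator {p..q} t \<partial>lborel)"
    by (simp add: nn_integral_add nn_integral_cmult)
  also have "\<dots> \<le> ?I + ennreal (exp (- y0)) * ennreal ((q - p) * y0)"
    by (intro add_mono mult_left_mono int) auto
  also have "ennreal (exp (- y0)) * ennreal ((q - p) * y0) = ennreal ((q - p) * (exp (- y0) * y0))"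
    using pq nn by (simp add: mult_ac flip: ennreal_mult)
  finally have "ennreal ((q - p) * (exp (- y0) * y0)) + ennreal ((q - p) * exp (- y0)) \<le> ennreal ((q - p) * (exp (- y0) * y0)) + ?I"
    by (simp add: add.commute)
  then show ?thesis by (simp add: ennreal_add_left_cancel_le)
qed

lemma insertion_kernel_ge_smoothed:
  assumes b: "\<beta> > 0" and h: "h > 0" and N: "N > 0" and t: "t \<notin> x ` {..<N}"
  shows "exp (- (\<alpha> / 2) * t\<^sup>2 + \<beta> * real N * log_mean N x (Complex t h))
      * exp (- (\<Sum>i<N. \<beta> * (2 * sqrt h) * (1 / sqrt \<bar>t - x i\<bar>))) \<le> insertion_kernel \<alpha> \<beta> N x t"
proof -
  have "exp (\<beta> * real N * log_mean N x (Complex t h)) * exp (- (\<Sum>i<N. \<beta> * (2 * sqrt h) * (1 / sqrt \<bar>t - x i\<bar>)))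
      = exp (\<Sum>i<N. \<beta> * ln (cmod (Complex t h - complex_of_real (x i))) - \<beta> * (2 * sqrt h) * (1 / sqrt \<bar>t - x i\<bar>))"
    using N by (simp add: log_mean_def exp_add[symmetric] sum_distrib_left[symmetric] sum_subtractf)
  also have "\<dots> = (\<Prod>i<N. exp (\<beta> * ln (cmod (Complex t h - complex_of_real (x i))) - \<beta> * (2 * sqrt h) * (1 / sqrt \<bar>t - x i\<bar>)))"
    by (simp add: exp_sum)
  also have "\<dots> \<le> (\<Prod>i<N. \<bar>x i - t\<bar> powr \<beta>)"
  proof (intro prod_mono conjI)
    fix i assume "i \<in> {..<N}"
    then have ne: "t \<noteq> x i" using t by auto
    have "\<beta> * (ln (cmod (Complex t h - complex_of_real (x i))) - 2 * sqrt h / sqrt \<bar>t - x i\<bar>) \<le> \<beta> * ln \<bar>t - x i\<bar>"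
      using b by (intro mult_left_mono log_smoothing_loss[OF h ne]) auto
    then have "exp (\<beta> * ln (cmod (Complex t h - complex_of_real (x i))) - \<beta> * (2 * sqrt h) * (1 / sqrt \<bar>t - x i\<bar>))
       \<le> exp (\<beta> * ln \<bar>t - x i\<bar>)"
      by (simp add: right_diff_distrib)
    then show "exp (\<beta> * ln (cmod (Complex t h - complex_of_real (x i))) - \<beta> * (2 * sqrt h) * (1 / sqrt \<bar>t - x i\<bar>))
       \<le> \<bar>x i - t\<bar> powr \<beta>"
      using ne by (simp add: powr_def abs_minus_commute)
  qed auto
  finally have "exp (- (\<alpha> / 2) * t\<^sup>2) * (exp (\<beta> * real N * log_mean N x (Complex t h)) * exp (- (\<Sum>i<N. \<beta> * (2 * sqrt h) * (1 / sqrt \<bar>t - x i\<bar>))))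
     \<le> insertion_kernel \<alpha> \<beta> N x t"
    unfolding insertion_kernel_def by (rule mult_left_mono) simp
  then show ?thesis by (simp only: exp_add mult.assoc)
qed

context beta_regime
begin

text \<open>
  On the good event the smoothed kernel is at least \<open>exp m\<close> on the whole interval. The smoothing loss \<open>y\<close> is singular at
  the particles, but its average over the interval is small, so \<open>Jensen_exp_interval\<close> applies to each configuration separately.
\<close>

lemma insertion_mass_lower:
  assumes pq: "2 < p" "p < q" and k: "\<kappa> > 0"
  shows "\<forall>\<^sub>F n in sequentially.
    ennreal (exp (speed n * (- 1 / 2 - excess q - \<kappa>))) \<le> insertion_mass (n - 1) (real n * \<beta> n / 2) (\<beta> n) {p..q}"
proof -
  define e where "e = \<kappa> / 8"
  have e: "e > 0" using k by (simp add: e_def)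
  define c where "c = 2 * (outer_root_real p / (outer_root_real p - 1))"
  have "outer_root_real p > 1" using outer_root_real_strict_mono[of 2 p] pq by (simp add: outer_root_real_def)
  then have c: "c > 0" by (simp add: c_def)
  \<comment> \<open>The first entry controls the change of the potential from height \<open>0\<close> to \<open>h\<close>, the second one the average smoothing
    loss, which is at most \<open>8 * a * sqrt h / sqrt (q - p)\<close>.\<close>
  define h where "h = min (e / c) ((q - p) * (e / 8)\<^sup>2)"
  have h: "h > 0" using e c pq by (simp add: h_def)
  have "c * h \<le> c * (e / c)" using c by (intro mult_left_mono) (auto simp: h_def)
  then have ch: "c * h \<le> e" using c by simp
  have "sqrt h \<le> sqrt ((q - p) * (e / 8)\<^sup>2)" by (simp add: h_def)
  also have "\<dots> = sqrt (q - p) * (e / 8)" using e by (simp add: real_sqrt_mult)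
  finally have sh: "8 * sqrt h \<le> sqrt (q - p) * e" by simp
  have B: "q \<ge> 0" using pq by simp
  show ?thesis
    using log_mean_superexponential[OF B h e, of 1] real_ge[of 2] real_ge[of "q\<^sup>2 / e"]
      speed_ge[of "ln 2"] speed_ge[of "ln (2 / (q - p)) / e"]
  proof eventually_elim
    case (elim n)
    define a where "a = speed n"
    define N where "N = n - 1"
    have n: "n \<ge> 2" using elim by simp
    have N: "N \<le> n" "n \<le> N + 1" "N > 0" "real N = real n - 1" using n by (auto simp: N_def)
    have b: "\<beta> n > 0" using beta_pos[of n] n by simp
    have a: "a = real n * \<beta> n" "a > 0" using b n elim by (simp_all add: a_def speed_def)
    let ?\<alpha> = "real n * \<beta> n / 2"
    let ?M = "ens n N"
    interpret prob_space ?M using b a by (intro prob_space_gbe) auto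
    from mp[OF spec[OF elim(1), of N] conjI[OF N(1,2)]]
    obtain G where G01: "G \<in> sets (lebn N)" "emeasure ?M (space (lebn N) - G) \<le> ennreal (exp (- (1 * speed n)))"
      and G2: "\<forall>x\<in>G. \<forall>t. \<bar>t\<bar> \<le> q \<longrightarrow> \<bar>log_mean N x (Complex t h) - plane_potential (Complex t h)\<bar> \<le> e"
      by (elim bexE conjE)
    note G = G01[folded a_def, unfolded mult_1_left] G2[rule_format]
    have PG: "ennreal (1 / 2) \<le> emeasure ?M G"
    proof -
      have Gm: "G \<in> sets ?M" using G(1) by (simp add: sets_gbe)
      have "prob (space ?M - G) \<le> exp (- a)"
        using G(2) by (simp add: emeasure_eq_measure space_gbe)
      also have "\<dots> \<le> exp (- ln 2)" using elim(4) by (simp add: a_def)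
      also have "\<dots> = 1 / 2" by (simp add: exp_minus)
      finally have "prob G \<ge> 1 / 2" using prob_compl[OF Gm] by simp
      then show ?thesis unfolding emeasure_eq_measure by (rule ennreal_leI)
    qed
    define m where "m = a * (- 1 / 2 - excess q - 3 * e)"
    define y where "y x t = (\<Sum>i<N. \<beta> n * (2 * sqrt h) * (1 / sqrt \<bar>t - x i\<bar>))" for x :: "nat \<Rightarrow> real" and t
    have ker: "exp m * exp (- y x t) \<le> insertion_kernel ?\<alpha> (\<beta> n) N x t"
      if x: "x \<in> G" and t: "t \<in> {p..q}" "t \<notin> x ` {..<N}" for x t
    proof -
      have t2: "t > 2" "\<bar>t\<bar> \<le> q" using t pq by auto
      have "plane_potential (Complex t h) \<ge> line_potential t - c * h"
        using plane_potential_near_line[OF h, of p t] t pq by (simp add: c_def abs_le_iff algebra_simps)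
      then have lm: "log_mean N x (Complex t h) \<ge> line_potential t - 2 * e"
        using G(3)[OF x t2(2)] ch by (simp add: abs_le_iff)
      have "- (?\<alpha> / 2) * t\<^sup>2 + \<beta> n * real N * (line_potential t - 2 * e)
          = a * (line_potential t - t\<^sup>2 / 4 - 2 * e) - \<beta> n * (line_potential t - 2 * e)"
        by (simp add: a N algebra_simps)
      also have "\<dots> \<ge> a * (- 1 / 2 - excess q - 2 * e) - a * e"
      proof (rule diff_mono)
        have "- 1 / 2 - excess q - 2 * e \<le> line_potential t - t\<^sup>2 / 4 - 2 * e"
          using excess_mono[of t q] t t2 by (simp add: excess_def)
        then show "a * (- 1 / 2 - excess q - 2 * e) \<le> a * (line_potential t - t\<^sup>2 / 4 - 2 * e)"
          by (rule mult_left_mono) (use a in simp)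
        have "excess t \<ge> 0" using t2 by (intro excess_nonneg) simp
        then have "line_potential t - 2 * e \<le> t\<^sup>2" using e zero_le_power2[of t] unfolding excess_def by linarith
        also have "t\<^sup>2 \<le> q\<^sup>2" using t pq by (intro power_mono) auto
        also have "\<dots> \<le> real n * e" using elim(3) e by (simp add: pos_divide_le_eq)
        finally have "\<beta> n * (line_potential t - 2 * e) \<le> \<beta> n * (real n * e)"
          using b by (intro mult_left_mono) auto
        then show "\<beta> n * (line_potential t - 2 * e) \<le> a * e" by (simp add: a mult_ac)
      qed
      also have "a * (- 1 / 2 - excess q - 2 * e) - a * e = m" by (simp add: m_def algebra_simps)
      finally have "m \<le> - (?\<alpha> / 2) * t\<^sup>2 + \<beta> n * real N * (line_potential t - 2 * e)" .
      also have "\<dots> \<le> - (?\<alpha> / 2) * t\<^sup>2 + \<beta> n * real N * log_mean N x (Complex t h)"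
        using lm b by (intro add_left_mono mult_left_mono) auto
      finally have "exp m * exp (- y x t) \<le> exp (- (?\<alpha> / 2) * t\<^sup>2 + \<beta> n * real N * log_mean N x (Complex t h)) * exp (- y x t)"
        by (intro mult_right_mono) auto
      also have "\<dots> \<le> insertion_kernel ?\<alpha> (\<beta> n) N x t"
        unfolding y_def by (rule insertion_kernel_ge_smoothed[OF b h N(3) t(2)])
      finally show ?thesis .
    qed
    define y0 where "y0 = a * e"
    have y0: "y0 \<ge> 0" using a e by (simp add: y0_def)
    have yint: "(\<integral>\<^sup>+ t. ennreal (y x t) * indicator {p..q} t \<partial>lborel) \<le> ennreal ((q - p) * y0)" for x
    proof -
      have "(\<integral>\<^sup>+ t. ennreal (y x t) * indicator {p..q} t \<partial>lborel)
          = (\<integral>\<^sup>+ t. (\<Sum>i<N. ennreal (\<beta> n * (2 * sqrt h)) * (ennreal (1 / sqrt \<bar>t - x i\<bar>) * indicator {p..q} t)) \<partial>lborel)"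
      proof (rule nn_integral_cong)
        fix t
        have "ennreal (y x t) = (\<Sum>i<N. ennreal (\<beta> n * (2 * sqrt h) * (1 / sqrt \<bar>t - x i\<bar>)))"
          unfolding y_def using b h by (intro sum_ennreal[symmetric]) auto
        also have "\<dots> = (\<Sum>i<N. ennreal (\<beta> n * (2 * sqrt h)) * ennreal (1 / sqrt \<bar>t - x i\<bar>))"
          using b h by (intro sum.cong refl ennreal_mult) auto
        finally show "ennreal (y x t) * indicator {p..q} t
          = (\<Sum>i<N. ennreal (\<beta> n * (2 * sqrt h)) * (ennreal (1 / sqrt \<bar>t - x i\<bar>) * indicator {p..q} t))"
          by (simp add: sum_distrib_right mult.assoc)
      qed
      also have "\<dots> = (\<Sum>i<N. ennreal (\<beta> n * (2 * sqrt h)) * (\<integral>\<^sup>+ t. ennreal (1 / sqrt \<bar>t - x i\<bar>) * indicator {p..q} t \<partial>lborel))"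
        by (simp add: nn_integral_sum nn_integral_cmult)
      also have "\<dots> \<le> (\<Sum>i<N. ennreal (\<beta> n * (2 * sqrt h)) * ennreal (4 * sqrt (q - p)))"
        by (intro sum_mono mult_left_mono inverse_sqrt_integral pq) auto
      also have "\<dots> = (\<Sum>i<N. ennreal (\<beta> n * (2 * sqrt h) * (4 * sqrt (q - p))))"
        by (intro sum.cong refl ennreal_mult[symmetric]) (use b h pq in auto)
      also have "\<dots> = ennreal (\<Sum>i<N. \<beta> n * (2 * sqrt h) * (4 * sqrt (q - p)))"
        by (rule sum_ennreal) (use b h pq in auto)
      also have "(\<Sum>i<N. \<beta> n * (2 * sqrt h) * (4 * sqrt (q - p))) = real N * (\<beta> n * (2 * sqrt h) * (4 * sqrt (q - p)))"
        by simp
      also have "\<dots> \<le> ennreal ((q - p) * y0)"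
      proof (rule ennreal_leI)
        have "real N * (\<beta> n * (2 * sqrt h) * (4 * sqrt (q - p))) \<le> real n * (\<beta> n * (2 * sqrt h) * (4 * sqrt (q - p)))"
          using b h pq N by (intro mult_right_mono) auto
        also have "\<dots> = a * sqrt (q - p) * (8 * sqrt h)" by (simp add: a)
        also have "\<dots> \<le> a * sqrt (q - p) * (sqrt (q - p) * e)" using sh a pq by (intro mult_left_mono) auto
        also have "\<dots> = a * e * (sqrt (q - p) * sqrt (q - p))" by (simp only: mult_ac)
        also have "\<dots> = (q - p) * y0" using pq by (simp add: y0_def)
        finally show "real N * (\<beta> n * (2 * sqrt h) * (4 * sqrt (q - p))) \<le> (q - p) * y0" .
      qed
      finally show ?thesis .
    qed
    have inner: "ennreal (exp m * ((q - p) * exp (- y0))) \<le> (\<integral>\<^sup>+ t. ennreal (insertion_kernel ?\<alpha> (\<beta> n) N x t) * indicator {p..q} t \<partial>lborel)"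
      if x: "x \<in> G" for x
    proof -
      have ym [measurable]: "y x \<in> borel_measurable borel" unfolding y_def by measurable
      have ynn: "y x t \<ge> 0" for t unfolding y_def using b h by (intro sum_nonneg) auto
      have "ennreal (exp m * ((q - p) * exp (- y0))) = ennreal (exp m) * ennreal ((q - p) * exp (- y0))"
        using pq by (simp add: ennreal_mult)
      also have "\<dots> \<le> ennreal (exp m) * (\<integral>\<^sup>+ t. ennreal (exp (- y x t)) * indicator {p..q} t \<partial>lborel)"
        using pq by (intro mult_left_mono Jensen_exp_interval[OF _ ym ynn y0 yint]) auto
      also have "\<dots> = (\<integral>\<^sup>+ t. ennreal (exp m) * (ennreal (exp (- y x t)) * indicator {p..q} t) \<partial>lborel)"
        by (rule nn_integral_cmult[symmetric]) measurable
      also have "\<dots> \<le> (\<integral>\<^sup>+ t. ennreal (insertion_kernel ?\<alpha> (\<beta> n) N x t) * indicator {p..q} t \<partial>lborel)"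
      proof (rule nn_integral_mono_AE)
        have "AE t in lborel. t \<notin> x ` {..<N}"
          by (intro AE_not_in countable_imp_null_set_lborel) auto
        then show "AE t in lborel. ennreal (exp m) * (ennreal (exp (- y x t)) * indicator {p..q} t)
            \<le> ennreal (insertion_kernel ?\<alpha> (\<beta> n) N x t) * indicator {p..q} t"
        proof eventually_elim
          case (elim t)
          show ?case
          proof (cases "t \<in> {p..q}")
            case True
            have "ennreal (exp m) * ennreal (exp (- y x t)) = ennreal (exp m * exp (- y x t))" by (simp add: ennreal_mult)
            also have "\<dots> \<le> ennreal (insertion_kernel ?\<alpha> (\<beta> n) N x t)" by (intro ennreal_leI ker x True elim)
            finally show ?thesis using True by simp
          qed simp
        qed
      qed
      finally show ?thesis .
    qed
    have "exp (a * (- 1 / 2 - excess q - \<kappa>)) \<le> exp m * ((q - p) * exp (- y0)) * (1 / 2)"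
    proof -
      have "ln (2 / (q - p)) \<le> a * e" using elim(5) e by (simp add: a_def pos_divide_le_eq)
      then have "exp (ln (2 / (q - p))) \<le> exp (a * e)" by (subst exp_le_cancel_iff)
      then have "exp (- (a * e)) \<le> (q - p) / 2" using pq by (simp add: exp_minus field_simps)
      then have "exp m * exp (- y0) * exp (- (a * e)) \<le> exp m * exp (- y0) * ((q - p) / 2)"
        by (rule mult_left_mono) simp
      moreover have "exp (a * (- 1 / 2 - excess q - \<kappa>)) \<le> exp m * exp (- y0) * exp (- (a * e))"
        unfolding exp_add[symmetric] exp_le_cancel_iff using a e k
        by (simp add: m_def y0_def e_def algebra_simps)
      moreover have "exp m * exp (- y0) * ((q - p) / 2) = exp m * ((q - p) * exp (- y0)) * (1 / 2)" by simp
      ultimately show ?thesis by linarith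
    qed
    then have "ennreal (exp (a * (- 1 / 2 - excess q - \<kappa>))) \<le> ennreal (exp m * ((q - p) * exp (- y0)) * (1 / 2))"
      by (rule ennreal_leI)
    also have "\<dots> = ennreal (exp m * ((q - p) * exp (- y0))) * ennreal (1 / 2)"
      using pq by (intro ennreal_mult) auto
    also have "\<dots> \<le> ennreal (exp m * ((q - p) * exp (- y0))) * emeasure ?M G"
      by (intro mult_left_mono PG) auto
    also have "\<dots> = (\<integral>\<^sup>+ x. ennreal (exp m * ((q - p) * exp (- y0))) * indicator G x \<partial>?M)"
      using G(1) by (subst nn_integral_cmult_indicator) (auto simp: sets_gbe)
    also have "\<dots> \<le> insertion_mass N ?\<alpha> (\<beta> n) {p..q}"
      unfolding insertion_mass_def using inner by (intro nn_integral_mono) (auto simp: indicator_def)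
    finally show ?case by (simp add: N_def a_def)
  qed
qed

end

section \<open>Exchangeability and the largest coordinate\<close>

text \<open>
  Uniqueness of the product measure, tested on boxes.
\<close>

lemma nn_integral_lebn_permute:
  assumes pi: "\<pi> permutes {..<N}" and f: "f \<in> borel_measurable (lebn N)"
  shows "(\<integral>\<^sup>+ x. f (\<lambda>i\<in>{..<N}. x (\<pi> i)) \<partial>lebn N) = (\<integral>\<^sup>+ x. f x \<partial>lebn N)"
proof -
  let ?T = "\<lambda>x::nat \<Rightarrow> real. \<lambda>i\<in>{..<N}. x (\<pi> i)"
  have piN: "\<pi> i < N \<longleftrightarrow> i < N" for i using permutes_in_image[OF pi, of i] by simp
  have T: "?T \<in> lebn N \<rightarrow>\<^sub>M lebn N"
    by (rule measurable_restrict) (auto intro: measurable_coordinate simp: piN)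
  have "distr (lebn N) (lebn N) ?T = lebn N"
  proof (rule lebn.PiM_eqI)
    fix A :: "nat \<Rightarrow> real set" assume A: "\<And>i. i \<in> {..<N} \<Longrightarrow> A i \<in> sets lborel"
    let ?B = "\<lambda>i. A (inv \<pi> i)"
    have inv: "inv \<pi> permutes {..<N}" by (rule permutes_inv[OF pi])
    have invN: "inv \<pi> i < N \<longleftrightarrow> i < N" for i using permutes_in_image[OF inv, of i] by simp
    have vimage: "?T -` Pi\<^sub>E {..<N} A \<inter> space (lebn N) = Pi\<^sub>E {..<N} ?B"
    proof (intro set_eqI iffI)
      fix x assume x: "x \<in> ?T -` Pi\<^sub>E {..<N} A \<inter> space (lebn N)"
      have "x i \<in> ?B i" if "i < N" for i
      proof -
        have "?T x (inv \<pi> i) \<in> A (inv \<pi> i)" using x invN that by (auto simp: PiE_iff)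
        then show ?thesis using that invN permutes_inverses(1)[OF pi] by simp
      qed
      then show "x \<in> Pi\<^sub>E {..<N} ?B" using x by (auto simp: space_PiM PiE_iff)
    next
      fix x assume x: "x \<in> Pi\<^sub>E {..<N} ?B"
      have "x (\<pi> i) \<in> A i" if "i < N" for i
      proof -
        have "x (\<pi> i) \<in> ?B (\<pi> i)" using x that piN by (auto simp: PiE_iff)
        then show ?thesis using permutes_inverses(2)[OF pi] by simp
      qed
      then show "x \<in> ?T -` Pi\<^sub>E {..<N} A \<inter> space (lebn N)"
        using x by (auto simp: space_PiM PiE_iff)
    qed
    have "emeasure (distr (lebn N) (lebn N) ?T) (Pi\<^sub>E {..<N} A) = emeasure (lebn N) (Pi\<^sub>E {..<N} ?B)"
      using A by (subst emeasure_distr[OF T]) (auto simp: vimage intro!: sets_PiM_I_finite)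
    also have "\<dots> = (\<Prod>i<N. emeasure lborel (?B i))"
      using A invN by (intro lebn.emeasure_PiM) auto
    also have "\<dots> = (\<Prod>i<N. emeasure lborel (A i))"
      using prod.permute[OF inv, of "\<lambda>i. emeasure lborel (A i)"] by (simp add: o_def)
    finally show "emeasure (distr (lebn N) (lebn N) ?T) (Pi\<^sub>E {..<N} A) = (\<Prod>i\<in>{..<N}. emeasure lborel (A i))" .
  qed auto
  then have "(\<integral>\<^sup>+ x. f x \<partial>lebn N) = (\<integral>\<^sup>+ x. f x \<partial>distr (lebn N) (lebn N) ?T)" by simp
  also have "\<dots> = (\<integral>\<^sup>+ x. f (?T x) \<partial>lebn N)" by (rule nn_integral_distr[OF T]) (use f in simp)
  finally show ?thesis by simp
qed

text \<open>
  The right-hand side is visibly invariant under permutations, which the product over ordered pairs is not.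
\<close>

lemma symmetric_double_prod:
  fixes g :: "nat \<Rightarrow> nat \<Rightarrow> real"
  assumes "\<And>i j. g i j = g j i"
  shows "(\<Prod>j<N. \<Prod>i<j. g i j)\<^sup>2 = (\<Prod>i<N. \<Prod>j\<in>{..<N} - {i}. g i j)"
proof (induction N)
  case (Suc N)
  have "(\<Prod>j\<in>{..<Suc N} - {i}. g i j) = (\<Prod>j\<in>{..<N} - {i}. g i j) * g i N" if "i < N" for i
  proof -
    have "{..<Suc N} - {i} = insert N ({..<N} - {i})" using that by auto
    then show ?thesis by simp
  qed
  moreover have "{..<Suc N} - {N} = {..<N}" by auto
  ultimately have "(\<Prod>i<Suc N. \<Prod>j\<in>{..<Suc N} - {i}. g i j)
      = (\<Prod>i<N. (\<Prod>j\<in>{..<N} - {i}. g i j) * g i N) * (\<Prod>j<N. g N j)"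
    by simp
  also have "\<dots> = (\<Prod>i<N. \<Prod>j\<in>{..<N} - {i}. g i j) * (\<Prod>i<N. g i N) * (\<Prod>i<N. g i N)"
    using assms[of N] by (simp add: prod.distrib)
  finally show ?case using Suc by (simp add: power2_eq_square mult_ac)
qed simp

lemma gbe_weight_permute:
  assumes pi: "\<pi> permutes {..<N}"
  shows "gbe_weight N \<alpha> \<beta> (\<lambda>i\<in>{..<N}. x (\<pi> i)) = gbe_weight N \<alpha> \<beta> x"
proof -
  let ?g = "\<lambda>x i j. \<bar>x i - x j\<bar> powr \<beta>"
  let ?y = "\<lambda>i. x (\<pi> i)"
  have "(\<Prod>j<N. \<Prod>i<j. ?g ?y i j)\<^sup>2 = (\<Prod>i<N. \<Prod>j\<in>{..<N} - {i}. ?g x (\<pi> i) (\<pi> j))"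
    by (subst symmetric_double_prod) (simp_all add: abs_minus_commute)
  also have "\<dots> = (\<Prod>i<N. \<Prod>j\<in>{..<N} - {\<pi> i}. ?g x (\<pi> i) j)"
  proof (rule prod.cong[OF refl])
    fix i assume "i \<in> {..<N}"
    have "bij_betw \<pi> ({..<N} - {i}) ({..<N} - {\<pi> i})"
      using permutes_image[OF pi] permutes_inj[OF pi] \<open>i \<in> {..<N}\<close>
      by (auto simp: bij_betw_def inj_on_def inj_def image_set_diff)
    then show "(\<Prod>j\<in>{..<N} - {i}. ?g x (\<pi> i) (\<pi> j)) = (\<Prod>j\<in>{..<N} - {\<pi> i}. ?g x (\<pi> i) j)"
      by (rule prod.reindex_bij_betw)
  qed
  also have "\<dots> = (\<Prod>i<N. \<Prod>j\<in>{..<N} - {i}. ?g x i j)"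
    using prod.permute[OF pi, of "\<lambda>i. \<Prod>j\<in>{..<N} - {i}. ?g x i j"] by (simp add: o_def)
  also have "\<dots> = (\<Prod>j<N. \<Prod>i<j. ?g x i j)\<^sup>2"
    by (subst symmetric_double_prod) (simp_all add: abs_minus_commute)
  finally have "(\<Prod>j<N. \<Prod>i<j. ?g ?y i j) = (\<Prod>j<N. \<Prod>i<j. ?g x i j)"
    by (subst (asm) power2_eq_iff_nonneg) (auto intro!: prod_nonneg)
  moreover have "(\<Sum>i<N. (?y i)\<^sup>2) = (\<Sum>i<N. (x i)\<^sup>2)"
    using sum.permute[OF pi, of "\<lambda>i. (x i)\<^sup>2"] by (simp add: o_def)
  moreover have "gbe_weight N \<alpha> \<beta> (\<lambda>i\<in>{..<N}. ?y i) = gbe_weight N \<alpha> \<beta> ?y"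
    unfolding gbe_weight_def by (intro arg_cong2[where f = "(*)"] arg_cong[where f = exp] sum.cong prod.cong refl) auto
  ultimately show ?thesis by (simp add: gbe_weight_def)
qed

lemma emeasure_gbe_coordinate:
  assumes ab: "\<alpha> > 0" "\<beta> > 0" and [measurable]: "A \<in> sets borel" and i: "i < N" "j < N"
  shows "emeasure (gbe N \<alpha> \<beta>) {x \<in> space (lebn N). x i \<in> A} = emeasure (gbe N \<alpha> \<beta>) {x \<in> space (lebn N). x j \<in> A}"
proof -
  have eq: "emeasure (gbe N \<alpha> \<beta>) {x \<in> space (lebn N). x k \<in> A}
      = (\<integral>\<^sup>+ x. ennreal (gbe_weight N \<alpha> \<beta> x) * indicator A (x k) \<partial>lebn N) / gbe_mass N \<alpha> \<beta>" if "k < N" for k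
  proof -
    let ?E = "{x \<in> space (lebn N). x k \<in> A}"
    have [measurable]: "(\<lambda>x. x k) \<in> borel_measurable (lebn N)" using that by (rule measurable_coordinate)
    have [measurable]: "?E \<in> sets (lebn N)" by measurable
    have "emeasure (gbe N \<alpha> \<beta>) ?E = (\<integral>\<^sup>+ x. indicator ?E x \<partial>gbe N \<alpha> \<beta>)"
      by (simp add: sets_gbe)
    also have "\<dots> = (\<integral>\<^sup>+ x. ennreal (gbe_weight N \<alpha> \<beta> x) * indicator A (x k) \<partial>lebn N) / gbe_mass N \<alpha> \<beta>"
      by (subst nn_integral_gbe[OF ab]) (auto intro!: arg_cong2[where f = "(/)"] nn_integral_cong simp: indicator_def)
    finally show ?thesis .
  qed
  let ?pi = "Transposition.transpose i j"
  have pi: "?pi permutes {..<N}" using i by (intro permutes_swap_id) auto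
  have [measurable]: "(\<lambda>x. x i) \<in> borel_measurable (lebn N)" using i by (intro measurable_coordinate)
  have "(\<integral>\<^sup>+ x. ennreal (gbe_weight N \<alpha> \<beta> x) * indicator A (x i) \<partial>lebn N)
     = (\<integral>\<^sup>+ x. ennreal (gbe_weight N \<alpha> \<beta> (\<lambda>k\<in>{..<N}. x (?pi k))) * indicator A ((\<lambda>k\<in>{..<N}. x (?pi k)) i) \<partial>lebn N)"
    by (rule nn_integral_lebn_permute[OF pi, symmetric]) measurable
  also have "\<dots> = (\<integral>\<^sup>+ x. ennreal (gbe_weight N \<alpha> \<beta> x) * indicator A (x j) \<partial>lebn N)"
    using i by (simp add: gbe_weight_permute[OF pi])
  finally show ?thesis using i by (simp add: eq)
qed

lemma lambda_max_measurable:
  assumes "N > 0" shows "lambda_max N \<in> borel_measurable (lebn N)"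
  unfolding lambda_max_def[abs_def] using measurable_coordinate
  by (intro borel_measurable_Max) auto

lemma lambda_max_ge_iff: "N > 0 \<Longrightarrow> c \<le> lambda_max N x \<longleftrightarrow> (\<exists>i<N. c \<le> x i)"
  unfolding lambda_max_def by (subst Max_ge_iff) auto

lemma lambda_max_le_iff: "N > 0 \<Longrightarrow> lambda_max N x \<le> c \<longleftrightarrow> (\<forall>i<N. x i \<le> c)"
  unfolding lambda_max_def by (subst Max_le_iff) auto

text \<open>
  Union bound over the coordinates, all of which have the same law as the last one.
\<close>

lemma emeasure_lambda_max_ge:
  assumes ab: "\<alpha> > 0" "\<beta> > 0" and N: "N > 0"
  shows "emeasure (gbe N \<alpha> \<beta>) {x \<in> space (lebn N). c \<le> lambda_max N x}
     \<le> ennreal (real N) * (insertion_mass (N - 1) \<alpha> \<beta> {c..} / insertion_mass (N - 1) \<alpha> \<beta> UNIV)"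
    "insertion_mass (N - 1) \<alpha> \<beta> {c..} / insertion_mass (N - 1) \<alpha> \<beta> UNIV
     \<le> emeasure (gbe N \<alpha> \<beta>) {x \<in> space (lebn N). c \<le> lambda_max N x}"
proof -
  let ?M = "gbe N \<alpha> \<beta>"
  let ?E = "\<lambda>i. {x \<in> space (lebn N). x i \<in> {c..}}"
  have last: "emeasure ?M (?E (N - 1)) = insertion_mass (N - 1) \<alpha> \<beta> {c..} / insertion_mass (N - 1) \<alpha> \<beta> UNIV"
    using emeasure_gbe_last[OF ab, of "{c..}" "N - 1"] N by (simp add: space_gbe)
  have Em: "?E i \<in> sets ?M" if "i < N" for i
  proof -
    have [measurable]: "(\<lambda>x. x i) \<in> borel_measurable (lebn N)" using that by (rule measurable_coordinate)
    show ?thesis unfolding sets_gbe by measurable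
  qed
  have eq: "{x \<in> space (lebn N). c \<le> lambda_max N x} = (\<Union>i\<in>{..<N}. ?E i)"
    using N by (auto simp: lambda_max_ge_iff)
  have "emeasure ?M (\<Union>i\<in>{..<N}. ?E i) \<le> (\<Sum>i<N. emeasure ?M (?E i))"
    using Em by (intro emeasure_subadditive_finite) auto
  also have "\<dots> = (\<Sum>i<N. emeasure ?M (?E (N - 1)))"
    using N by (intro sum.cong refl emeasure_gbe_coordinate ab) auto
  finally show "emeasure ?M {x \<in> space (lebn N). c \<le> lambda_max N x}
     \<le> ennreal (real N) * (insertion_mass (N - 1) \<alpha> \<beta> {c..} / insertion_mass (N - 1) \<alpha> \<beta> UNIV)"
    unfolding eq last by (simp add: ennreal_of_nat_eq_real_of_nat)
  have "(\<Union>i\<in>{..<N}. ?E i) \<in> sets ?M" using Em by (intro sets.finite_UN) auto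
  then have "emeasure ?M (?E (N - 1)) \<le> emeasure ?M (\<Union>i\<in>{..<N}. ?E i)"
    using N by (intro emeasure_mono UN_upper) auto
  then show "insertion_mass (N - 1) \<alpha> \<beta> {c..} / insertion_mass (N - 1) \<alpha> \<beta> UNIV
     \<le> emeasure ?M {x \<in> space (lebn N). c \<le> lambda_max N x}"
    unfolding eq last .
qed

lemma insertion_mass_mono: "A \<subseteq> B \<Longrightarrow> insertion_mass N \<alpha> \<beta> A \<le> insertion_mass N \<alpha> \<beta> B"
  unfolding insertion_mass_def by (intro nn_integral_mono mult_left_mono) (auto simp: indicator_def)

lemma excess_right_continuous:
  assumes "x \<ge> 2" "e > 0"
  obtains d where "d > 0" "\<And>y. x \<le> y \<Longrightarrow> y < x + d \<Longrightarrow> excess y < excess x + e"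
proof -
  obtain d where d: "d > 0" "\<And>y. y \<in> {2..} \<Longrightarrow> dist y x < d \<Longrightarrow> dist (excess y) (excess x) < e"
    using continuous_on_excess assms unfolding continuous_on_iff by (metis atLeast_iff)
  show thesis
  proof (rule that[OF d(1)])
    fix y assume "x \<le> y" "y < x + d"
    then show "excess y < excess x + e" using d(2)[of y] assms by (auto simp: dist_real_def)
  qed
qed

text \<open>
  For real \<open>s\<close> one has \<open>s\<^sup>2 - E * s + 1 = (s - E / 2)\<^sup>2 + (1 - E\<^sup>2 / 4)\<close>. If no particle exceeds \<open>c < E\<close>, then the resolvent mean
  at \<open>E + \<i> * h\<close> has imaginary part at most \<open>h / (E - c)\<^sup>2\<close> in modulus, so it is nearly real for small \<open>h\<close>.
\<close>

lemma defect_below_edge: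
  assumes E: "0 \<le> E" "E < 2" and c: "c < E"
  obtains h where "h > 0" "\<And>N x. N > 0 \<Longrightarrow> (\<forall>i<N. x i \<le> c) \<Longrightarrow> cmod (resolvent_defect N x (Complex E h)) > (1 - E\<^sup>2 / 4) / 2"
proof -
  define k where "k = 1 - E\<^sup>2 / 4"
  have k: "k > 0" using power_strict_mono[of E 2 2] E by (simp add: k_def)
  define r where "r = E - c"
  have r: "r > 0" using c by (simp add: r_def)
  define D where "D = 1 / r ^ 4 + 1 / r\<^sup>2"
  have D: "D > 0" using r by (simp add: D_def add_pos_pos)
  define h where "h = min 1 (k / (4 * D))"
  have h: "h > 0" "h \<le> 1" using k D by (auto simp: h_def)
  have "h * D \<le> k / (4 * D) * D" using D by (intro mult_right_mono) (auto simp: h_def)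
  then have hD: "h * D \<le> k / 4" using D by simp
  show thesis
  proof (rule that[OF h(1)])
    fix N :: nat and x :: "nat \<Rightarrow> real" assume N: "N > 0" and x: "\<forall>i<N. x i \<le> c"
    let ?z = "Complex E h"
    define s where "s = resolvent_mean N x ?z"
    have "- Im s = (\<Sum>i<N. h / (cmod (?z - complex_of_real (x i)))\<^sup>2) / real N"
      by (simp add: s_def resolvent_mean_def Im_divide_of_nat Im_inverse_resolvent sum_negf)
    also have "\<dots> \<le> (\<Sum>i<N. h / r\<^sup>2) / real N"
    proof (intro divide_right_mono sum_mono divide_left_mono power_mono mult_pos_pos zero_less_power)
      fix i assume "i \<in> {..<N}"
      then have "r \<le> E - x i" using x by (simp add: r_def)
      also have "\<dots> \<le> cmod (?z - complex_of_real (x i))" using complex_Re_le_cmod[of "?z - complex_of_real (x i)"] by simp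
      finally show rl: "r \<le> cmod (?z - complex_of_real (x i))" .
      then show "0 < cmod (?z - complex_of_real (x i))" using r by linarith
    qed (use h r in auto)
    also have "\<dots> = h / r\<^sup>2" using N by simp
    finally have im: "- Im s \<le> h / r\<^sup>2" .
    have im0: "Im s \<le> 0" unfolding s_def using h by (intro Im_resolvent_mean_nonpos) simp
    have "(Im s)\<^sup>2 \<le> (h / r\<^sup>2)\<^sup>2" using power_mono[OF im, of 2] im0 by simp
    also have "\<dots> = h * h * (1 / r ^ 4)" using r by (simp add: power2_eq_square eval_nat_numeral)
    also have "\<dots> \<le> h * 1 * (1 / r ^ 4)" using h r by (intro mult_right_mono mult_left_mono) auto
    finally have a: "(Im s)\<^sup>2 \<le> h * (1 / r ^ 4)" by simp
    have "h * - Im s \<le> h * (h / r\<^sup>2)" using h by (intro mult_left_mono im) auto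
    also have "\<dots> \<le> h * (1 / r\<^sup>2)" using h r by (intro mult_left_mono divide_right_mono) auto
    finally have b: "h * - Im s \<le> h * (1 / r\<^sup>2)" .
    have "Re (resolvent_defect N x ?z) = (Re s)\<^sup>2 - (Im s)\<^sup>2 - (E * Re s - h * Im s) + 1"
      by (simp add: resolvent_defect_def s_def[symmetric] Re_power2)
    also have "\<dots> = (Re s - E / 2)\<^sup>2 + k - (Im s)\<^sup>2 - h * - Im s"
      by (simp add: k_def power2_eq_square algebra_simps)
    also have "\<dots> \<ge> k - h * D" 
      using a b zero_le_power2[of "Re s - E / 2"] unfolding D_def distrib_left by linarith
    finally have "Re (resolvent_defect N x ?z) > k / 2" using hD k by linarith
    then show "cmod (resolvent_defect N x ?z) > (1 - E\<^sup>2 / 4) / 2"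
      using complex_Re_le_cmod[of "resolvent_defect N x ?z"] by (simp add: k_def)
  qed
qed

lemma ennreal_divide_le_exp:
  assumes "X \<le> ennreal (exp u)" "ennreal (exp v) \<le> Y"
  shows "X / Y \<le> ennreal (exp (u - v))"
proof (rule divide_le_posI_ennreal)
  have "0 < ennreal (exp v)" by simp
  then show "0 < Y" using assms(2) by (rule less_le_trans)
  have "X \<le> ennreal (exp v) * ennreal (exp (u - v))"
    using assms(1) by (simp add: exp_add[symmetric] flip: ennreal_mult'')
  also have "\<dots> \<le> Y * ennreal (exp (u - v))" using assms(2) by (rule mult_right_mono) simp
  finally show "X \<le> Y * ennreal (exp (u - v))" .
qed

lemma ennreal_divide_ge_exp:
  assumes "ennreal (exp u) \<le> X" "Y \<le> ennreal (exp v)"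
  shows "ennreal (exp (u - v)) \<le> X / Y"
proof (cases "Y = 0")
  case True
  have "X \<noteq> 0" using assms(1) by (auto simp: ennreal_eq_0_iff not_le)
  then show ?thesis using True by simp
next
  case False
  have "Y \<noteq> top" using assms(2) by (auto simp: top_unique)
  then have "ennreal (exp (u - v)) = ennreal (exp (u - v)) * Y / Y"
    using False by (simp add: mult_divide_eq_ennreal)
  also have "\<dots> \<le> ennreal (exp (u - v)) * ennreal (exp v) / Y"
    using assms(2) by (intro divide_right_mono_ennreal mult_left_mono) auto
  also have "ennreal (exp (u - v)) * ennreal (exp v) = ennreal (exp u)"
    by (simp add: exp_add[symmetric] flip: ennreal_mult'')
  also have "ennreal (exp u) / Y \<le> X / Y" using assms(1) by (rule divide_right_mono_ennreal)
  finally show ?thesis .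
qed

section \<open>Tails of the largest coordinate\<close>

context beta_regime
begin

definition prob_max :: "nat \<Rightarrow> real set \<Rightarrow> real"
  where "prob_max n F = measure (ens n n) {x \<in> space (ens n n). lambda_max n x \<in> F}"

lemma prob_space_ens: "n \<ge> 1 \<Longrightarrow> prob_space (ens n N)"
  using beta_pos[of n] by (intro prob_space_gbe) auto

lemma prob_max_sets:
  assumes "n \<ge> 1" "F \<in> sets borel"
  shows "{x \<in> space (ens n n). lambda_max n x \<in> F} \<in> sets (ens n n)"
proof -
  have [measurable]: "lambda_max n \<in> borel_measurable (ens n n)"
    using lambda_max_measurable[of n] assms(1) by (simp add: measurable_cong_sets[OF sets_gbe refl])
  show ?thesis using assms(2) by measurable
qed

lemma emeasure_prob_max:
  assumes "n \<ge> 1"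
  shows "emeasure (ens n n) {x \<in> space (lebn n). lambda_max n x \<in> F} = ennreal (prob_max n F)"
proof -
  interpret prob_space "ens n n" by (rule prob_space_ens[OF assms])
  show ?thesis by (simp add: prob_max_def emeasure_eq_measure space_gbe)
qed

lemma prob_max_nonneg: "prob_max n F \<ge> 0"
  by (simp add: prob_max_def)

lemma prob_max_le_1: "n \<ge> 1 \<Longrightarrow> prob_max n F \<le> 1"
  using prob_space.prob_le_1[OF prob_space_ens] by (simp add: prob_max_def)

lemma prob_max_mono: "n \<ge> 1 \<Longrightarrow> F \<subseteq> F' \<Longrightarrow> F' \<in> sets borel \<Longrightarrow> prob_max n F \<le> prob_max n F'"
  unfolding prob_max_def using prob_max_sets[of n F']
  by (intro finite_measure.finite_measure_mono prob_space.finite_measure prob_space_ens) auto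

lemma prob_max_Un: "n \<ge> 1 \<Longrightarrow> F \<in> sets borel \<Longrightarrow> F' \<in> sets borel \<Longrightarrow> prob_max n (F \<union> F') \<le> prob_max n F + prob_max n F'"
proof -
  assume *: "n \<ge> 1" "F \<in> sets borel" "F' \<in> sets borel"
  interpret prob_space "ens n n" by (rule prob_space_ens[OF *(1)])
  have "{x \<in> space (ens n n). lambda_max n x \<in> F \<union> F'}
    = {x \<in> space (ens n n). lambda_max n x \<in> F} \<union> {x \<in> space (ens n n). lambda_max n x \<in> F'}" by auto
  then show ?thesis
    unfolding prob_max_def using * by (simp only:) (intro measure_Un_le prob_max_sets)
qed

lemma insertion_mass_UNIV_upper:
  assumes "\<kappa> > 0"
  shows "\<forall>\<^sub>F n in sequentially. insertion_mass (n - 1) (real n * \<beta> n / 2) (\<beta> n) UNIV \<le> ennreal (exp (speed n * (- 1 / 2 + \<kappa>)))"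
proof (rule insertion_mass_upper)
  fix k :: real assume "k > 0"
  then show "\<exists>h>0. \<forall>t\<in>UNIV. plane_potential (Complex t h) - t\<^sup>2 / 4 \<le> - 1 / 2 + k"
  proof (intro exI[of _ "k / 2"] conjI ballI)
    fix t
    show "plane_potential (Complex t (k / 2)) - t\<^sup>2 / 4 \<le> - 1 / 2 + k"
      using plane_potential_le[of "k / 2" t] \<open>k > 0\<close> by simp
  qed simp
qed (use assms in auto)

text \<open>
  A short interval just to the right of the edge \<open>2\<close> already carries the full exponential rate.
\<close>

lemma insertion_mass_UNIV_lower:
  assumes k: "\<kappa> > 0"
  shows "\<forall>\<^sub>F n in sequentially. ennreal (exp (speed n * (- 1 / 2 - \<kappa>))) \<le> insertion_mass (n - 1) (real n * \<beta> n / 2) (\<beta> n) UNIV"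
proof -
  obtain d where d: "d > 0" "\<And>y. 2 \<le> y \<Longrightarrow> y < 2 + d \<Longrightarrow> excess y < excess 2 + \<kappa> / 2"
    using excess_right_continuous[of 2 "\<kappa> / 2"] k by auto
  define q where "q = 2 + d / 2"
  have q: "2 < 2 + d / 4" "2 + d / 4 < q" "excess q < \<kappa> / 2" using d by (auto simp: q_def excess_2)
  have k2: "\<kappa> / 2 > 0" using k by simp
  show ?thesis
    using insertion_mass_lower[OF q(1,2) k2] real_ge[of 1]
  proof eventually_elim
    case (elim n)
    have "speed n \<ge> 0" using beta_pos[of n] elim(2) by (simp add: speed_def)
    then have "speed n * (- 1 / 2 - \<kappa>) \<le> speed n * (- 1 / 2 - excess q - \<kappa> / 2)"
      using q(3) by (intro mult_left_mono) auto
    then have "ennreal (exp (speed n * (- 1 / 2 - \<kappa>))) \<le> ennreal (exp (speed n * (- 1 / 2 - excess q - \<kappa> / 2)))"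
      by (intro ennreal_leI) simp
    also note elim(1)
    also have "insertion_mass (n - 1) (real n * \<beta> n / 2) (\<beta> n) {2 + d / 4..q} \<le> insertion_mass (n - 1) (real n * \<beta> n / 2) (\<beta> n) UNIV"
      by (rule insertion_mass_mono) simp
    finally show ?case .
  qed
qed

lemma insertion_mass_tail_upper:
  assumes x: "x > 2" and "\<kappa> > 0"
  shows "\<forall>\<^sub>F n in sequentially. insertion_mass (n - 1) (real n * \<beta> n / 2) (\<beta> n) {x..}
    \<le> ennreal (exp (speed n * ((- 1 / 2 - excess x) + \<kappa>)))"
proof (rule insertion_mass_upper)
  fix k :: real assume k: "k > 0"
  define c where "c = 2 * (outer_root_real x / (outer_root_real x - 1))"
  have "outer_root_real x > 1" using outer_root_real_strict_mono[of 2 x] x by (simp add: outer_root_real_def)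
  then have c: "c > 0" by (simp add: c_def)
  have h: "k / c > 0" using k c by simp
  show "\<exists>h>0. \<forall>t\<in>{x..}. plane_potential (Complex t h) - t\<^sup>2 / 4 \<le> - 1 / 2 - excess x + k"
  proof (intro exI[of _ "k / c"] conjI ballI h)
    fix t assume "t \<in> {x..}"
    then have t: "t \<ge> x" by simp
    have "2 * (k / c) * (outer_root_real x / (outer_root_real x - 1)) = (k / c) * c" by (simp add: c_def)
    also have "\<dots> = k" using c by simp
    finally have "plane_potential (Complex t (k / c)) \<le> line_potential t + k"
      using plane_potential_near_line[OF h t x] by (simp add: abs_le_iff)
    moreover have "excess x \<le> excess t" using t x by (intro excess_mono) auto
    ultimately show "plane_potential (Complex t (k / c)) - t\<^sup>2 / 4 \<le> - 1 / 2 - excess x + k"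
      unfolding excess_def by linarith
  qed
qed (use assms in auto)

lemma prob_max_right_upper:
  assumes x: "x > 2" and k: "\<kappa> > 0"
  shows "\<forall>\<^sub>F n in sequentially. prob_max n {x..} \<le> exp (speed n * (- excess x + \<kappa>))"
proof -
  define e where "e = \<kappa> / 3"
  have e: "e > 0" using k by (simp add: e_def)
  have "\<forall>\<^sub>F n in sequentially. ln (real n) / (real n * \<beta> n) < e"
    by (rule order_tendstoD(2)[OF ln_negligible e])
  then show ?thesis
    using insertion_mass_tail_upper[OF x e] insertion_mass_UNIV_lower[OF e] real_ge[of 1]
  proof eventually_elim
    case (elim n)
    have n: "n \<ge> 1" "n > 0" using elim by auto
    have b: "\<beta> n > 0" using beta_pos n by simp
    have s: "speed n > 0" using b n by (simp add: speed_def)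
    have ln: "ln (real n) \<le> speed n * e" using elim(1) s by (simp add: speed_def pos_divide_less_eq mult.commute)
    have "ennreal (prob_max n {x..}) = emeasure (ens n n) {y \<in> space (lebn n). x \<le> lambda_max n y}"
      using emeasure_prob_max[OF n(1), of "{x..}"] by simp
    also have "\<dots> \<le> ennreal (real n) * (insertion_mass (n - 1) (real n * \<beta> n / 2) (\<beta> n) {x..} / insertion_mass (n - 1) (real n * \<beta> n / 2) (\<beta> n) UNIV)"
      using b n by (intro emeasure_lambda_max_ge) auto
    also have "\<dots> \<le> ennreal (real n) * ennreal (exp (speed n * ((- 1 / 2 - excess x) + e) - speed n * (- 1 / 2 - e)))"
      by (intro mult_left_mono ennreal_divide_le_exp elim) auto
    also have "\<dots> = ennreal (exp (ln (real n)) * exp (speed n * ((- 1 / 2 - excess x) + e) - speed n * (- 1 / 2 - e)))"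
      using n by (simp add: ennreal_mult)
    also have "\<dots> \<le> ennreal (exp (speed n * (- excess x + \<kappa>)))"
      unfolding exp_add[symmetric] using ln by (intro ennreal_leI) (simp add: e_def algebra_simps)
    finally show ?case by (simp add: ennreal_le_iff)
  qed
qed

lemma prob_max_right_lower:
  assumes p: "2 < p" "p < q" and k: "\<kappa> > 0"
  shows "\<forall>\<^sub>F n in sequentially. exp (speed n * (- excess q - \<kappa>)) \<le> prob_max n {p..}"
proof -
  have k2: "\<kappa> / 2 > 0" using k by simp
  show ?thesis
    using insertion_mass_lower[OF p k2] insertion_mass_UNIV_upper[OF k2] real_ge[of 1]
  proof eventually_elim
    case (elim n)
    have n: "n \<ge> 1" "n > 0" using elim by auto
    have b: "\<beta> n > 0" using beta_pos n by simp
    have "insertion_mass (n - 1) (real n * \<beta> n / 2) (\<beta> n) {p..q} \<le> insertion_mass (n - 1) (real n * \<beta> n / 2) (\<beta> n) {p..}"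
      by (rule insertion_mass_mono) auto
    with elim(1) have le: "ennreal (exp (speed n * (- 1 / 2 - excess q - \<kappa> / 2))) \<le> insertion_mass (n - 1) (real n * \<beta> n / 2) (\<beta> n) {p..}"
      by (rule order_trans)
    have "exp (speed n * (- excess q - \<kappa>)) = exp (speed n * (- 1 / 2 - excess q - \<kappa> / 2) - speed n * (- 1 / 2 + \<kappa> / 2))"
      by (simp add: algebra_simps)
    then have "ennreal (exp (speed n * (- excess q - \<kappa>)))
       \<le> insertion_mass (n - 1) (real n * \<beta> n / 2) (\<beta> n) {p..} / insertion_mass (n - 1) (real n * \<beta> n / 2) (\<beta> n) UNIV"
      by (simp only: ennreal_divide_ge_exp[OF le elim(2)])
    also have "\<dots> \<le> emeasure (ens n n) {y \<in> space (lebn n). p \<le> lambda_max n y}"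
      using b n by (intro emeasure_lambda_max_ge) auto
    also have "\<dots> = ennreal (prob_max n {p..})"
      using emeasure_prob_max[OF n(1), of "{p..}"] by simp
    finally show ?case by (simp add: ennreal_le_iff prob_max_nonneg)
  qed
qed

text \<open>
  The tail at \<open>v\<close> is exponentially smaller than the tail just above \<open>u\<close>, because the excess is strictly increasing.
\<close>

lemma prob_max_interval_lower:
  assumes u: "2 < u" "u < v" and k: "\<kappa> > 0"
  shows "\<forall>\<^sub>F n in sequentially. exp (speed n * (- excess u - \<kappa>)) \<le> prob_max n {u<..<v}"
proof -
  obtain d where d: "d > 0" "\<And>y. u \<le> y \<Longrightarrow> y < u + d \<Longrightarrow> excess y < excess u + \<kappa> / 2"
    using excess_right_continuous[of u "\<kappa> / 2"] u k by auto
  define m where "m = min (d / 2) ((v - u) / 2)"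
  define q where "q = u + m"
  define p where "p = (u + q) / 2"
  have "0 < m" using d(1) u by (simp add: m_def)
  moreover have "m \<le> d / 2" unfolding m_def by (rule min.cobounded1)
  moreover have "m \<le> (v - u) / 2" unfolding m_def by (rule min.cobounded2)
  ultimately have "u < q" "q \<le> u + d / 2" "q \<le> u + (v - u) / 2" unfolding q_def by linarith+
  then have q: "u < q" "q < u + d" "q < v" using d(1) u by (simp_all add: field_simps)
  have p: "u < p" "2 < p" "p < q" using q u by (auto simp: p_def)
  have eq: "excess q < excess u + \<kappa> / 2" using d(2)[of q] q by simp
  define g where "g = excess v - excess q"
  have g: "g > 0" using excess_strict_mono[of q v] q u by (simp add: g_def)
  define e where "e = min (g / 4) (\<kappa> / 4)"
  have e: "e > 0" "e \<le> g / 4" "e \<le> \<kappa> / 4" using g k by (auto simp: e_def)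
  have v2: "2 < v" using u by simp
  show ?thesis
    using prob_max_right_lower[OF p(2,3) e(1)] prob_max_right_upper[OF v2 e(1)] real_ge[of 1]
      speed_ge[of "ln 2 / (\<kappa> / 4)"] speed_ge[of "ln 2 / (g / 4)"]
  proof eventually_elim
    case (elim n)
    define s where "s = speed n"
    have n: "n \<ge> 1" using elim by simp
    have s0: "s \<ge> 0" using beta_pos[OF n] by (simp add: s_def speed_def)
    have s1: "ln 2 \<le> s * (\<kappa> / 4)" using elim(4) k by (simp add: s_def pos_divide_le_eq)
    have s2: "ln 2 \<le> s * (g / 4)" using elim(5) g by (simp add: s_def pos_divide_le_eq)
    have half: "exp x \<le> exp y / 2" if "x + ln 2 \<le> y" for x y :: real
    proof -
      have "exp x * exp (ln 2) \<le> exp y" using that by (simp only: exp_add[symmetric] exp_le_cancel_iff)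
      then show ?thesis by simp
    qed
    have "{p..} \<subseteq> {u<..<v} \<union> {v..}" using p by auto
    then have "prob_max n {p..} \<le> prob_max n ({u<..<v} \<union> {v..})" by (intro prob_max_mono n) auto
    also have "\<dots> \<le> prob_max n {u<..<v} + prob_max n {v..}" by (intro prob_max_Un n) auto
    finally have "exp (s * (- excess q - e)) - exp (s * (- excess v + e)) \<le> prob_max n {u<..<v}"
      using elim(1,2) by (simp add: s_def)
    moreover have "exp (s * (- excess v + e)) \<le> exp (s * (- excess q - e)) / 2"
    proof (rule half)
      have "s * (- excess v + e) + s * (g / 4) = s * (- excess v + e + g / 4)" by (simp add: algebra_simps)
      also have "- excess v + e + g / 4 \<le> - excess q - e"
      proof -
        have "2 * e \<le> g / 2" "excess v = g + excess q" using e by (simp_all add: g_def)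
        then show ?thesis using g by linarith
      qed
      then have "s * (- excess v + e + g / 4) \<le> s * (- excess q - e)" using s0 by (rule mult_left_mono)
      finally show "s * (- excess v + e) + ln 2 \<le> s * (- excess q - e)" using s2 by linarith
    qed
    moreover have "exp (s * (- excess u - \<kappa>)) \<le> exp (s * (- excess q - e)) / 2"
    proof (rule half)
      have "s * (- excess u - \<kappa>) + s * (\<kappa> / 4) = s * (- excess u - \<kappa> + \<kappa> / 4)" by (simp add: algebra_simps)
      also have "\<dots> \<le> s * (- excess q - e)" using e s0 eq by (intro mult_left_mono) auto
      finally show "s * (- excess u - \<kappa>) + ln 2 \<le> s * (- excess q - e)" using s1 by linarith
    qed
    ultimately show ?case by (simp add: s_def)
  qed
qed

text \<open>
  The approximate equation would fail at a point above the gap, see \<open>defect_below_edge\<close>.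
\<close>

lemma prob_max_left:
  assumes c: "c < 2"
  shows "\<forall>\<^sub>F n in sequentially. prob_max n {..c} \<le> exp (- (M * speed n))"
proof -
  define E where "E = (max c 0 + 2) / 2"
  have E: "0 \<le> E" "E < 2" "c < E" using c by (auto simp: E_def)
  obtain h where h: "h > 0"
    "\<And>N x. N > 0 \<Longrightarrow> (\<forall>i<N. x i \<le> c) \<Longrightarrow> cmod (resolvent_defect N x (Complex E h)) > (1 - E\<^sup>2 / 4) / 2"
    using defect_below_edge[OF E] by blast
  have im: "Im (Complex E h) > 0" using h by simp
  have "E\<^sup>2 < 2\<^sup>2" using E by (intro power_strict_mono) auto
  then have d: "(1 - E\<^sup>2 / 4) / 2 > 0" by simp
  show ?thesis
    using resolvent_defect_superexponential[OF im d, of M] real_ge[of 1]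
  proof eventually_elim
    case (elim n)
    let ?E = "{x \<in> space (lebn n). cmod (resolvent_defect n x (Complex E h)) > (1 - E\<^sup>2 / 4) / 2}"
    have n: "n \<ge> 1" "n > 0" using elim by auto
    have Em: "?E \<in> sets (ens n n)"
    proof -
      note [measurable] = resolvent_defect_measurable
      show ?thesis unfolding sets_gbe by measurable
    qed
    have "ennreal (prob_max n {..c}) = emeasure (ens n n) {x \<in> space (lebn n). lambda_max n x \<in> {..c}}"
      by (rule emeasure_prob_max[OF n(1), symmetric])
    also have "\<dots> \<le> emeasure (ens n n) ?E"
      using h(2) n(2) Em by (intro emeasure_mono) (auto simp: lambda_max_le_iff)
    also have "\<dots> \<le> ennreal (exp (- (M * speed n)))" using elim(1) by simp
    finally show ?case by (simp add: ennreal_le_iff)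
  qed
qed

end

section \<open>The large deviations principle\<close>

lemma log_prob_le:
  assumes "0 \<le> p" "p \<le> exp (s * c)" "s > 0"
  shows "ereal (1 / s) * log_prob p \<le> ereal c"
proof (cases "p = 0")
  case False
  then have "p > 0" using assms by simp
  then have "ln p \<le> ln (exp (s * c))" using assms(2) by (subst ln_le_cancel_iff) auto
  then have "ln p \<le> s * c" by simp
  then have "1 / s * ln p \<le> c" using assms(3) by (simp add: field_simps)
  then show ?thesis using False by (simp add: log_prob_def)
qed (use assms in \<open>simp add: log_prob_def\<close>)

lemma log_prob_ge:
  assumes "exp (s * c) \<le> p" "s > 0"
  shows "ereal c \<le> ereal (1 / s) * log_prob p"
proof -
  have p: "p > 0" using assms(1) exp_gt_zero[of "s * c"] by linarith
  then have "s * c \<le> ln p" using assms(1) by (simp add: ln_ge_iff)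
  then have "c \<le> 1 / s * ln p" using assms(2) by (simp add: field_simps)
  then show ?thesis using p by (simp add: log_prob_def)
qed

lemma lower_semicontinuous_rate_J: "lower_semicontinuous rate_J"
  unfolding lower_semicontinuous_def
proof
  fix c
  show "closed {x. rate_J x \<le> c}"
  proof (cases c)
    case (real r)
    have "{x. rate_J x \<le> c} = {2..} \<inter> excess -` {..r}"
      using real by (auto simp: rate_J_eq)
    then show ?thesis using continuous_on_excess by (simp add: continuous_on_closed_vimage Int_commute)
  next
    case PInf
    then show ?thesis by simp
  next
    case MInf
    then have "{x. rate_J x \<le> c} = {}" by (auto simp: rate_J_eq)
    then show ?thesis by simp
  qed
qed

lemma closed_gap_below:
  fixes F :: "real set"
  assumes F: "closed F" and c: "c \<notin> F"
  obtains y where "y < c" "F \<inter> {..<c} \<subseteq> {..y}"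
proof -
  have "open (- F)" using F by (rule open_Compl)
  then obtain d where d: "d > 0" "ball c d \<subseteq> - F" using c openE[of "- F" c] by auto
  show thesis
  proof (rule that[of "c - d"])
    show "F \<inter> {..<c} \<subseteq> {..c - d}"
    proof
      fix z assume z: "z \<in> F \<inter> {..<c}"
      then have "z \<notin> ball c d" using d(2) by auto
      then show "z \<in> {..c - d}" using z by (auto simp: dist_real_def)
    qed
  qed (use d in simp)
qed

context beta_regime
begin

text \<open>
  Only the least point \<open>x \<ge> 2\<close> of \<open>F\<close> matters: the part of \<open>F\<close> below \<open>2\<close> is at positive distance from \<open>2\<close> unless
  \<open>x = 2\<close>, and in that case the trivial bound \<open>1\<close> for probabilities is enough.
\<close>

lemma limsup_log_prob_max:
  assumes F: "closed F"
  shows "limsup (\<lambda>n. ereal (1 / speed n) * log_prob (prob_max n F)) \<le> - (INF x\<in>F. rate_J x)"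
proof -
  let ?L = "limsup (\<lambda>n. ereal (1 / speed n) * log_prob (prob_max n F))"
  have Fb: "F \<in> sets borel" using F by simp
  have limsupI: "?L \<le> ereal c" if "\<forall>\<^sub>F n in sequentially. prob_max n F \<le> exp (speed n * c)" for c
  proof (rule Limsup_bounded)
    show "\<forall>\<^sub>F n in sequentially. ereal (1 / speed n) * log_prob (prob_max n F) \<le> ereal c"
      using that speed_ge[of 1]
      by eventually_elim (intro log_prob_le prob_max_nonneg, auto)
  qed
  show ?thesis
  proof (cases "F \<inter> {2..} = {}")
    case True
    then have "2 \<notin> F" by auto
    then obtain y where y: "y < 2" "F \<inter> {..<2} \<subseteq> {..y}" using closed_gap_below[OF F] by blast
    have sub: "F \<subseteq> {..y}"
    proof
      fix z assume "z \<in> F"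
      with True have "z < 2" by (metis IntI atLeast_iff empty_iff not_le)
      with \<open>z \<in> F\<close> y(2) show "z \<in> {..y}" by auto
    qed
    have "?L \<le> ereal B" for B
    proof (rule limsupI)
      show "\<forall>\<^sub>F n in sequentially. prob_max n F \<le> exp (speed n * B)"
        using prob_max_left[OF y(1), of "- B"] real_ge[of 1]
      proof eventually_elim
        case (elim n)
        have "prob_max n F \<le> prob_max n {..y}" using elim by (intro prob_max_mono sub) auto
        with elim(1) show ?case by (simp add: mult.commute)
      qed
    qed
    then have "?L = - \<infinity>" by (rule ereal_bot)
    then show ?thesis by simp
  next
    case False
    define x where "x = Inf (F \<inter> {2..})"
    have "x \<in> F \<inter> {2..}" unfolding x_def
      by (intro closed_contains_Inf False closed_Int F) (auto intro: bdd_belowI[of _ 2])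
    then have x: "x \<in> F" "2 \<le> x" by auto
    have least: "x \<le> z" if "z \<in> F" "2 \<le> z" for z
      unfolding x_def using that by (intro cInf_lower) (auto intro: bdd_belowI[of _ 2])
    have "?L \<le> - ereal (excess x)"
    proof (cases "x = 2")
      case True
      have "?L \<le> ereal 0"
        by (rule limsupI) (use real_ge[of 1] in \<open>eventually_elim, auto intro: prob_max_le_1\<close>)
      then show ?thesis using True by (simp add: excess_2 zero_ereal_def)
    next
      case False
      then have x2: "2 < x" using x by simp
      then have "2 \<notin> F" using least[of 2] by auto
      then obtain y where y: "y < 2" "F \<inter> {..<2} \<subseteq> {..y}" using closed_gap_below[OF F] by blast
      have sub: "F \<subseteq> {..y} \<union> {x..}"
      proof
        fix z assume z: "z \<in> F"
        show "z \<in> {..y} \<union> {x..}"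
        proof (cases "z < 2")
          case True
          with z y(2) show ?thesis by auto
        next
          case False
          with z least[of z] show ?thesis by auto
        qed
      qed
      show ?thesis
      proof (rule ereal_le_epsilon2)
        fix e :: real assume e: "0 < e"
        then have e2: "e / 2 > 0" by simp
        have "?L \<le> ereal (- excess x + e)"
        proof (rule limsupI)
          show "\<forall>\<^sub>F n in sequentially. prob_max n F \<le> exp (speed n * (- excess x + e))"
            using prob_max_left[OF y(1), of "excess x - e / 2"] prob_max_right_upper[OF x2 e2]
              real_ge[of 1] speed_ge[of "ln 2 / (e / 2)"]
          proof eventually_elim
            case (elim n)
            have n: "n \<ge> 1" using elim by simp
            let ?b = "exp (speed n * (- excess x + e / 2))"
            have "exp (- ((excess x - e / 2) * speed n)) = ?b" by (simp add: algebra_simps)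
            then have "prob_max n {..y} + prob_max n {x..} \<le> 2 * ?b" using elim(1,2) by simp
            moreover have "prob_max n F \<le> prob_max n ({..y} \<union> {x..})" by (intro prob_max_mono n sub) auto
            moreover have "prob_max n ({..y} \<union> {x..}) \<le> prob_max n {..y} + prob_max n {x..}"
              by (intro prob_max_Un n) auto
            ultimately have "prob_max n F \<le> 2 * ?b" by linarith
            also have "\<dots> = exp (ln 2) * ?b" by simp
            also have "\<dots> \<le> exp (speed n * (e / 2)) * ?b"
            proof (rule mult_right_mono)
              have "ln 2 \<le> speed n * (e / 2)" using elim(4) e2 by (simp only: pos_divide_le_eq)
              then show "exp (ln 2) \<le> exp (speed n * (e / 2))" by (simp only: exp_le_cancel_iff)
            qed simp
            also have "\<dots> = exp (speed n * (- excess x + e))" by (simp add: exp_add[symmetric] algebra_simps)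
            finally show ?case .
          qed
        qed
        then show "?L \<le> - ereal (excess x) + ereal e" by simp
      qed
    qed
    also have "- ereal (excess x) \<le> - (INF x\<in>F. rate_J x)"
    proof -
      have "(INF x\<in>F. rate_J x) \<le> rate_J x" using x(1) by (rule INF_lower)
      then show ?thesis using x(2) by (simp add: rate_J_eq flip: uminus_ereal.simps)
    qed
    finally show ?thesis .
  qed
qed

text \<open>
  Each point \<open>x \<ge> 2\<close> of \<open>G\<close> is approached from the right, so that the edge \<open>x = 2\<close> is covered as well.
\<close>

lemma liminf_log_prob_max:
  assumes G: "open G"
  shows "- (INF x\<in>G. rate_J x) \<le> liminf (\<lambda>n. ereal (1 / speed n) * log_prob (prob_max n G))"
proof -
  let ?L = "liminf (\<lambda>n. ereal (1 / speed n) * log_prob (prob_max n G))"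
  have "- ?L \<le> rate_J x" if x: "x \<in> G" for x
  proof (cases "2 \<le> x")
    case True
    obtain r where r: "r > 0" "ball x r \<subseteq> G" using openE[OF G x] by blast
    have "- ereal (excess x) \<le> ?L"
    proof (rule ereal_le_epsilon2)
      fix e :: real assume e: "0 < e"
      then have e2: "e / 2 > 0" by simp
      obtain d where d: "d > 0" "\<And>y. x \<le> y \<Longrightarrow> y < x + d \<Longrightarrow> excess y < excess x + e / 2"
        using excess_right_continuous[OF True e2] by blast
      define u where "u = x + min (d / 2) (r / 2)"
      have m: "0 < min (d / 2) (r / 2)" "min (d / 2) (r / 2) \<le> d / 2" "min (d / 2) (r / 2) \<le> r / 2" using d(1) r(1) by auto
      have u: "x < u" "u < x + d" "u < x + r" "2 < u" using m d(1) r(1) True unfolding u_def by linarith+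
      have exu: "excess u \<le> excess x + e / 2" using d(2)[of u] u by simp
      have "{u<..<x + r} \<subseteq> ball x r" using u by (auto simp: dist_real_def)
      then have sub: "{u<..<x + r} \<subseteq> G" using r(2) by blast
      have "ereal (- excess x - e) \<le> ?L"
      proof (rule Liminf_bounded)
        show "\<forall>\<^sub>F n in sequentially. ereal (- excess x - e) \<le> ereal (1 / speed n) * log_prob (prob_max n G)"
          using prob_max_interval_lower[OF u(4) u(3) e2] real_ge[of 1] speed_ge[of 1]
        proof eventually_elim
          case (elim n)
          have "speed n * (- excess x - e) \<le> speed n * (- excess u - e / 2)"
            using exu elim by (intro mult_left_mono) auto
          then have "exp (speed n * (- excess x - e)) \<le> exp (speed n * (- excess u - e / 2))" by simp
          also note elim(1)
          also have "prob_max n {u<..<x + r} \<le> prob_max n G" using elim G by (intro prob_max_mono sub) auto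
          finally show ?case using elim by (intro log_prob_ge) auto
        qed
      qed
      then have "ereal (- excess x - e) + ereal e \<le> ?L + ereal e" by (rule add_right_mono)
      then show "- ereal (excess x) \<le> ?L + ereal e" by simp
    qed
    then have "- ?L \<le> ereal (excess x)" using ereal_uminus_le_reorder by blast
    then show ?thesis using True by (simp add: rate_J_eq)
  qed (simp add: rate_J_eq)
  then have "- ?L \<le> (INF x\<in>G. rate_J x)" by (rule INF_greatest)
  then show ?thesis by (simp add: ereal_uminus_le_reorder)
qed

end

theorem theorem1p1:
  fixes \<beta> \<alpha> :: "nat \<Rightarrow> real"
  assumes "\<And>n. n \<ge> 1 \<Longrightarrow> \<beta> n > 0"
    and "(\<lambda>n. ln (real n) / real n) \<lless> \<beta>"
    and "\<beta> \<lless> (\<lambda>n. 1 / ln (real n))"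
    and "\<And>n. n \<ge> 1 \<Longrightarrow> \<alpha> n = real n * \<beta> n / 2"
  shows "large_deviations_principle (\<lambda>n. gbe n (\<alpha> n) (\<beta> n)) lambda_max
           (\<lambda>n. real n * \<beta> n) rate_J"
proof -
  interpret beta_regime \<beta>
    using assms(1,2) by unfold_locales (simp_all add: much_less_def)
  have prob: "\<forall>\<^sub>F n in sequentially. ereal (1 / (real n * \<beta> n)) *
        log_prob \<P>(\<omega> in gbe n (\<alpha> n) (\<beta> n). lambda_max n \<omega> \<in> F)
      = ereal (1 / speed n) * log_prob (prob_max n F)" for F
    using eventually_ge_at_top[of 1]
    by eventually_elim (simp add: assms(4) prob_max_def speed_def)
  show ?thesis
    unfolding large_deviations_principle_def
  proof (intro conjI allI impI)
    show "filterlim (\<lambda>n. real n * \<beta> n) at_top sequentially"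
      using speed_at_top by (simp add: speed_def[abs_def])
    show "0 \<le> rate_J x" for x
      by (simp add: rate_J_eq excess_nonneg)
    show "lower_semicontinuous rate_J" by (rule lower_semicontinuous_rate_J)
  next
    fix F :: "real set" assume "closed F"
    then show "limsup (\<lambda>n. ereal (1 / (real n * \<beta> n)) *
        log_prob \<P>(\<omega> in gbe n (\<alpha> n) (\<beta> n). lambda_max n \<omega> \<in> F)) \<le> - (INF x\<in>F. rate_J x)"
      using limsup_log_prob_max by (simp add: Limsup_eq[OF prob])
  next
    fix G :: "real set" assume "open G"
    then show "- (INF x\<in>G. rate_J x) \<le> liminf (\<lambda>n. ereal (1 / (real n * \<beta> n)) *
        log_prob \<P>(\<omega> in gbe n (\<alpha> n) (\<beta> n). lambda_max n \<omega> \<in> G))"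
      using liminf_log_prob_max by (simp add: Liminf_eq[OF prob])
  qed
qed

end
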